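(* Let $\mathcal X,\mathcal Y,\mathcal Z$ be finite sets and, for each $k\in\mathbb N$, let $W_{1k}:\mathcal X\to\mathcal Y$ and $W_{2k}:\mathcal Y\to\mathcal Z$ be channels. Consider the degraded, discrete, memoryless but non-stationary wiretap channel $\mathbf W=\{W^n\}_{n\in\mathbb N}$ given by $$W^n(\mathbf y,\mathbf z|\mathbf x)=\prod_{k=1}^nW_{1k}(y_k|x_k)\,W_{2k}(z_k|y_k).$$ Put $W_{\mathcal Y,k}(y|x):=W_{1k}(y|x)$ and $W_{\mathcal Z,k}(z|x):=\sum_{y\in\mathcal Y}W_{1k}(y|x)W_{2k}(z|y)$, and assume that all the channels $W_{\mathcal Y,k}$ and $W_{\mathcal Z,k}$, $k\in\mathbb N$, are weakly symmetric. If the limits $$\lim_{n\to\infty}\frac1n\sum_{k=1}^nC(W_{\mathcal Y,k})\qquad\text{and}\qquad\lim_{n\to\infty}\frac1n\sum_{k=1}^nC(W_{\mathcal Z,k})$$ both exist, where $C(\cdot)$ denotes Shannon capacity, then for every $i\in\{1,2,3,4,5,6\}$, $\mathbf W$ satisfies the partial strong converse under secrecy metric $i$.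
   Context: A discrete channel $V:\mathcal X\to\mathcal Y$ is weakly symmetric if the rows of its transition probability matrix are permutations of each other and the column sums $\sum_{x\in\mathcal X}V(y|x)$ do not depend on $y$. The Shannon capacity is $C(V)=\max_{P_X}I(X;Y)$. The marginal of $W^n$ to the legitimate receiver is $W^n_{\mathcal Y}(\mathbf y|\mathbf x)=\sum_{\mathbf z}W^n(\mathbf y,\mathbf z|\mathbf x)$. Logarithms are to an arbitrary fixed base. Secrecy metrics. Let $(M,Z^n)\sim P:=P_{MZ^n}$ and $Q:=P_M\times P_{Z^n}$. With $\mathbb V(P,Q)=\sup_{\mathcal A}|P(\mathcal A)-Q(\mathcal A)|$ the variational distance, $D$ the relative entropy, and $\eta>0$: $\mathbb S_1=D(P\|Q)$; $\mathbb S_2=\mathbb V(P,Q)$; $\mathbb S_3^\eta=\Pr\big(\log\frac{P(M,Z^n)}{Q(M,Z^n)}>\eta\big)$; $\mathbb S_4=\frac1nD(P\|Q)$; $\mathbb S_5=\frac1n\mathbb V(P,Q)$; $\mathbb S_6^\eta=\Pr\big(\frac1n\log\frac{P(M,Z^n)}{Q(M,Z^n)}>\eta\big)$. Codes. An $(n,M_n,\varepsilon_n,\delta_n)$-wiretap code for secrecy metric $i\in\{1,\dots,6\}$ consists of a message set $\mathcal M_n=\{1,\dots,M_n\}$, a stochastic encoder $Q_{X^n|M}:\mathcal M_n\to\mathcal X^n$ and a decoder $\varphi_n:\mathcal Y^n\to\mathcal M_n$ such that, with the message $M$ uniform on $\mathcal M_n$, the average error probability satisfies $\frac1{M_n}\sum_{m}\sum_{\mathbf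 x}Q_{X^n|M}(\mathbf x|m)W^n_{\mathcal Y}(\mathcal Y^n\setminus\varphi_n^{-1}(m)|\mathbf x)\le\varepsilon_n$, and the leakage satisfies $\mathbb S_i(P_{MZ^n},P_M\times P_{Z^n})\le\delta_n$. For $i=3,6$, the requirement "$\delta_n\to0$" below is imposed for every $\eta>0$, i.e. $\mathbb S_i^\eta\to0$ for every $\eta>0$. Capacities. The $(i)$-capacity $C^{(i)}(\mathbf W)$ is the supremum of all $R\in\mathbb R$ for which there is a sequence of $(n,M_n,\varepsilon_n,\delta_n)$-wiretap codes for secrecy metric $i$ with $\lim_n\varepsilon_n=0$, $\lim_n\delta_n=0$ and $\liminf_n\frac1n\log M_n\ge R$. The $(i)$-optimistic capacity $\overline C^{(i)}(\mathbf W)$ is the infimum of all $R\in\mathbb R$ such that every sequence of $(n,M_n,\varepsilon_n,\delta_n)$-wiretap codes for secrecy metric $i$ with $\liminf_n\frac1n\log M_n\ge R$ and $\lim_n\delta_n=0$ satisfies $\liminf_n\varepsilon_n\ge1$. The channel $\mathbf W$ satisfies the partial strong converse under secrecy metric $i$ if $C^{(i)}(\mathbf W)=\overline C^{(i)}(\mathbf W)$. *)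

theory Defs
  imports "HOL-Probability.Probability"
begin

section \<open>Discrete channels\<close>

text \<open>
  A channel with finite input and output alphabets is a map \<^typ>\<open>'x \<Rightarrow> 'y pmf\<close> over types of
  class \<^class>\<open>finite\<close>; the transition probability $V(y|x)$ is \<open>pmf (V x) y\<close>.
\<close>

definition weakly_symmetric :: "('x::finite \<Rightarrow> 'y::finite pmf) \<Rightarrow> bool" where
  "weakly_symmetric V \<longleftrightarrow>
     (\<forall>x x'. \<exists>\<pi>. bij \<pi> \<and> (\<forall>y. pmf (V x') y = pmf (V x) (\<pi> y))) \<and>
     (\<forall>y y'. (\<Sum>x\<in>UNIV. pmf (V x) y) = (\<Sum>x\<in>UNIV. pmf (V x) y'))"

definition joint_pmf :: "'x pmf \<Rightarrow> ('x \<Rightarrow> 'y pmf) \<Rightarrow> ('x \<times> 'y) pmf" where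
  "joint_pmf p V = bind_pmf p (\<lambda>x. map_pmf (Pair x) (V x))"

definition input_output_information ::
    "real \<Rightarrow> 'x::finite pmf \<Rightarrow> ('x \<Rightarrow> 'y::finite pmf) \<Rightarrow> real" where
  "input_output_information b p V =
     prob_space.mutual_information (measure_pmf (joint_pmf p V)) b
       (count_space UNIV) (count_space UNIV) fst snd"

text \<open>
  The supremum over input distributions is a maximum, by compactness of the probability simplex.
\<close>

definition shannon_capacity :: "real \<Rightarrow> ('x::finite \<Rightarrow> 'y::finite pmf) \<Rightarrow> real" where
  "shannon_capacity b V = (SUP p. input_output_information b p V)"


section \<open>Wiretap channels\<close>

text \<open>
  A word of length $n$ is an extensional function on \<open>{1..n}\<close>, so the $k$-th letter of
  \<open>x\<close> is \<open>x k\<close> with $1 \le k \le n$. The value of a channel \<open>W n\<close> on inputs outside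
  \<open>words n\<close> is irrelevant.
\<close>

type_synonym 'a word = "nat \<Rightarrow> 'a"

type_synonym ('x, 'y, 'z) wiretap_channel = "nat \<Rightarrow> 'x word \<Rightarrow> ('y word \<times> 'z word) pmf"

definition words :: "nat \<Rightarrow> 'a word set" where
  "words n = {1..n} \<rightarrow>\<^sub>E UNIV"

definition main_marginal :: "('x, 'y, 'z) wiretap_channel \<Rightarrow> nat \<Rightarrow> 'x word \<Rightarrow> 'y word pmf" where
  "main_marginal W n x = map_pmf fst (W n x)"

text \<open>
  Independent pairs $(y_k, z_k)$, $1 \le k \le n$, with $y_k$ drawn from \<open>W1 k (x k)\<close> and $z_k$
  drawn from \<open>W2 k (y k)\<close>. The default \<open>(undefined, undefined)\<close> outside \<open>{1..n}\<close> makes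
  both components extensional. The product formula for the transition probabilities is the lemma
  \<open>pmf_degraded_wiretap_channel\<close> below.
\<close>

definition degraded_wiretap_channel ::
    "(nat \<Rightarrow> 'x \<Rightarrow> 'y pmf) \<Rightarrow> (nat \<Rightarrow> 'y \<Rightarrow> 'z pmf) \<Rightarrow> ('x, 'y, 'z) wiretap_channel" where
  "degraded_wiretap_channel W1 W2 n x =
     map_pmf (\<lambda>f. (fst \<circ> f, snd \<circ> f))
       (Pi_pmf {1..n} (undefined, undefined) (\<lambda>k. joint_pmf (W1 k (x k)) (W2 k)))"

definition cascade :: "('x \<Rightarrow> 'y pmf) \<Rightarrow> ('y \<Rightarrow> 'z pmf) \<Rightarrow> 'x \<Rightarrow> 'z pmf" where
  "cascade V1 V2 x = bind_pmf (V1 x) V2"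

lemma pmf_cascade:
  fixes V1 :: "'x \<Rightarrow> 'y::finite pmf"
  shows "pmf (cascade V1 V2 x) z = (\<Sum>y\<in>UNIV. pmf (V1 x) y * pmf (V2 y) z)"
  unfolding cascade_def pmf_bind
  by (subst integral_measure_pmf_real[of UNIV]) (auto simp: mult.commute)

lemma pmf_joint_pmf: "pmf (joint_pmf p V) (x, y) = pmf p x * pmf (V x) y"
proof -
  have "pmf (map_pmf (Pair a) (V a)) (x, y) = (if a = x then pmf (V x) y else 0)" for a
  proof (cases "a = x")
    case True
    then show ?thesis by (simp add: pmf_map_inj' inj_on_def)
  next
    case False
    then have "(x, y) \<notin> set_pmf (map_pmf (Pair a) (V a))" by auto
    with False show ?thesis by (simp add: pmf_eq_0_set_pmf)
  qed
  then have "pmf (joint_pmf p V) (x, y) =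
      measure_pmf.expectation p (\<lambda>a. if a = x then pmf (V x) y else 0)"
    by (simp add: joint_pmf_def pmf_bind)
  also have "\<dots> = pmf p x * pmf (V x) y"
    by (subst integral_measure_pmf_real[of "{x}"]) (auto split: if_splits)
  finally show ?thesis .
qed

lemma pmf_degraded_wiretap_channel:
  fixes y :: "'y word" and z :: "'z word"
  assumes "y \<in> words n" "z \<in> words n"
  shows "pmf (degraded_wiretap_channel W1 W2 n x) (y, z) =
           (\<Prod>k=1..n. pmf (W1 k (x k)) (y k) * pmf (W2 k (y k)) (z k))"
proof -
  let ?h = "\<lambda>f::nat \<Rightarrow> 'y \<times> 'z. (fst \<circ> f, snd \<circ> f)"
  let ?f = "\<lambda>k. (y k, z k)"
  have "inj ?h"
    by (rule injI) (simp add: fun_eq_iff prod_eq_iff)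
  moreover have "?h ?f = (y, z)"
    by (auto simp: fun_eq_iff)
  ultimately have "pmf (degraded_wiretap_channel W1 W2 n x) (y, z) =
      pmf (Pi_pmf {1..n} (undefined, undefined) (\<lambda>k. joint_pmf (W1 k (x k)) (W2 k))) ?f"
    using pmf_map_inj'[of ?h _ ?f] by (simp add: degraded_wiretap_channel_def)
  also have "\<dots> = (\<Prod>k=1..n. pmf (joint_pmf (W1 k (x k)) (W2 k)) (?f k))"
  proof (rule pmf_Pi')
    fix k assume "k \<notin> {1..n}"
    then show "?f k = (undefined, undefined)"
      using assms by (simp add: words_def PiE_def extensional_def)
  qed simp
  finally show ?thesis by (simp add: pmf_joint_pmf)
qed

lemma set_pmf_degraded_wiretap_channel:
  fixes W1 :: "nat \<Rightarrow> 'x \<Rightarrow> 'y pmf" and W2 :: "nat \<Rightarrow> 'y \<Rightarrow> 'z pmf"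
  shows
  "set_pmf (degraded_wiretap_channel W1 W2 n x) \<subseteq> words n \<times> words n"
proof -
  have "set_pmf (Pi_pmf {1..n} (undefined, undefined) (\<lambda>k. joint_pmf (W1 k (x k)) (W2 k)))
      \<subseteq> {f. \<forall>k. k \<notin> {1..n} \<longrightarrow> f k = (undefined, undefined)}"
    by (rule set_Pi_pmf_subset) simp
  moreover have "(fst \<circ> f, snd \<circ> f) \<in> words n \<times> words n"
    if "\<forall>k. k \<notin> {1..n} \<longrightarrow> f k = (undefined, undefined)" for f :: "nat \<Rightarrow> 'y \<times> 'z"
    using that by (simp add: words_def PiE_def extensional_def)
  ultimately show ?thesis
    unfolding degraded_wiretap_channel_def set_map_pmf by blast
qed


section \<open>Secrecy metrics\<close>

definition variational_distance :: "'a pmf \<Rightarrow> 'a pmf \<Rightarrow> real" where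
  "variational_distance P Q = (SUP A. \<bar>measure_pmf.prob P A - measure_pmf.prob Q A\<bar>)"

text \<open>
  The library's \<^const>\<open>KL_divergence\<close> takes the reference measure first, so
  $D(P\|Q)$ is \<open>KL_divergence b Q P\<close>.
\<close>

definition relative_entropy :: "real \<Rightarrow> 'a pmf \<Rightarrow> 'a pmf \<Rightarrow> real" where
  "relative_entropy b P Q = KL_divergence b (measure_pmf Q) (measure_pmf P)"

definition log_ratio_tail :: "real \<Rightarrow> real \<Rightarrow> real \<Rightarrow> 'a pmf \<Rightarrow> 'a pmf \<Rightarrow> real" where
  "log_ratio_tail b c \<eta> P Q = measure_pmf.prob P {w. c * log b (pmf P w / pmf Q w) > \<eta>}"

datatype secrecy_metric = S1 | S2 | S3 | S4 | S5 | S6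

text \<open>Only \<open>S3\<close> and \<open>S6\<close> depend on the threshold \<open>\<eta>\<close>.\<close>

fun secrecy ::
    "real \<Rightarrow> secrecy_metric \<Rightarrow> nat \<Rightarrow> real \<Rightarrow> 'a pmf \<Rightarrow> 'a pmf \<Rightarrow> real" where
  "secrecy b S1 n \<eta> P Q = relative_entropy b P Q"
| "secrecy b S2 n \<eta> P Q = variational_distance P Q"
| "secrecy b S3 n \<eta> P Q = log_ratio_tail b 1 \<eta> P Q"
| "secrecy b S4 n \<eta> P Q = 1 / real n * relative_entropy b P Q"
| "secrecy b S5 n \<eta> P Q = 1 / real n * variational_distance P Q"
| "secrecy b S6 n \<eta> P Q = log_ratio_tail b (1 / real n) \<eta> P Q"


section \<open>Wiretap codes\<close>

type_synonym 'x encoder = "nat \<Rightarrow> 'x word pmf"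
type_synonym 'y decoder = "'y word \<Rightarrow> nat"

definition message_output_pmf ::
    "('x, 'y, 'z) wiretap_channel \<Rightarrow> nat \<Rightarrow> nat \<Rightarrow> 'x encoder \<Rightarrow> (nat \<times> 'z word) pmf" where
  "message_output_pmf W n M enc =
     joint_pmf (pmf_of_set {1..M}) (\<lambda>m. bind_pmf (enc m) (\<lambda>x. map_pmf snd (W n x)))"

definition leakage ::
    "real \<Rightarrow> secrecy_metric \<Rightarrow> ('x, 'y, 'z) wiretap_channel \<Rightarrow> nat \<Rightarrow> nat \<Rightarrow> 'x encoder
      \<Rightarrow> real \<Rightarrow> real" where
  "leakage b i W n M enc \<eta> =
     (let P = message_output_pmf W n M enc
      in secrecy b i n \<eta> P (pair_pmf (map_pmf fst P) (map_pmf snd P)))"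

definition average_error ::
    "('x::finite, 'y::finite, 'z::finite) wiretap_channel \<Rightarrow> nat \<Rightarrow> nat \<Rightarrow> 'x encoder
      \<Rightarrow> 'y decoder \<Rightarrow> real" where
  "average_error W n M enc dec =
     1 / real M * (\<Sum>m=1..M. \<Sum>x\<in>words n. pmf (enc m) x *
        measure_pmf.prob (main_marginal W n x) (words n - dec -` {m}))"

text \<open>
  The leakage bound \<open>\<delta>\<close> is a function of the threshold \<open>\<eta>\<close>, because the metrics
  \<open>S3\<close> and \<open>S6\<close> are to be controlled for every positive threshold. For the other metrics the
  leakage does not depend on \<open>\<eta>\<close>.
\<close>

definition wiretap_code ::
    "real \<Rightarrow> secrecy_metric \<Rightarrow> ('x::finite, 'y::finite, 'z::finite) wiretap_channel
      \<Rightarrow> nat \<Rightarrow> nat \<Rightarrow> real \<Rightarrow> (real \<Rightarrow> real) \<Rightarrow> 'x encoder \<Rightarrow> 'y decoder \<Rightarrow> bool" where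
  "wiretap_code b i W n M \<epsilon> \<delta> enc dec \<longleftrightarrow>
     M \<ge> 1 \<and>
     (\<forall>m\<in>{1..M}. set_pmf (enc m) \<subseteq> words n) \<and>
     dec \<in> words n \<rightarrow> {1..M} \<and>
     average_error W n M enc dec \<le> \<epsilon> \<and>
     (\<forall>\<eta>>0. leakage b i W n M enc \<eta> \<le> \<delta> \<eta>)"

definition wiretap_code_sequence ::
    "real \<Rightarrow> secrecy_metric \<Rightarrow> ('x::finite, 'y::finite, 'z::finite) wiretap_channel
      \<Rightarrow> (nat \<Rightarrow> nat) \<Rightarrow> (nat \<Rightarrow> real) \<Rightarrow> (nat \<Rightarrow> real \<Rightarrow> real)
      \<Rightarrow> (nat \<Rightarrow> 'x encoder) \<Rightarrow> (nat \<Rightarrow> 'y decoder) \<Rightarrow> bool" where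
  "wiretap_code_sequence b i W M \<epsilon> \<delta> enc dec \<longleftrightarrow>
     (\<forall>n\<ge>1. wiretap_code b i W n (M n) (\<epsilon> n) (\<delta> n) (enc n) (dec n))"

definition vanishing_leakage :: "(nat \<Rightarrow> real \<Rightarrow> real) \<Rightarrow> bool" where
  "vanishing_leakage \<delta> \<longleftrightarrow> (\<forall>\<eta>>0. (\<lambda>n. \<delta> n \<eta>) \<longlonglongrightarrow> 0)"

definition asymptotic_rate :: "real \<Rightarrow> (nat \<Rightarrow> nat) \<Rightarrow> ereal" where
  "asymptotic_rate b M = liminf (\<lambda>n. ereal (1 / real n * log b (real (M n))))"


section \<open>Capacities and the partial strong converse\<close>

definition secrecy_capacity ::
    "real \<Rightarrow> secrecy_metric \<Rightarrow> ('x::finite, 'y::finite, 'z::finite) wiretap_channel \<Rightarrow> ereal" where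
  "secrecy_capacity b i W =
     Sup {ereal R | R. \<exists>M \<epsilon> \<delta> enc dec.
       wiretap_code_sequence b i W M \<epsilon> \<delta> enc dec \<and>
       \<epsilon> \<longlonglongrightarrow> 0 \<and> vanishing_leakage \<delta> \<and> asymptotic_rate b M \<ge> ereal R}"

definition optimistic_secrecy_capacity ::
    "real \<Rightarrow> secrecy_metric \<Rightarrow> ('x::finite, 'y::finite, 'z::finite) wiretap_channel \<Rightarrow> ereal" where
  "optimistic_secrecy_capacity b i W =
     Inf {ereal R | R. \<forall>M \<epsilon> \<delta> enc dec.
       wiretap_code_sequence b i W M \<epsilon> \<delta> enc dec \<and>
       asymptotic_rate b M \<ge> ereal R \<and> vanishing_leakage \<delta> \<longrightarrow>
       liminf (\<lambda>n. ereal (\<epsilon> n)) \<ge> 1}"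

definition partial_strong_converse ::
    "real \<Rightarrow> secrecy_metric \<Rightarrow> ('x::finite, 'y::finite, 'z::finite) wiretap_channel \<Rightarrow> bool" where
  "partial_strong_converse b i W \<longleftrightarrow>
     secrecy_capacity b i W = optimistic_secrecy_capacity b i W"

end

(*
  Weak symmetry makes the information densities i_Y and i_Z, taken with respect to uniform outputs,
  have the capacities as their means for every input letter, and bounds their moment generating
  functions uniformly over all channels with the given alphabets. Hence both densities of a word
  of length n concentrate exponentially around the sums of the capacities, whatever the word.

  Converse: by degradedness log W(y|x,z) / Q(y|z) = i_Y - i_Z, where Q is the reverse channel from z
  to y for uniform y. A test between the joint distribution of message, z and y and the product of
  the uniform message distribution with P_Z and Q bounds the probability of correct decoding by
  the leakage tail, the two deviation probabilities, and a term that vanishes at every rate above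
  CY - CZ.

  Achievability: pairwise independent uniform codewords with a threshold decoder, and about
  exp(n CZ) codewords per message, make the error and the divergence of the eavesdropper's output
  from uniform tend to zero together, so that one code satisfies the strongest metric.
*)
theory Submission
  imports Defs
begin

section \<open>Capacity and moments of weakly symmetric channels\<close>

text \<open>The letter channels change with time and an encoder may use any word, so every estimate
  has to be uniform in the channel and in the word; the limits \<open>CY\<close> and
  \<open>CZ\<close> enter only at the very end, to turn sums of capacities into exponents.

  The six metrics are handled by a sandwich. A vanishing divergence makes all of them vanish; a
  vanishing metric other than \<open>S5\<close> makes the tail metric \<open>S6\<close> vanish.
  Achievability is therefore proved for the divergence alone and the converse for \<open>S6\<close>
  alone, with the common value \<open>CY - CZ\<close>. \<open>S5\<close> falls outside: it is at
  most \<open>1 / n\<close> for every code, its value is \<open>CY\<close>, and it is reached by the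
  same two arguments against an eavesdropper with constant output.

  Exponential moments replace variances because \<open>S1\<close> is not divided by the block
  length: through \<open>ln (1 + v) \<le> v powr s / s\<close> the divergence is bounded by such a
  moment directly, and the same moments give the tails.

  Of \<open>W2\<close> only the column sums can be recovered from the symmetry of the two marginals.
  That suffices to normalise the reverse channel of the converse.\<close>

lemma sum_pmf_UNIV: "(\<Sum>x\<in>UNIV. pmf (p :: 'a::finite pmf) x) = 1"
  by (simp add: sum_pmf_eq_1)

text \<open>The ratio of the point masses is the Radon-Nikodym derivative once the support of
  \<open>P\<close> lies in that of \<open>Q\<close>. Points of \<open>Q\<close> outside the support
  of \<open>P\<close> contribute \<open>0 * log b 0 = 0\<close>.\<close>

lemma KL_divergence_measure_pmf:
  fixes P Q :: "'a pmf"
  assumes "b > 1" and sub: "set_pmf P \<subseteq> set_pmf Q" and fin: "finite (set_pmf P)"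
  shows "KL_divergence b (measure_pmf Q) (measure_pmf P) =
    (\<Sum>w\<in>set_pmf P. pmf P w * log b (pmf P w / pmf Q w))"
proof -
  define f where "f = (\<lambda>w. pmf P w / pmf Q w)"
  have fQ: "pmf Q w * f w = pmf P w" for w
    using sub by (cases "w \<in> set_pmf Q") (auto simp: f_def set_pmf_iff)
  have "measure_pmf P = density (measure_pmf Q) (\<lambda>w. ennreal (f w))"
    unfolding measure_pmf_eq_density[of Q] measure_pmf_eq_density[of P]
    by (subst density_density_eq) (auto simp: fQ simp flip: ennreal_mult')
  then have "KL_divergence b (measure_pmf Q) (measure_pmf P) =
      (\<integral>w. f w * log b (f w) \<partial>measure_pmf Q)"
    using sigma_finite_measure.KL_density[OF measure_pmf.sigma_finite_measure_axioms \<open>b > 1\<close>, of f Q] by (simp add: f_def)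
  also have "\<dots> = (\<Sum>w\<in>set_pmf P. pmf Q w * (f w * log b (f w)))"
    by (subst integral_measure_pmf_real[OF fin]) (auto simp: f_def set_pmf_iff mult_ac)
  also have "\<dots> = (\<Sum>w\<in>set_pmf P. pmf P w * log b (f w))"
    using fQ by (intro sum.cong) (auto simp flip: mult.assoc)
  finally show ?thesis by (simp add: f_def)
qed

lemma input_output_information_eq:
  fixes p :: "'x::finite pmf" and V :: "'x \<Rightarrow> 'y::finite pmf"
  assumes "b > 1"
  shows "input_output_information b p V =
    (\<Sum>x\<in>UNIV. \<Sum>y\<in>UNIV. pmf p x * pmf (V x) y *
       log b (pmf p x * pmf (V x) y / (pmf p x * pmf (bind_pmf p V) y)))"
proof -
  let ?J = "joint_pmf p V"
  interpret information_space "measure_pmf ?J" b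
    using \<open>b > 1\<close> by unfold_locales
  have map1: "map_pmf fst ?J = p" and map2: "map_pmf snd ?J = bind_pmf p V"
    by (simp_all add: joint_pmf_def map_bind_pmf pmf.map_comp o_def bind_return_pmf' map_pmf_const)
  have sf: "simple_function (measure_pmf ?J) (g :: 'x \<times> 'y \<Rightarrow> 'c)" for g
    by (simp add: simple_function_def)
  have p1: "pmf p x = measure ?J (fst -` {x})" for x
    by (metis map1 pmf_map)
  have p2: "pmf (bind_pmf p V) y = measure ?J (snd -` {y})" for y
    by (metis map2 pmf_map)
  have p3: "pmf ?J w = measure ?J ((\<lambda>w. (fst w, snd w)) -` {w})" for w
    by (simp add: vimage_def measure_pmf_single)
  have X: "simple_distributed (measure_pmf ?J) fst (pmf p)"
    by (rule measure_pmf.simple_distributedI[OF sf]) (simp_all add: p1)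
  have Y: "simple_distributed (measure_pmf ?J) snd (pmf (bind_pmf p V))"
    by (rule measure_pmf.simple_distributedI[OF sf]) (simp_all add: p2)
  have XY: "simple_distributed (measure_pmf ?J) (\<lambda>w. (fst w, snd w)) (pmf ?J)"
    by (rule measure_pmf.simple_distributedI[OF sf]) (simp_all add: p3)
  have "prob_space.mutual_information ?J b (count_space UNIV) (count_space UNIV) fst snd =
    (\<Sum>(x, y)\<in>UNIV. pmf ?J (x, y) * log b (pmf ?J (x, y) / (pmf p x * pmf (bind_pmf p V) y)))"
    using mutual_information_simple_distributed[OF X Y XY] by simp
  then show ?thesis
    unfolding input_output_information_def pmf_joint_pmf
    by (simp add: UNIV_Times_UNIV[symmetric] sum.cartesian_product del: UNIV_Times_UNIV)
qed

text \<open>Equal columns share the total mass \<open>CARD('x)\<close> of the rows evenly. In other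
  words, a uniform input produces a uniform output.\<close>

lemma weakly_symmetric_column:
  fixes V :: "'x::finite \<Rightarrow> 'y::finite pmf"
  assumes "weakly_symmetric V"
  shows "(\<Sum>x\<in>UNIV. pmf (V x) y) = real CARD('x) / real CARD('y)"
proof -
  have "real CARD('y) * (\<Sum>x\<in>UNIV. pmf (V x) y) = (\<Sum>y'\<in>(UNIV::'y set). \<Sum>x\<in>UNIV. pmf (V x) y)"
    by simp
  also have "\<dots> = (\<Sum>y'\<in>UNIV. \<Sum>x\<in>UNIV. pmf (V x) y')"
    using assms unfolding weakly_symmetric_def by metis
  also have "\<dots> = (\<Sum>x\<in>UNIV. \<Sum>y'\<in>UNIV. pmf (V x) y')"
    by (rule sum.swap)
  also have "\<dots> = real CARD('x)"
    by (simp add: sum_pmf_UNIV)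
  finally show ?thesis by (simp add: field_simps)
qed

lemma weakly_symmetric_row_sum:
  fixes V :: "'x::finite \<Rightarrow> 'y::finite pmf" and g :: "real \<Rightarrow> real"
  assumes "weakly_symmetric V"
  shows "(\<Sum>y\<in>UNIV. g (pmf (V x) y)) = (\<Sum>y\<in>UNIV. g (pmf (V x') y))"
proof -
  obtain \<pi> where "bij \<pi>" and \<pi>: "\<And>y. pmf (V x) y = pmf (V x') (\<pi> y)"
    using assms unfolding weakly_symmetric_def by metis
  then show ?thesis
    using sum.reindex_bij_betw[of \<pi> UNIV UNIV "\<lambda>y. g (pmf (V x') y)"] by simp
qed

text \<open>The sum is the divergence of \<open>f\<close> from the uniform distribution on
  \<open>B\<close>, and \<open>ln t \<le> t - 1\<close> bounds it termwise. It gives the upper bound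
  on the capacity and later allows divergences of output laws to be dropped.\<close>

lemma sum_ln_uniform_nonneg:
  fixes f :: "'a \<Rightarrow> real"
  assumes "finite B" "B \<noteq> {}" "\<And>z. z \<in> B \<Longrightarrow> f z \<ge> 0" "(\<Sum>z\<in>B. f z) = 1"
  shows "0 \<le> (\<Sum>z\<in>B. f z * ln (real (card B) * f z))"
proof -
  let ?N = "real (card B)"
  have "?N > 0" using assms by (simp add: card_gt_0_iff)
  have "f z - 1 / ?N \<le> f z * ln (?N * f z)" if "z \<in> B" for z
  proof (cases "f z = 0")
    case False
    with assms(3)[OF that] have "f z > 0" by simp
    then have "ln (1 / (?N * f z)) \<le> 1 / (?N * f z) - 1"
      using \<open>?N > 0\<close> by (intro ln_le_minus_one) simp
    then have "f z * (1 - 1 / (?N * f z)) \<le> f z * ln (?N * f z)"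
      using \<open>?N > 0\<close> \<open>f z > 0\<close> by (intro mult_left_mono) (auto simp: ln_div)
    then show ?thesis using \<open>f z > 0\<close> by (simp add: right_diff_distrib)
  qed (use \<open>?N > 0\<close> in auto)
  then have "(\<Sum>z\<in>B. f z - 1 / ?N) \<le> (\<Sum>z\<in>B. f z * ln (?N * f z))"
    by (intro sum_mono)
  then show ?thesis using \<open>?N > 0\<close> assms by (simp add: sum_subtractf)
qed

text \<open>Mutual information equals the divergence of a row from uniform, the same for all rows,
  minus the divergence of the output law from uniform. A uniform input makes the subtracted term
  vanish, because the column sums are constant.\<close>

lemma shannon_capacity_weakly_symmetric:
  fixes V :: "'x::finite \<Rightarrow> 'y::finite pmf"
  assumes "b > 1" and ws: "weakly_symmetric V"
  shows "shannon_capacity b V = (\<Sum>y\<in>UNIV. pmf (V x) y * log b (real CARD('y) * pmf (V x) y))"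
    (is "_ = ?C")
proof -
  define N where "N = real CARD('y)"
  have "N > 0" by (simp add: N_def)
  define C where "C = ?C"
  have C: "(\<Sum>y\<in>UNIV. pmf (V x') y * log b (N * pmf (V x') y)) = C" for x'
    unfolding C_def N_def
    by (rule weakly_symmetric_row_sum[OF ws, of "\<lambda>v. v * log b (real CARD('y) * v)"])
  have eq: "input_output_information b p V =
      C - (\<Sum>y\<in>UNIV. pmf (bind_pmf p V) y * log b (N * pmf (bind_pmf p V) y))" for p
  proof -
    let ?q = "pmf (bind_pmf p V)"
    have q: "?q y = (\<Sum>x\<in>UNIV. pmf p x * pmf (V x) y)" for y
      unfolding pmf_bind by (subst integral_measure_pmf_real[of UNIV]) (auto simp: mult.commute)
    have "pmf p x * pmf (V x) y * log b (pmf p x * pmf (V x) y / (pmf p x * ?q y)) =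
       pmf p x * (pmf (V x) y * log b (N * pmf (V x) y)) - pmf p x * pmf (V x) y * log b (N * ?q y)"
      for x y
    proof (cases "pmf p x * pmf (V x) y = 0")
      case False
      then have pos: "pmf p x > 0" "pmf (V x) y > 0"
        by (auto simp: less_le)
      have "pmf p x * pmf (V x) y \<le> ?q y"
        unfolding q by (rule member_le_sum) auto
      with pos have "?q y > 0"
        by (smt (verit) mult_pos_pos)
      with pos \<open>N > 0\<close> \<open>b > 1\<close> show ?thesis
        by (simp add: log_mult log_divide algebra_simps)
    qed auto
    then have "input_output_information b p V =
       (\<Sum>x\<in>UNIV. pmf p x * (\<Sum>y\<in>UNIV. pmf (V x) y * log b (N * pmf (V x) y)))
       - (\<Sum>x\<in>UNIV. \<Sum>y\<in>UNIV. pmf p x * pmf (V x) y * log b (N * ?q y))"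
      by (simp add: input_output_information_eq[OF \<open>b > 1\<close>] sum_subtractf sum_distrib_left)
    also have "(\<Sum>x\<in>UNIV. \<Sum>y\<in>UNIV. pmf p x * pmf (V x) y * log b (N * ?q y)) =
       (\<Sum>y\<in>UNIV. ?q y * log b (N * ?q y))"
      by (subst sum.swap) (simp add: q sum_distrib_right)
    finally show ?thesis
      by (simp add: C sum_pmf_UNIV flip: sum_distrib_right)
  qed
  have le: "input_output_information b p V \<le> C" for p
  proof -
    have "0 \<le> (\<Sum>y\<in>UNIV. pmf (bind_pmf p V) y * ln (real CARD('y) * pmf (bind_pmf p V) y))"
      by (rule sum_ln_uniform_nonneg) (auto simp: sum_pmf_UNIV)
    then have "0 \<le> (\<Sum>y\<in>UNIV. pmf (bind_pmf p V) y * log b (N * pmf (bind_pmf p V) y))"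
      using \<open>b > 1\<close> by (simp add: log_def N_def flip: sum_divide_distrib)
    then show ?thesis by (simp add: eq)
  qed
  have unif: "input_output_information b (pmf_of_set UNIV) V = C"
  proof -
    have "pmf (bind_pmf (pmf_of_set UNIV) V) y = 1 / N" for y
      unfolding pmf_bind
      by (subst integral_measure_pmf_real[of UNIV])
         (auto simp: weakly_symmetric_column[OF ws] N_def simp flip: sum_divide_distrib)
    then show ?thesis using \<open>N > 0\<close> by (simp add: eq)
  qed
  have "(SUP p. input_output_information b p V) = C"
    using le unif by (intro cSup_eq_maximum) (auto intro!: image_eqI[where x = "pmf_of_set UNIV"])
  then show ?thesis by (simp add: shannon_capacity_def C_def)
qed

text \<open>
  The bound carries the extra factor \<open>v\<close> because \<open>ln v\<close> itself is unbounded as \<open>v\<close> tends to \<open>0\<close>: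
  uniformity over the channel, not only over \<open>s\<close>, is what the non-stationary setting needs.
\<close>

lemma powr_second_order_bound:
  fixes v N s :: real
  assumes "0 < v" "v \<le> N" "\<bar>s\<bar> \<le> 1 / 2"
  shows "v * v powr s \<le> v + s * (v * ln v) + s\<^sup>2 * (16 + N ^ 3 * v)"
proof -
  obtain t where t: "\<bar>t\<bar> \<le> \<bar>s * ln v\<bar>"
    and exp: "exp (s * ln v) = 1 + s * ln v + exp t / 2 * (s * ln v)\<^sup>2"
    using Maclaurin_exp_le[of "s * ln v" 2] by (auto simp: numeral_2_eq_2)
  have "t \<le> \<bar>ln v\<bar> / 2"
  proof -
    have "\<bar>s\<bar> * \<bar>ln v\<bar> \<le> 1 / 2 * \<bar>ln v\<bar>"
      using assms(3) by (rule mult_right_mono) simp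
    with t show ?thesis by (simp add: abs_mult)
  qed
  \<comment> \<open>For \<open>\<bar>s\<bar> \<le> 1 / 2\<close> the remainder loses at most a
    factor \<open>exp (\<bar>ln v\<bar> / 2)\<close>, the square root of \<open>1 / v\<close> or of
    \<open>v\<close>. Near 0 the weight \<open>v\<close> in front absorbs it.\<close>
  have main: "v * exp (\<bar>ln v\<bar> / 2) * (ln v)\<^sup>2 \<le> 16 + N ^ 3 * v"
  proof (cases "v \<le> 1")
    case True
    \<comment> \<open>In terms of the fourth root the left side is 16 times the square of
      \<open>r * ln r\<close>, whose modulus is at most 1. This is where the constant 16 comes
      from.\<close>
    define r where "r = exp (ln v / 4)"
    have "r > 0" "r \<le> 1" using True \<open>0 < v\<close> by (auto simp: r_def)
    have lnv: "ln v = 4 * ln r" by (simp add: r_def)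
    have v: "v = r ^ 4"
      using \<open>0 < v\<close> by (simp add: r_def flip: exp_of_nat_mult)
    have "ln (1 / r) \<le> 1 / r" using \<open>r > 0\<close> ln_le_minus_one[of "1 / r"] by simp
    then have "(- ln r) * r \<le> 1" using \<open>r > 0\<close> by (simp add: ln_div field_simps)
    then have "((- ln r) * r)\<^sup>2 \<le> 1"
      using \<open>r > 0\<close> \<open>r \<le> 1\<close> by (intro power_le_one) (auto intro!: mult_nonpos_nonneg)
    moreover have e: "exp (\<bar>ln v\<bar> / 2) = 1 / r\<^sup>2"
    proof -
      have "exp (\<bar>ln v\<bar> / 2) = exp (- (ln r) * 2)"
        using \<open>r > 0\<close> \<open>r \<le> 1\<close> lnv by simp
      also have "\<dots> = 1 / r\<^sup>2"
        using \<open>r > 0\<close> by (simp add: exp_minus exp_diff exp_double mult.commute[of _ 2] inverse_eq_divide)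
      finally show ?thesis .
    qed
    moreover have "v * exp (\<bar>ln v\<bar> / 2) * (ln v)\<^sup>2 = 16 * ((- ln r) * r)\<^sup>2"
      unfolding e unfolding lnv using \<open>r > 0\<close>
      by (subst v) (simp add: power_mult_distrib field_simps power2_eq_square power4_eq_xxxx)
    moreover have "N ^ 3 * v \<ge> 0" using assms by simp
    ultimately show ?thesis by simp
  next
    case False
    then have "v > 1" by simp
    \<comment> \<open>Above 1 crude estimates suffice: the exponential is at most \<open>N\<close>
      and the squared logarithm at most \<open>N\<^sup>2\<close>, where \<open>N\<close> will be the
      alphabet size.\<close>
    have "ln v \<le> N" using ln_le_minus_one[of v] assms by simp
    then have "(ln v)\<^sup>2 \<le> N\<^sup>2" using \<open>v > 1\<close> by (intro power_mono) auto
    moreover have "exp (\<bar>ln v\<bar> / 2) \<le> N"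
    proof -
      have "exp (\<bar>ln v\<bar> / 2) \<le> exp (ln v)"
        using \<open>v > 1\<close> by (subst exp_le_cancel_iff) simp
      then show ?thesis using assms by simp
    qed
    ultimately have "exp (\<bar>ln v\<bar> / 2) * (ln v)\<^sup>2 \<le> N * N\<^sup>2"
      using assms by (intro mult_mono) auto
    then have "v * (exp (\<bar>ln v\<bar> / 2) * (ln v)\<^sup>2) \<le> v * (N * N\<^sup>2)"
      using assms by (intro mult_left_mono) auto
    then show ?thesis by (simp add: mult_ac power2_eq_square power3_eq_cube)
  qed
  have "exp t / 2 \<le> exp (\<bar>ln v\<bar> / 2)"
    using \<open>t \<le> \<bar>ln v\<bar> / 2\<close> by (smt (verit) exp_gt_zero exp_le_cancel_iff field_sum_of_halves)
  then have "v * (exp t / 2) * (ln v)\<^sup>2 \<le> v * exp (\<bar>ln v\<bar> / 2) * (ln v)\<^sup>2"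
    using \<open>0 < v\<close> by (intro mult_right_mono mult_left_mono) auto
  with main have "s\<^sup>2 * (v * (exp t / 2) * (ln v)\<^sup>2) \<le> s\<^sup>2 * (16 + N ^ 3 * v)"
    by (intro mult_left_mono) auto
  moreover have "v * v powr s = v + s * (v * ln v) + s\<^sup>2 * (v * (exp t / 2) * (ln v)\<^sup>2)"
    using \<open>0 < v\<close> exp by (simp add: powr_def algebra_simps power_mult_distrib)
  ultimately show ?thesis by simp
qed

text \<open>The density with respect to the uniform output law. Its logarithm is the information
  density, whose mean is the capacity.\<close>

definition normalized_prob :: "'y::finite pmf \<Rightarrow> 'y \<Rightarrow> real" where
  "normalized_prob p y = real CARD('y) * pmf p y"

lemma normalized_prob_nonneg [simp]: "normalized_prob p y \<ge> 0"
  by (simp add: normalized_prob_def)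

text \<open>Summing the pointwise bound over the outputs turns its linear term into the capacity in
  natural units and its error into a constant that depends on the alphabet size only. The final
  \<open>1 + t \<le> exp t\<close> gives a form that multiplies over letters.\<close>

lemma moment_generating_bound:
  fixes V :: "'x::finite \<Rightarrow> 'y::finite pmf"
  assumes "b > 1" "weakly_symmetric V" "\<bar>s\<bar> \<le> 1 / 2"
  shows "(\<Sum>y\<in>UNIV. pmf (V x) y * normalized_prob (V x) y powr s)
    \<le> exp (s * (ln b * shannon_capacity b V) + s\<^sup>2 * (16 + real CARD('y) ^ 3))"
proof -
  define N where "N = real CARD('y)"
  have "N > 0" by (simp add: N_def)
  have pw: "pmf (V x) y * normalized_prob (V x) y powr s \<le>
     pmf (V x) y + s * (pmf (V x) y * ln (N * pmf (V x) y)) + s\<^sup>2 * (16 / N + N ^ 3 * pmf (V x) y)"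
    for y
  proof (cases "pmf (V x) y = 0")
    case True
    then show ?thesis using \<open>N > 0\<close> by simp
  next
    case False
    then have "pmf (V x) y > 0" by (simp add: less_le)
    then have "N * pmf (V x) y > 0" "N * pmf (V x) y \<le> N"
      using \<open>N > 0\<close> pmf_le_1[of "V x" y] by (auto simp: mult_le_cancel_left1)
    \<comment> \<open>The bound is used at \<open>N * pmf (V x) y\<close> and then divided by
      \<open>N\<close>: the constant 16 becomes \<open>16 / N\<close>, which sums to 16
      again.\<close>
    from powr_second_order_bound[OF this assms(3)] \<open>N > 0\<close>
    have "N * (pmf (V x) y * (N * pmf (V x) y) powr s) \<le>
      N * (pmf (V x) y + s * (pmf (V x) y * ln (N * pmf (V x) y))
         + s\<^sup>2 * (16 / N + N ^ 3 * pmf (V x) y))"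
      by (simp add: algebra_simps)
    then show ?thesis
      using \<open>N > 0\<close> by (simp add: normalized_prob_def N_def)
  qed
  have cap: "(\<Sum>y\<in>UNIV. pmf (V x) y * ln (N * pmf (V x) y)) = ln b * shannon_capacity b V"
    using \<open>b > 1\<close> unfolding shannon_capacity_weakly_symmetric[OF assms(1,2), of x] N_def
    by (simp add: log_def sum_distrib_left)
  have "(\<Sum>y\<in>UNIV. pmf (V x) y * normalized_prob (V x) y powr s) \<le>
     (\<Sum>y\<in>UNIV. pmf (V x) y + s * (pmf (V x) y * ln (N * pmf (V x) y))
        + s\<^sup>2 * (16 / N + N ^ 3 * pmf (V x) y))"
    by (intro sum_mono pw)
  also have "\<dots> = 1 + s * (ln b * shannon_capacity b V) + s\<^sup>2 * (16 + N ^ 3)"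
    by (simp add: sum.distrib cap sum_pmf_UNIV flip: sum_distrib_left) (simp add: N_def)
  also have "\<dots> \<le> exp (s * (ln b * shannon_capacity b V) + s\<^sup>2 * (16 + N ^ 3))"
    using exp_ge_add_one_self[of "s * (ln b * shannon_capacity b V) + s\<^sup>2 * (16 + N ^ 3)"]
    by (simp add: add_ac)
  finally show ?thesis by (simp add: N_def)
qed

section \<open>Product channels and the information density\<close>

lemma finite_words [simp]: "finite (words n :: 'a::finite word set)"
  unfolding words_def by (intro finite_PiE) auto

lemma card_words: "card (words n :: 'a::finite word set) = CARD('a) ^ n"
  by (simp add: words_def card_PiE)

lemma words_nonempty [simp]: "words n \<noteq> {}"
  by (simp add: words_def PiE_eq_empty_iff)

lemma card_words_pos [simp]: "card (words n :: 'a::finite word set) > 0"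
  by (simp add: card_gt_0_iff)

lemma sum_words_prod:
  fixes f :: "nat \<Rightarrow> 'a::finite \<Rightarrow> real"
  shows "(\<Sum>x\<in>words n. \<Prod>k=1..n. f k (x k)) = (\<Prod>k=1..n. \<Sum>a\<in>UNIV. f k a)"
  unfolding words_def by (rule prod_sum_PiE[symmetric]) auto

definition product_channel :: "(nat \<Rightarrow> 'x \<Rightarrow> 'y pmf) \<Rightarrow> nat \<Rightarrow> 'x word \<Rightarrow> 'y word pmf" where
  "product_channel V n x = Pi_pmf {1..n} undefined (\<lambda>k. V k (x k))"

lemma pmf_product_channel:
  "y \<in> words n \<Longrightarrow> pmf (product_channel V n x) y = (\<Prod>k=1..n. pmf (V k (x k)) (y k))"
  unfolding product_channel_def
  by (rule pmf_Pi') (auto simp: words_def PiE_def extensional_def)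

lemma set_pmf_product_channel: "set_pmf (product_channel V n x) \<subseteq> words n"
  unfolding product_channel_def
  by (rule order.trans[OF set_Pi_pmf_subset]) (auto simp: words_def PiE_def extensional_def)

lemma map_fst_joint_pmf [simp]: "map_pmf fst (joint_pmf p V) = p"
  by (simp add: joint_pmf_def map_bind_pmf pmf.map_comp o_def bind_return_pmf' map_pmf_const)

lemma map_snd_joint_pmf [simp]: "map_pmf snd (joint_pmf p V) = bind_pmf p V"
  by (simp add: joint_pmf_def map_bind_pmf pmf.map_comp o_def)

lemma main_marginal_degraded:
  "main_marginal (degraded_wiretap_channel W1 W2) n x = product_channel W1 n x"
proof -
  have "product_channel W1 n x =
      Pi_pmf {1..n} undefined (\<lambda>k. map_pmf fst (joint_pmf (W1 k (x k)) (W2 k)))"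
    by (simp add: product_channel_def)
  also have "\<dots> = map_pmf (\<lambda>h. fst \<circ> h)
      (Pi_pmf {1..n} (undefined, undefined) (\<lambda>k. joint_pmf (W1 k (x k)) (W2 k)))"
    by (rule Pi_pmf_map) auto
  finally show ?thesis
    by (simp add: main_marginal_def degraded_wiretap_channel_def pmf.map_comp o_def)
qed

lemma eavesdropper_marginal_degraded:
  "map_pmf snd (degraded_wiretap_channel W1 W2 n x) =
    product_channel (\<lambda>k. cascade (W1 k) (W2 k)) n x"
proof -
  have "product_channel (\<lambda>k. cascade (W1 k) (W2 k)) n x =
      Pi_pmf {1..n} undefined (\<lambda>k. map_pmf snd (joint_pmf (W1 k (x k)) (W2 k)))"
    by (simp add: product_channel_def cascade_def)
  also have "\<dots> = map_pmf (\<lambda>h. snd \<circ> h)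
      (Pi_pmf {1..n} (undefined, undefined) (\<lambda>k. joint_pmf (W1 k (x k)) (W2 k)))"
    by (rule Pi_pmf_map) auto
  finally show ?thesis
    by (simp add: degraded_wiretap_channel_def pmf.map_comp o_def)
qed

text \<open>Columns factor over the letters. The hypothesis speaks of column sums instead of weak
  symmetry because the converse applies it to \<open>W2\<close>, for which only the column sums are
  available.\<close>

lemma product_channel_column:
  fixes V :: "nat \<Rightarrow> 'x::finite \<Rightarrow> 'y::finite pmf"
  assumes "\<And>k y. 1 \<le> k \<Longrightarrow> (\<Sum>x\<in>UNIV. pmf (V k x) y) = real CARD('x) / real CARD('y)"
    and "y \<in> words n"
  shows "(\<Sum>x\<in>words n. pmf (product_channel V n x) y) =
    real (card (words n :: 'x word set)) / real (card (words n :: 'y word set))"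
proof -
  have "(\<Sum>x\<in>words n. pmf (product_channel V n x) y) =
      (\<Prod>k=1..n. \<Sum>a\<in>UNIV. pmf (V k a) (y k))"
    by (simp only: pmf_product_channel[OF assms(2)]
        sum_words_prod[where f = "\<lambda>k a. pmf (V k a) (y k)"])
  also have "\<dots> = (\<Prod>k=1..n. real CARD('x) / real CARD('y))"
    by (intro prod.cong refl assms) auto
  finally show ?thesis by (simp add: card_words power_divide)
qed

abbreviation (input) "total_capacity b V n \<equiv> \<Sum>k=1..n. shannon_capacity b (V k)"

text \<open>The sum of the capacities in natural units, whatever the base \<open>b\<close> is.\<close>

abbreviation (input) "sum_capacity b V n \<equiv> ln b * total_capacity b V n"

lemma product_moment_generating_bound:
  fixes V :: "nat \<Rightarrow> 'x::finite \<Rightarrow> 'y::finite pmf"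
  assumes "b > 1" "\<And>k. 1 \<le> k \<Longrightarrow> weakly_symmetric (V k)" "\<bar>s\<bar> \<le> 1 / 2"
  shows "(\<Sum>y\<in>words n. pmf (product_channel V n x) y *
      (real (card (words n :: 'y word set)) * pmf (product_channel V n x) y) powr s)
    \<le> exp (s * sum_capacity b V n + real n * (s\<^sup>2 * (16 + real CARD('y) ^ 3)))"
proof -
  have "(\<Sum>y\<in>words n. pmf (product_channel V n x) y *
      (real (card (words n :: 'y word set)) * pmf (product_channel V n x) y) powr s) =
    (\<Sum>y\<in>words n. \<Prod>k=1..n. pmf (V k (x k)) (y k) * normalized_prob (V k (x k)) (y k) powr s)"
  proof (rule sum.cong[OF refl])
    fix y :: "'y word" assume "y \<in> words n"
    then have p: "pmf (product_channel V n x) y = (\<Prod>k=1..n. pmf (V k (x k)) (y k))"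
      by (rule pmf_product_channel)
    have "real (card (words n :: 'y word set)) * pmf (product_channel V n x) y =
        (\<Prod>k=1..n. normalized_prob (V k (x k)) (y k))"
      by (simp add: p card_words normalized_prob_def prod.distrib)
    then show "pmf (product_channel V n x) y *
      (real (card (words n :: 'y word set)) * pmf (product_channel V n x) y) powr s =
      (\<Prod>k=1..n. pmf (V k (x k)) (y k) * normalized_prob (V k (x k)) (y k) powr s)"
      by (simp add: p prod.distrib prod_powr_distrib)
  qed
  also have "\<dots> = (\<Prod>k=1..n. \<Sum>y\<in>UNIV. pmf (V k (x k)) y * normalized_prob (V k (x k)) y powr s)"
    by (rule sum_words_prod)
  also have "\<dots> \<le> (\<Prod>k=1..n. exp (s * (ln b * shannon_capacity b (V k))
      + s\<^sup>2 * (16 + real CARD('y) ^ 3)))"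
    using assms by (intro prod_mono conjI moment_generating_bound sum_nonneg) auto
  also have "\<dots> = exp (s * sum_capacity b V n + real n * (s\<^sup>2 * (16 + real CARD('y) ^ 3)))"
    by (simp add: exp_sum[symmetric] sum.distrib sum_distrib_left mult_ac)
  finally show ?thesis .
qed

section \<open>Chernoff bounds for the information density\<close>

lemma exponent_choice:
  fixes \<gamma> K :: real
  assumes "\<gamma> > 0" "K > 0"
  obtains s c where "0 < s" "s \<le> 1 / 2" "c > 0" "- s * \<gamma> + s\<^sup>2 * K \<le> - c"
proof
  \<comment> \<open>The minimiser of \<open>- s * \<gamma> + s\<^sup>2 * K\<close>, capped at the
    range of the moment bound. With or without the cap at most half of the gain
    \<open>s * \<gamma>\<close> is lost.\<close>
  define s where "s = min (1 / 2) (\<gamma> / (2 * K))"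
  show "0 < s" "s \<le> 1 / 2" using assms by (auto simp: s_def)
  have "s * K \<le> \<gamma> / (2 * K) * K" using assms by (intro mult_right_mono) (auto simp: s_def)
  then have "s * K \<le> \<gamma> / 2" using assms by simp
  then have "s * (s * K) \<le> s * (\<gamma> / 2)" using \<open>0 < s\<close> by (intro mult_left_mono) auto
  then show "- s * \<gamma> + s\<^sup>2 * K \<le> - (s * \<gamma> / 2)" by (simp add: power2_eq_square)
  show "s * \<gamma> / 2 > 0" using \<open>0 < s\<close> assms by simp
qed

text \<open>Markov's inequality for a power of \<open>v\<close>, arranged for both tails: positive
  \<open>s\<close> for large values, negative \<open>s\<close> for small ones. As
  \<open>0 powr s = 0\<close> also for negative \<open>s\<close>, the lower tail requires
  \<open>v y = 0\<close> to be excluded, which positivity on the support does.\<close>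

lemma prob_le_powr_moment:
  fixes p :: "'a pmf" and v :: "'a \<Rightarrow> real"
  assumes "finite B" "set_pmf p \<subseteq> B" and pos: "\<And>y. y \<in> set_pmf p \<Longrightarrow> v y > 0"
    and D: "\<And>y. y \<in> D \<Longrightarrow> v y > 0 \<Longrightarrow> v y powr s \<ge> T" and "T > 0"
  shows "measure_pmf.prob p D \<le> (\<Sum>y\<in>B. pmf p y * v y powr s) / T"
proof -
  have "measure_pmf.prob p D = measure_pmf.prob p (D \<inter> set_pmf p)"
    by (simp add: measure_Int_set_pmf)
  also have "\<dots> = (\<Sum>y\<in>D \<inter> set_pmf p. pmf p y)"
    using assms by (intro measure_measure_pmf_finite) (auto intro: finite_subset)
  also have "\<dots> \<le> (\<Sum>y\<in>D \<inter> set_pmf p. pmf p y * v y powr s / T)"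
  proof (rule sum_mono)
    fix y assume y: "y \<in> D \<inter> set_pmf p"
    then have "1 \<le> v y powr s / T" using D pos \<open>T > 0\<close> by (simp add: field_simps)
    then have "pmf p y * 1 \<le> pmf p y * (v y powr s / T)" by (intro mult_left_mono) auto
    then show "pmf p y \<le> pmf p y * v y powr s / T" by simp
  qed
  also have "\<dots> \<le> (\<Sum>y\<in>B. pmf p y * v y powr s / T)"
    using assms by (intro sum_mono2) auto
  finally show ?thesis by (simp add: sum_divide_distrib)
qed

text \<open>Chernoff's method with the exponents \<open>s\<close> and \<open>- s\<close>; one rate
  serves both tails because the second-order term is even in \<open>s\<close>. The constant
  \<open>c\<close> is chosen before the word \<open>x\<close>, so no encoder can escape the
  concentration.\<close>

lemma information_density_tails:
  fixes V :: "nat \<Rightarrow> 'x::finite \<Rightarrow> 'y::finite pmf"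
  assumes "b > 1" and ws: "\<And>k. 1 \<le> k \<Longrightarrow> weakly_symmetric (V k)" and "\<gamma> > 0"
  shows "\<exists>c>0. \<forall>n x.
     measure_pmf.prob (product_channel V n x)
       {y. real (card (words n :: 'y word set)) * pmf (product_channel V n x) y
            \<le> exp (sum_capacity b V n - real n * \<gamma>)} \<le> exp (- c * real n) \<and>
     measure_pmf.prob (product_channel V n x)
       {y. real (card (words n :: 'y word set)) * pmf (product_channel V n x) y
            \<ge> exp (sum_capacity b V n + real n * \<gamma>)} \<le> exp (- c * real n)"
proof -
  define K where "K = 16 + real CARD('y) ^ 3"
  have "K > 0" by (simp add: K_def add_pos_nonneg)
  then obtain s c where s: "0 < s" "s \<le> 1 / 2" "c > 0" "- s * \<gamma> + s\<^sup>2 * K \<le> - c"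
    using exponent_choice \<open>\<gamma> > 0\<close> by blast
  note mgf = product_moment_generating_bound[of b V, OF \<open>b > 1\<close> ws]
  have e: "real n * (- s * \<gamma> + s\<^sup>2 * K) \<le> - c * real n" for n
    using mult_left_mono[OF s(4), of "real n"] by (simp add: mult.commute)
  let ?v = "\<lambda>n x y. real (card (words n :: 'y word set)) * pmf (product_channel V n x) y"
  have pos: "?v n x y > 0" if "y \<in> set_pmf (product_channel V n x)" for n x y
    using that by (intro mult_pos_pos) (auto simp: pmf_positive_iff)
  have low: "measure_pmf.prob (product_channel V n x)
       {y. ?v n x y \<le> exp (sum_capacity b V n - real n * \<gamma>)} \<le> exp (- c * real n)" for n x
  proof -
    let ?T = "exp (- s * (sum_capacity b V n - real n * \<gamma>))"
    have "?v n x y powr (- s) \<ge> ?T" 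
      if "?v n x y \<le> exp (sum_capacity b V n - real n * \<gamma>)" "?v n x y > 0" for y
      using powr_mono2'[of "- s" "?v n x y" "exp (sum_capacity b V n - real n * \<gamma>)"] that s
      by (simp add: powr_def)
    then have "measure_pmf.prob (product_channel V n x)
       {y. ?v n x y \<le> exp (sum_capacity b V n - real n * \<gamma>)} \<le>
       (\<Sum>y\<in>words n. pmf (product_channel V n x) y * ?v n x y powr (- s)) / ?T"
      by (intro prob_le_powr_moment pos) (auto simp: set_pmf_product_channel)
    also have "\<dots> \<le> exp (- s * sum_capacity b V n + real n * ((- s)\<^sup>2 * K)) / ?T"
      unfolding K_def using s by (intro divide_right_mono mgf) auto
    also have "\<dots> = exp (real n * (- s * \<gamma> + s\<^sup>2 * K))"
      by (simp add: algebra_simps flip: exp_diff)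
    also have "\<dots> \<le> exp (- c * real n)" using e by simp
    finally show ?thesis .
  qed
  have up: "measure_pmf.prob (product_channel V n x)
       {y. ?v n x y \<ge> exp (sum_capacity b V n + real n * \<gamma>)} \<le> exp (- c * real n)" for n x
  proof -
    let ?T = "exp (s * (sum_capacity b V n + real n * \<gamma>))"
    have "?v n x y powr s \<ge> ?T" 
      if "?v n x y \<ge> exp (sum_capacity b V n + real n * \<gamma>)" "?v n x y > 0" for y
      using powr_mono2[of s "exp (sum_capacity b V n + real n * \<gamma>)" "?v n x y"] that s
      by (simp add: powr_def)
    then have "measure_pmf.prob (product_channel V n x)
       {y. ?v n x y \<ge> exp (sum_capacity b V n + real n * \<gamma>)} \<le>
       (\<Sum>y\<in>words n. pmf (product_channel V n x) y * ?v n x y powr s) / ?T"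
      by (intro prob_le_powr_moment pos) (auto simp: set_pmf_product_channel)
    also have "\<dots> \<le> exp (s * sum_capacity b V n + real n * (s\<^sup>2 * K)) / ?T"
      unfolding K_def using s by (intro divide_right_mono mgf) auto
    also have "\<dots> = exp (real n * (- s * \<gamma> + s\<^sup>2 * K))"
      by (simp add: algebra_simps flip: exp_diff)
    also have "\<dots> \<le> exp (- c * real n)" using e by simp
    finally show ?thesis .
  qed
  show ?thesis using \<open>c > 0\<close> low up by (intro exI[of _ c] conjI allI)
qed

text \<open>Dividing the density by \<open>L\<close> cancels the linear term of the exponent and
  leaves the surplus \<open>\<gamma>\<close>. This moment bounds the divergence from uniform of a
  mixture of \<open>L\<close> random codewords.\<close>

lemma resolvability_moment_decay:
  fixes V :: "nat \<Rightarrow> 'x::finite \<Rightarrow> 'y::finite pmf"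
  assumes "b > 1" and ws: "\<And>k. 1 \<le> k \<Longrightarrow> weakly_symmetric (V k)" and "\<gamma> > 0"
  shows "\<exists>s c. 0 < s \<and> s \<le> 1 \<and> 0 < c \<and>
    (\<forall>n x L. exp (sum_capacity b V n + real n * \<gamma>) \<le> L \<longrightarrow>
       (\<Sum>y\<in>words n. pmf (product_channel V n x) y *
         (real (card (words n :: 'y word set)) * pmf (product_channel V n x) y / L) powr s)
       \<le> exp (- c * real n))"
proof -
  define K where "K = 16 + real CARD('y) ^ 3"
  have "K > 0" by (simp add: K_def add_pos_nonneg)
  then obtain s c where s: "0 < s" "s \<le> 1 / 2" "c > 0" "- s * \<gamma> + s\<^sup>2 * K \<le> - c"
    using exponent_choice \<open>\<gamma> > 0\<close> by blast
  let ?v = "\<lambda>n x y. real (card (words n :: 'y word set)) * pmf (product_channel V n x) y"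
  have "(\<Sum>y\<in>words n. pmf (product_channel V n x) y * (?v n x y / L) powr s) \<le> exp (- c * real n)"
    if L: "L \<ge> exp (sum_capacity b V n + real n * \<gamma>)" for n x L
  proof -
    let ?T = "exp (s * (sum_capacity b V n + real n * \<gamma>))"
    have "L > 0" using L by (smt (verit) exp_gt_zero)
    have "?T \<le> L powr s"
      using powr_mono2[of s "exp (sum_capacity b V n + real n * \<gamma>)" L] L s by (simp add: powr_def)
    have "(\<Sum>y\<in>words n. pmf (product_channel V n x) y * (?v n x y / L) powr s) =
        (\<Sum>y\<in>words n. pmf (product_channel V n x) y * ?v n x y powr s) / L powr s"
      using \<open>L > 0\<close> by (subst powr_divide) (auto simp: sum_divide_distrib)
    also have "\<dots> \<le> exp (s * sum_capacity b V n + real n * (s\<^sup>2 * K)) / ?T"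
      unfolding K_def using \<open>?T \<le> L powr s\<close> s
      by (intro frac_le product_moment_generating_bound \<open>b > 1\<close> ws sum_nonneg) auto
    also have "\<dots> = exp (real n * (- s * \<gamma> + s\<^sup>2 * K))"
      by (simp add: algebra_simps flip: exp_diff)
    also have "\<dots> \<le> exp (- c * real n)"
      using mult_left_mono[OF s(4), of "real n"] by (simp add: mult.commute)
    finally show ?thesis .
  qed
  with s show ?thesis by (intro exI[of _ s] exI[of _ c] conjI allI impI) auto
qed

section \<open>Random coding\<close>

lemma expectation_finite_pmf:
  assumes "finite (set_pmf p)"
  shows "measure_pmf.expectation p f = (\<Sum>w\<in>set_pmf p. pmf p w * (f w :: real))"
  using assms by (subst integral_measure_pmf_real[of "set_pmf p"]) (auto simp: mult.commute)

lemma exists_le_expectation: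
  fixes f :: "'a \<Rightarrow> real"
  assumes "finite (set_pmf p)" "measure_pmf.expectation p f \<le> c"
  shows "\<exists>w\<in>set_pmf p. f w \<le> c"
proof (rule ccontr)
  assume "\<not> ?thesis"
  then have "(\<Sum>w\<in>set_pmf p. pmf p w * c) < (\<Sum>w\<in>set_pmf p. pmf p w * f w)"
    using assms(1) set_pmf_not_empty[of p]
    by (intro sum_strict_mono) (auto simp: pmf_positive not_le)
  then show False
    using assms expectation_finite_pmf[OF assms(1), of f]
    by (simp add: sum_pmf_eq_1 flip: sum_distrib_right)
qed

text \<open>Powers with exponent at most 1 are subadditive, so
  \<open>(1 + v) powr s \<le> 1 + v powr s\<close>, and \<open>ln (1 + u) \<le> u\<close> finishes.
  A logarithm is thereby traded for a fractional moment, which decays exponentially in the block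
  length.\<close>

lemma ln_one_plus_le_powr:
  fixes v s :: real
  assumes "0 \<le> v" "0 < s" "s \<le> 1"
  shows "ln (1 + v) \<le> v powr s / s"
proof -
  have "ln (1 + v powr s) \<ge> s * ln (1 + v)"
  proof -
    let ?t = "1 / (1 + v)" and ?u = "v / (1 + v)"
    \<comment> \<open>After division by \<open>1 + v\<close> both summands lie in the unit interval,
      where a power with exponent at most 1 does not decrease them.\<close>
    have unit: "w \<le> w powr s" if "0 \<le> w" "w \<le> 1" for w :: real
      using that assms powr_mono'[of s 1 w] by (cases "w = 0") auto
    have "?t + ?u = 1" using assms by (simp add: add_divide_distrib[symmetric])
    moreover have "?t \<le> ?t powr s" "?u \<le> ?u powr s" using assms by (auto intro!: unit)
    ultimately have "1 \<le> ?t powr s + ?u powr s" by linarith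
    also have "\<dots> = (1 + v powr s) / (1 + v) powr s"
      using assms by (simp add: powr_divide add_divide_distrib)
    finally have "(1 + v) powr s \<le> 1 + v powr s"
      using assms by (simp add: le_divide_eq)
    then have "ln ((1 + v) powr s) \<le> ln (1 + v powr s)"
      using assms by (subst ln_le_cancel_iff) (auto intro: add_pos_nonneg)
    then show ?thesis using assms by (simp add: ln_powr)
  qed
  also have "ln (1 + v powr s) \<le> v powr s"
    by (rule ln_add_one_self_le_self) simp
  finally show ?thesis using assms by (simp add: field_simps)
qed

section \<open>Expectations over random codebooks\<close>

abbreviation (input) random_codebook :: "'i set \<Rightarrow> 'a set \<Rightarrow> ('i \<Rightarrow> 'a) pmf" where
  "random_codebook I A \<equiv> Pi_pmf I undefined (\<lambda>_. pmf_of_set A)"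

lemma finite_set_random_codebook:
  assumes "finite I" "finite A" "A \<noteq> {}"
  shows "finite (set_pmf (random_codebook I A))"
  using assms by (simp add: set_Pi_pmf finite_PiE_dflt)

lemma random_codebook_range:
  assumes "finite I" "finite A" "A \<noteq> {}" "cb \<in> set_pmf (random_codebook I A)" "i \<in> I"
  shows "cb i \<in> A"
  using assms by (auto simp: set_Pi_pmf PiE_dflt_def)

lemma expectation_codeword:
  fixes g :: "'a \<Rightarrow> real"
  assumes "finite I" "finite A" "A \<noteq> {}" "i \<in> I"
  shows "measure_pmf.expectation (random_codebook I A) (\<lambda>cb. g (cb i)) =
    (\<Sum>a\<in>A. g a) / card A"
proof -
  have "measure_pmf.expectation (random_codebook I A) (\<lambda>cb. g (cb i)) =
     measure_pmf.expectation (map_pmf (\<lambda>cb. cb i) (random_codebook I A)) g"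
    by simp
  also have "\<dots> = (\<Sum>a\<in>A. g a) / card A"
    using assms by (subst Pi_pmf_component) (auto simp: integral_pmf_of_set)
  finally show ?thesis .
qed

lemma expectation_codeword_pair:
  fixes g :: "'a \<Rightarrow> 'a \<Rightarrow> real"
  assumes "finite I" "finite A" "A \<noteq> {}" "i \<in> I" "j \<in> I" "i \<noteq> j"
  shows "measure_pmf.expectation (random_codebook I A) (\<lambda>cb. g (cb i) (cb j)) =
    (\<Sum>a\<in>A. \<Sum>a'\<in>A. g a a') / (real (card A))\<^sup>2"
proof -
  let ?p = "pmf_of_set A"
  have "random_codebook I A = random_codebook (insert i (I - {i})) A"
    using assms by (simp add: insert_absorb)
  also have "\<dots> = map_pmf (\<lambda>(a, f). f(i := a)) (pair_pmf ?p (random_codebook (I - {i}) A))"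
    using assms by (intro Pi_pmf_insert) auto
  finally have "map_pmf (\<lambda>cb. (cb i, cb j)) (random_codebook I A) =
      map_pmf (\<lambda>(a, f). (a, f j)) (pair_pmf ?p (random_codebook (I - {i}) A))"
    using assms by (simp add: pmf.map_comp o_def case_prod_unfold)
  also have "\<dots> = pair_pmf (map_pmf (\<lambda>a. a) ?p) (map_pmf (\<lambda>f. f j) (random_codebook (I - {i}) A))"
    by (rule map_pair)
  also have "map_pmf (\<lambda>f. f j) (random_codebook (I - {i}) A) = ?p"
    using assms by (subst Pi_pmf_component) auto
  finally have pair: "map_pmf (\<lambda>cb. (cb i, cb j)) (random_codebook I A) = pair_pmf ?p ?p"
    by simp
  have pmf_A: "pmf ?p a = indicator A a / card A" for a
    using assms by (intro pmf_of_set) auto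
  have "measure_pmf.expectation (random_codebook I A) (\<lambda>cb. g (cb i) (cb j)) =
     measure_pmf.expectation (map_pmf (\<lambda>cb. (cb i, cb j)) (random_codebook I A)) (\<lambda>(a, a'). g a a')"
    by simp
  also have "\<dots> = (\<Sum>(a, a')\<in>A \<times> A. g a a' / (real (card A))\<^sup>2)"
    unfolding pair using assms
    by (subst integral_measure_pmf_real[of "A \<times> A"])
       (auto simp: pmf_pair pmf_A power2_eq_square intro!: sum.cong)
  finally show ?thesis
    by (simp add: sum_divide_distrib flip: sum.cartesian_product)
qed

text \<open>The column condition says that a uniform input on \<open>A\<close> gives a uniform
  output on \<open>B\<close>. Whole words play the role of letters, so the random coding argument is
  one-shot and the block length appears only in the instances.\<close>

locale symmetric_kernel =
  fixes A :: "'a set" and B :: "'c set" and U :: "'a \<Rightarrow> 'c pmf"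
  assumes finite_A [simp]: "finite A" and A_nonempty [simp]: "A \<noteq> {}"
    and finite_B [simp]: "finite B"
    and support: "\<And>a. a \<in> A \<Longrightarrow> set_pmf (U a) \<subseteq> B"
    and column: "\<And>y. y \<in> B \<Longrightarrow> (\<Sum>a\<in>A. pmf (U a) y) = real (card A) / real (card B)"
begin

lemma B_nonempty [simp]: "B \<noteq> {}"
  using support set_pmf_not_empty A_nonempty by fastforce

lemma card_A_pos [simp]: "card A > 0" and card_B_pos [simp]: "card B > 0"
  by (simp_all add: card_gt_0_iff)

lemma sum_U: "a \<in> A \<Longrightarrow> (\<Sum>y\<in>B. pmf (U a) y) = 1"
  using support by (intro sum_pmf_eq_1) auto

definition density :: "'a \<Rightarrow> 'c \<Rightarrow> real" where
  "density a y = real (card B) * pmf (U a) y"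

lemma density_nonneg [simp]: "density a y \<ge> 0"
  by (simp add: density_def)

lemma sum_density: "y \<in> B \<Longrightarrow> (\<Sum>a\<in>A. density a y) = card A"
  using card_B_pos by (simp add: density_def column flip: sum_distrib_left)

text \<open>The codeword \<open>cb j\<close> is independent of the output caused by
  \<open>cb i\<close>, and that output is uniform on \<open>B\<close>. Where the density of
  \<open>cb j\<close> exceeds \<open>T\<close>, the uniform law is below \<open>1 / T\<close> times
  the law \<open>U (cb j)\<close>, which has total mass 1.\<close>

lemma expected_confusion_prob:
  assumes "finite I" "i \<in> I" "j \<in> I" "i \<noteq> j" "T > 0"
  shows "measure_pmf.expectation (random_codebook I A)
      (\<lambda>cb. measure_pmf.prob (U (cb i)) {y\<in>B. T < density (cb j) y}) \<le> 1 / T"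
proof -
  have "measure_pmf.expectation (random_codebook I A)
      (\<lambda>cb. measure_pmf.prob (U (cb i)) {y\<in>B. T < density (cb j) y}) =
    (\<Sum>a\<in>A. \<Sum>a'\<in>A. \<Sum>y | y \<in> B \<and> T < density a' y. pmf (U a) y) / (real (card A))\<^sup>2"
    using assms by (subst expectation_codeword_pair[where g =
          "\<lambda>a a'. measure_pmf.prob (U a) {y\<in>B. T < density a' y}"])
      (simp_all add: measure_measure_pmf_finite)
  also have "(\<Sum>a\<in>A. \<Sum>a'\<in>A. \<Sum>y | y \<in> B \<and> T < density a' y. pmf (U a) y) =
     (\<Sum>a'\<in>A. \<Sum>y | y \<in> B \<and> T < density a' y. real (card A) / real (card B))"
    by (subst sum.swap, intro sum.cong[OF refl], subst sum.swap) (simp add: column)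
  also have "\<dots> \<le> (\<Sum>a'\<in>A. \<Sum>y\<in>B. real (card A) * pmf (U a') y / T)"
  proof (rule sum_mono)
    fix a' assume "a' \<in> A"
    have "(\<Sum>y | y \<in> B \<and> T < density a' y. real (card A) / real (card B)) \<le>
        (\<Sum>y | y \<in> B \<and> T < density a' y. real (card A) * pmf (U a') y / T)"
      using \<open>T > 0\<close> card_A_pos card_B_pos
      by (intro sum_mono) (auto simp: density_def field_simps)
    also have "\<dots> \<le> (\<Sum>y\<in>B. real (card A) * pmf (U a') y / T)"
      using \<open>T > 0\<close> by (intro sum_mono2) auto
    finally show "(\<Sum>y | y \<in> B \<and> T < density a' y. real (card A) / real (card B)) \<le>
        (\<Sum>y\<in>B. real (card A) * pmf (U a') y / T)" .
  qed
  also have "\<dots> = (real (card A))\<^sup>2 / T"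
    by (simp add: sum_U power2_eq_square flip: sum_divide_distrib sum_distrib_left)
  finally have "measure_pmf.expectation (random_codebook I A)
      (\<lambda>cb. measure_pmf.prob (U (cb i)) {y\<in>B. T < density (cb j) y})
      \<le> (real (card A))\<^sup>2 / T / (real (card A))\<^sup>2"
    by (simp add: divide_right_mono)
  then show ?thesis using card_A_pos by simp
qed

text \<open>Union bound: either the sent codeword misses the threshold or another one passes it. All
  other indices are charged, including those of the same message, so the receiver is in effect asked
  to recover the local randomness too.\<close>

lemma expected_threshold_error:
  assumes "finite I" "i \<in> I" "T > 0"
    and low: "\<And>a. a \<in> A \<Longrightarrow> measure_pmf.prob (U a) {y. density a y \<le> T} \<le> \<tau>"
  shows "measure_pmf.expectation (random_codebook I A)
    (\<lambda>cb. measure_pmf.prob (U (cb i)) {y. density (cb i) y \<le> T} +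
      (\<Sum>j\<in>I - {i}. measure_pmf.prob (U (cb i)) {y\<in>B. T < density (cb j) y}))
    \<le> \<tau> + real (card I) / T"
proof -
  note fin = finite_set_random_codebook[OF \<open>finite I\<close> finite_A A_nonempty]
  have swap: "measure_pmf.expectation (random_codebook I A)
      (\<lambda>cb. \<Sum>j\<in>I - {i}. measure_pmf.prob (U (cb i)) {y\<in>B. T < density (cb j) y}) =
    (\<Sum>j\<in>I - {i}. measure_pmf.expectation (random_codebook I A)
      (\<lambda>cb. measure_pmf.prob (U (cb i)) {y\<in>B. T < density (cb j) y}))"
    using fin by (intro Bochner_Integration.integral_sum integrable_measure_pmf_finite)
  have "measure_pmf.expectation (random_codebook I A)
    (\<lambda>cb. measure_pmf.prob (U (cb i)) {y. density (cb i) y \<le> T} +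
      (\<Sum>j\<in>I - {i}. measure_pmf.prob (U (cb i)) {y\<in>B. T < density (cb j) y})) =
    (\<Sum>a\<in>A. measure_pmf.prob (U a) {y. density a y \<le> T}) / card A +
    (\<Sum>j\<in>I - {i}. measure_pmf.expectation (random_codebook I A)
      (\<lambda>cb. measure_pmf.prob (U (cb i)) {y\<in>B. T < density (cb j) y}))"
    using assms fin
    by (subst Bochner_Integration.integral_add)
       (auto intro!: integrable_measure_pmf_finite simp: swap
         expectation_codeword[where g = "\<lambda>a. measure_pmf.prob (U a) {y. density a y \<le> T}"])
  also have "\<dots> \<le> (\<Sum>a\<in>A. \<tau>) / card A + (\<Sum>j\<in>I - {i}. 1 / T)"
    using assms by (intro add_mono divide_right_mono sum_mono low expected_confusion_prob) auto
  also have "\<dots> \<le> \<tau> + real (card I) / T"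
    using assms by (auto intro!: divide_right_mono)
  finally show ?thesis .
qed

text \<open>
  Jensen's inequality over the other codewords is replaced by the tangent bound
  \<open>ln (\<alpha> + \<beta>) \<le> ln (1 + \<alpha>) + (\<beta> - 1) / (1 + \<alpha>)\<close>, whose last term has nonpositive mean because the
  codewords are pairwise independent.
\<close>

lemma expected_resolvability:
  assumes "finite I" "J \<subseteq> I" "i \<in> J" "0 < s" "s \<le> 1"
    and mom: "\<And>a. a \<in> A \<Longrightarrow>
      (\<Sum>z\<in>B. pmf (U a) z * (density a z / real (card J)) powr s) \<le> \<tau>"
  shows "measure_pmf.expectation (random_codebook I A)
    (\<lambda>cb. \<Sum>z\<in>B. pmf (U (cb i)) z * ln ((\<Sum>j\<in>J. density (cb j) z) / real (card J))) \<le> \<tau> / s"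
proof -
  note fin = finite_set_random_codebook[OF \<open>finite I\<close> finite_A A_nonempty]
  have "finite J" using assms by (auto intro: finite_subset)
  define L where "L = real (card J)"
  have "L \<ge> 1" using \<open>finite J\<close> \<open>i \<in> J\<close> by (auto simp: L_def Suc_le_eq card_gt_0_iff)
  \<comment> \<open>The coefficient of \<open>\<beta> - 1\<close> in the tangent bound, weighted by
    the output law. It depends on \<open>cb i\<close> alone, so its product with the density of
    another codeword has a mean that factors.\<close>
  define h where "h = (\<lambda>a z. pmf (U a) z / (1 + density a z / L))"
  let ?E = "measure_pmf.expectation (random_codebook I A)"
  have pt: "pmf (U (cb i)) z * ln ((\<Sum>j\<in>J. density (cb j) z) / L) \<le>
      pmf (U (cb i)) z * (density (cb i) z / L) powr s / s +
      ((\<Sum>j\<in>J - {i}. h (cb i) z * density (cb j) z / L) - h (cb i) z)" for cb z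
  proof (cases "pmf (U (cb i)) z = 0")
    case True
    then show ?thesis by (simp add: h_def)
  next
    case False
    then have "density (cb i) z / L > 0"
      using \<open>L \<ge> 1\<close> by (auto simp: density_def less_le)
    \<comment> \<open>Here \<open>\<alpha>\<close> is the share of the sent codeword in the mixture
      density and \<open>\<beta>\<close> the share of the others, whose mean is
      \<open>(L - 1) / L\<close>.\<close>
    define \<alpha> where "\<alpha> = density (cb i) z / L"
    define \<beta> where "\<beta> = (\<Sum>j\<in>J - {i}. density (cb j) z / L)"
    have "\<alpha> > 0" "\<beta> \<ge> 0"
      using \<open>density (cb i) z / L > 0\<close> \<open>L \<ge> 1\<close> by (auto simp: \<alpha>_def \<beta>_def intro!: sum_nonneg)
    have "(\<Sum>j\<in>J. density (cb j) z) / L = \<alpha> + \<beta>"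
      using \<open>finite J\<close> \<open>i \<in> J\<close> by (simp add: \<alpha>_def \<beta>_def sum.remove[of J i] add_divide_distrib sum_divide_distrib)
    moreover have "ln (\<alpha> + \<beta>) \<le> \<alpha> powr s / s + (\<beta> - 1) / (1 + \<alpha>)"
    proof -
      have "ln (\<alpha> + \<beta>) = ln (1 + \<alpha>) + ln ((\<alpha> + \<beta>) / (1 + \<alpha>))"
        using \<open>\<alpha> > 0\<close> \<open>\<beta> \<ge> 0\<close> by (simp add: ln_div add_pos_nonneg)
      also have "ln ((\<alpha> + \<beta>) / (1 + \<alpha>)) \<le> (\<alpha> + \<beta>) / (1 + \<alpha>) - 1"
        using \<open>\<alpha> > 0\<close> \<open>\<beta> \<ge> 0\<close> by (intro ln_le_minus_one) (simp add: add_pos_nonneg)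
      also have "(\<alpha> + \<beta>) / (1 + \<alpha>) - 1 = (\<beta> - 1) / (1 + \<alpha>)"
        using \<open>\<alpha> > 0\<close> by (simp add: field_simps)
      also have "ln (1 + \<alpha>) \<le> \<alpha> powr s / s"
        using \<open>\<alpha> > 0\<close> assms by (intro ln_one_plus_le_powr) auto
      finally show ?thesis by simp
    qed
    ultimately have "pmf (U (cb i)) z * ln ((\<Sum>j\<in>J. density (cb j) z) / L) \<le>
        pmf (U (cb i)) z * (\<alpha> powr s / s + (\<beta> - 1) / (1 + \<alpha>))"
      by (simp add: mult_left_mono)
    also have "\<dots> = pmf (U (cb i)) z * \<alpha> powr s / s + (h (cb i) z * \<beta> - h (cb i) z)"
      by (simp add: h_def \<alpha>_def algebra_simps diff_divide_distrib)
    finally show ?thesis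
      by (simp add: \<alpha>_def \<beta>_def sum_distrib_left)
  qed
  \<comment> \<open>Densities have mean 1, so each of the \<open>L - 1\<close> other codewords
    contributes the mean of \<open>h\<close> divided by \<open>L\<close>. Subtracting the mean of
    \<open>h\<close> leaves minus one such share.\<close>
  have zero: "?E (\<lambda>cb. (\<Sum>j\<in>J - {i}. h (cb i) z * density (cb j) z / L) - h (cb i) z) \<le> 0"
    if "z \<in> B" for z
  proof -
    have pair: "?E (\<lambda>cb. h (cb i) z * density (cb j) z / L) = (\<Sum>a\<in>A. h a z) / card A / L"
      if "j \<in> J - {i}" for j
    proof -
      have "?E (\<lambda>cb. h (cb i) z * density (cb j) z / L) =
         (\<Sum>a\<in>A. \<Sum>a'\<in>A. h a z * density a' z / L) / (real (card A))\<^sup>2"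
        using that assms by (intro expectation_codeword_pair) auto
      also have "\<dots> = (\<Sum>a\<in>A. h a z) / card A / L"
        using card_A_pos
        by (simp add: sum_density \<open>z \<in> B\<close> power2_eq_square
            flip: sum_divide_distrib sum_distrib_left sum_distrib_right)
      finally show ?thesis .
    qed
    have swap: "?E (\<lambda>cb. \<Sum>j\<in>J - {i}. h (cb i) z * density (cb j) z / L) =
        (\<Sum>j\<in>J - {i}. ?E (\<lambda>cb. h (cb i) z * density (cb j) z / L))"
      using fin by (intro Bochner_Integration.integral_sum integrable_measure_pmf_finite)
    have "?E (\<lambda>cb. (\<Sum>j\<in>J - {i}. h (cb i) z * density (cb j) z / L) - h (cb i) z) =
        (\<Sum>j\<in>J - {i}. ?E (\<lambda>cb. h (cb i) z * density (cb j) z / L)) - ?E (\<lambda>cb. h (cb i) z)"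
      using fin
      unfolding swap[symmetric]
      by (intro Bochner_Integration.integral_diff integrable_measure_pmf_finite)
    also have "?E (\<lambda>cb. h (cb i) z) = (\<Sum>a\<in>A. h a z) / card A"
      using assms by (intro expectation_codeword) auto
    also have "(\<Sum>j\<in>J - {i}. ?E (\<lambda>cb. h (cb i) z * density (cb j) z / L)) =
        (\<Sum>j\<in>J - {i}. (\<Sum>a\<in>A. h a z) / card A / L)"
      by (intro sum.cong refl pair)
    also have "\<dots> = (L - 1) * ((\<Sum>a\<in>A. h a z) / card A / L)"
      using \<open>finite J\<close> \<open>i \<in> J\<close> \<open>L \<ge> 1\<close> by (simp add: L_def of_nat_diff)
    also have "(L - 1) * ((\<Sum>a\<in>A. h a z) / card A / L) - (\<Sum>a\<in>A. h a z) / card A =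
        - ((\<Sum>a\<in>A. h a z) / card A / L)"
      using \<open>L \<ge> 1\<close> by (simp add: field_simps)
    also have "\<dots> \<le> 0"
      using \<open>L \<ge> 1\<close> by (auto intro!: divide_nonneg_nonneg sum_nonneg add_nonneg_nonneg simp: h_def)
    finally show ?thesis .
  qed
  have "?E (\<lambda>cb. \<Sum>z\<in>B. pmf (U (cb i)) z * ln ((\<Sum>j\<in>J. density (cb j) z) / L)) \<le>
     ?E (\<lambda>cb. (\<Sum>z\<in>B. pmf (U (cb i)) z * (density (cb i) z / L) powr s / s) +
       (\<Sum>z\<in>B. (\<Sum>j\<in>J - {i}. h (cb i) z * density (cb j) z / L) - h (cb i) z))"
    unfolding sum.distrib[symmetric] using fin
    by (intro integral_mono integrable_measure_pmf_finite sum_mono pt) auto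
  also have "\<dots> = (\<Sum>a\<in>A. \<Sum>z\<in>B. pmf (U a) z * (density a z / L) powr s / s) / card A +
       (\<Sum>z\<in>B. ?E (\<lambda>cb. (\<Sum>j\<in>J - {i}. h (cb i) z * density (cb j) z / L) - h (cb i) z))"
  proof -
    have "?E (\<lambda>cb. \<Sum>z\<in>B. pmf (U (cb i)) z * (density (cb i) z / L) powr s / s) =
        (\<Sum>a\<in>A. \<Sum>z\<in>B. pmf (U a) z * (density a z / L) powr s / s) / card A"
      using assms
      by (intro expectation_codeword[where
            g = "\<lambda>a. \<Sum>z\<in>B. pmf (U a) z * (density a z / L) powr s / s"]) auto
    moreover have
      "?E (\<lambda>cb. \<Sum>z\<in>B. (\<Sum>j\<in>J - {i}. h (cb i) z * density (cb j) z / L) - h (cb i) z) =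
       (\<Sum>z\<in>B. ?E (\<lambda>cb. (\<Sum>j\<in>J - {i}. h (cb i) z * density (cb j) z / L) - h (cb i) z))"
      using fin by (intro Bochner_Integration.integral_sum integrable_measure_pmf_finite)
    ultimately show ?thesis
      using fin by (subst Bochner_Integration.integral_add)
        (simp_all only: integrable_measure_pmf_finite)
  qed
  also have "\<dots> \<le> (\<Sum>a\<in>A. \<tau> / s) / card A + 0"
    using mom \<open>s > 0\<close> zero unfolding L_def
    by (intro add_mono divide_right_mono sum_mono sum_nonpos)
       (auto simp: divide_right_mono simp flip: sum_divide_distrib)
  finally show ?thesis using card_A_pos by (simp add: L_def)
qed

end

text \<open>If several indices pass the threshold the choice is arbitrary, and if none passes the
  answer is 1: both situations are already charged as errors, and 1 is always a legitimate
  message.\<close>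

definition threshold_decoder ::
    "(nat \<times> nat) set \<Rightarrow> (nat \<times> nat \<Rightarrow> 'a) \<Rightarrow> ('a \<Rightarrow> 'c \<Rightarrow> real) \<Rightarrow> real \<Rightarrow> 'c \<Rightarrow> nat" where
  "threshold_decoder I cb v T y =
     (if \<exists>i\<in>I. T < v (cb i) y then fst (SOME i. i \<in> I \<and> T < v (cb i) y) else 1)"

lemma threshold_decoder_cases:
  "threshold_decoder I cb v T y = 1 \<or> (\<exists>i\<in>I. threshold_decoder I cb v T y = fst i)"
  using someI_ex[of "\<lambda>i. i \<in> I \<and> T < v (cb i) y"] by (auto simp: threshold_decoder_def)

lemma threshold_decoder_correct:
  assumes "i \<in> I" "T < v (cb i) y" "\<And>j. j \<in> I - {i} \<Longrightarrow> \<not> T < v (cb j) y"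
  shows "threshold_decoder I cb v T y = fst i"
proof -
  have "(SOME i. i \<in> I \<and> T < v (cb i) y) = i"
    using assms by (intro some_equality) auto
  then show ?thesis using assms by (auto simp: threshold_decoder_def)
qed

text \<open>Error and leakage are averaged together: some codebook keeps their sum below the sum of
  the expectations. Both are nonnegative, so each is below that total, which is why the two
  conclusions share one bound.\<close>

lemma wiretap_random_coding:
  fixes A :: "'a set" and U :: "'a \<Rightarrow> 'c pmf" and V :: "'a \<Rightarrow> 'd pmf"
  assumes Y: "symmetric_kernel A BY U" and Z: "symmetric_kernel A BZ V"
    and "M \<ge> 1" "L \<ge> 1" "T > 0" "0 < s" "s \<le> 1"
    and low: "\<And>a. a \<in> A \<Longrightarrow> measure_pmf.prob (U a) {y. real (card BY) * pmf (U a) y \<le> T} \<le> \<tau>"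
    and mom: "\<And>a. a \<in> A \<Longrightarrow>
      (\<Sum>z\<in>BZ. pmf (V a) z * (real (card BZ) * pmf (V a) z / real L) powr s) \<le> \<sigma>"
  shows "\<exists>(cb :: nat \<times> nat \<Rightarrow> 'a) (dec :: 'c \<Rightarrow> nat).
    (\<forall>i\<in>{1..M} \<times> {1..L}. cb i \<in> A) \<and> (\<forall>y. dec y \<in> {1..M}) \<and>
    (\<Sum>m=1..M. (\<Sum>l=1..L. measure_pmf.prob (U (cb (m, l))) (BY - dec -` {m})) / L) / M
       \<le> \<tau> + real M * real L / T + \<sigma> / s \<and>
    (\<Sum>m=1..M. \<Sum>z\<in>BZ. (\<Sum>l=1..L. pmf (V (cb (m, l))) z) / L *
        ln (real (card BZ) * ((\<Sum>l=1..L. pmf (V (cb (m, l))) z) / L))) / M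
       \<le> \<tau> + real M * real L / T + \<sigma> / s"
proof -
  interpret Y: symmetric_kernel A BY U by (rule Y)
  interpret Z: symmetric_kernel A BZ V by (rule Z)
  define I where "I = {1..M} \<times> {1..L}"
  have "finite I" and card_I: "card I = M * L" by (simp_all add: I_def)
  let ?E = "measure_pmf.expectation (random_codebook I A)"
  note fin = finite_set_random_codebook[OF \<open>finite I\<close> Y.finite_A Y.A_nonempty]
  define err where "err = (\<lambda>cb i. measure_pmf.prob (U (cb i)) {y. Y.density (cb i) y \<le> T} +
      (\<Sum>j\<in>I - {i}. measure_pmf.prob (U (cb i)) {y\<in>BY. T < Y.density (cb j) y}))"
  \<comment> \<open>Defined for a single sent codeword, so that the resolvability bound applies. Its
    average over \<open>l\<close> is the divergence from uniform of the eavesdropper's output for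
    message \<open>m\<close>.\<close>
  define leak where "leak = (\<lambda>cb (m :: nat, l :: nat). \<Sum>z\<in>BZ. pmf (V (cb (m, l))) z *
      ln ((\<Sum>j\<in>Pair m ` {1..L}. Z.density (cb j) z) / real L))"
  have err: "?E (\<lambda>cb. err cb i) \<le> \<tau> + real M * real L / T" if "i \<in> I" for i
    using Y.expected_threshold_error[OF \<open>finite I\<close> that \<open>T > 0\<close>, of \<tau>] low
    unfolding err_def card_I by (simp add: Y.density_def)
  have leak: "?E (\<lambda>cb. leak cb i) \<le> \<sigma> / s" if "i \<in> I" for i
  proof -
    obtain m l where i: "i = (m, l)" "l \<in> {1..L}" "m \<in> {1..M}" using \<open>i \<in> I\<close> by (auto simp: I_def)
    have "card (Pair m ` {1..L}) = L"
      by (subst card_image) (auto simp: inj_on_def)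
    then show ?thesis
      using Z.expected_resolvability[OF \<open>finite I\<close>, of "Pair m ` {1..L}" i s \<sigma>] i assms mom
      unfolding leak_def by (simp add: I_def Z.density_def image_iff image_subset_iff)
  qed
  have "?E (\<lambda>cb. (\<Sum>i\<in>I. err cb i + leak cb i)) = (\<Sum>i\<in>I. ?E (\<lambda>cb. err cb i) + ?E (\<lambda>cb. leak cb i))"
    using fin by (subst Bochner_Integration.integral_sum)
      (auto intro!: integrable_measure_pmf_finite sum.cong Bochner_Integration.integral_add)
  also have "\<dots> \<le> (\<Sum>i\<in>I. \<tau> + real M * real L / T + \<sigma> / s)"
    by (intro sum_mono add_mono err leak)
  finally obtain cb where cb: "cb \<in> set_pmf (random_codebook I A)"
    and sum_cb: "(\<Sum>i\<in>I. err cb i + leak cb i) \<le> (\<Sum>i\<in>I. \<tau> + real M * real L / T + \<sigma> / s)"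
    using exists_le_expectation[OF fin] by blast
  note cb_A = random_codebook_range[OF \<open>finite I\<close> Y.finite_A Y.A_nonempty cb]
  define F where "F = (\<Sum>m=1..M. (\<Sum>l=1..L. err cb (m, l)) / L) / M"
  define G where "G = (\<Sum>m=1..M. (\<Sum>l=1..L. leak cb (m, l)) / L) / M"
  have FG: "F + G \<le> \<tau> + real M * real L / T + \<sigma> / s"
  proof -
    have "F + G = (\<Sum>i\<in>I. err cb i + leak cb i) / (real M * real L)"
      by (simp add: F_def G_def I_def sum.distrib add_divide_distrib mult.commute[of "real L"]
          flip: sum_divide_distrib sum.cartesian_product')
    also have "\<dots> \<le> (real M * real L * (\<tau> + real M * real L / T + \<sigma> / s)) / (real M * real L)"
      using sum_cb by (intro divide_right_mono) (auto simp: card_I)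
    finally show ?thesis using assms by simp
  qed
  have G: "G = (\<Sum>m=1..M. \<Sum>z\<in>BZ. (\<Sum>l=1..L. pmf (V (cb (m, l))) z) / L *
        ln (real (card BZ) * ((\<Sum>l=1..L. pmf (V (cb (m, l))) z) / L))) / M"
    (is "_ = ?G")
  proof -
    have "(\<Sum>l=1..L. leak cb (m, l)) / L = (\<Sum>z\<in>BZ. (\<Sum>l=1..L. pmf (V (cb (m, l))) z) / L *
        ln (real (card BZ) * ((\<Sum>l=1..L. pmf (V (cb (m, l))) z) / L)))" for m
    proof -
      have eq: "(\<Sum>j\<in>Pair m ` {1..L}. Z.density (cb j) z) / real L =
          real (card BZ) * ((\<Sum>l=1..L. pmf (V (cb (m, l))) z) / L)" for z
        by (subst sum.reindex) (auto simp: inj_on_def Z.density_def sum_distrib_left)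
      have "(\<Sum>l=1..L. leak cb (m, l)) = (\<Sum>l=1..L. \<Sum>z\<in>BZ. pmf (V (cb (m, l))) z *
        ln (real (card BZ) * ((\<Sum>l=1..L. pmf (V (cb (m, l))) z) / L)))"
        by (simp only: leak_def split_conv eq)
      also have "\<dots> = (\<Sum>z\<in>BZ. (\<Sum>l=1..L. pmf (V (cb (m, l))) z) *
        ln (real (card BZ) * ((\<Sum>l=1..L. pmf (V (cb (m, l))) z) / L)))"
        by (subst sum.swap) (simp only: sum_distrib_right)
      finally show ?thesis by (simp only: sum_divide_distrib[where A = BZ] times_divide_eq_left)
    qed
    then show ?thesis by (simp add: G_def)
  qed
  \<comment> \<open>A single value of \<open>leak\<close> may be negative; only the average over the
    codewords of a message is a divergence.\<close>
  have "0 \<le> (\<Sum>z\<in>BZ. (\<Sum>l=1..L. pmf (V (cb (m, l))) z) / L *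
        ln (real (card BZ) * ((\<Sum>l=1..L. pmf (V (cb (m, l))) z) / L)))"
    if m: "m \<in> {1..M}" for m
  proof (rule sum_ln_uniform_nonneg)
    have "(\<Sum>z\<in>BZ. (\<Sum>l=1..L. pmf (V (cb (m, l))) z) / L) = (\<Sum>l=1..L. \<Sum>z\<in>BZ. pmf (V (cb (m, l))) z) / L"
      by (subst sum.swap) (simp add: sum_divide_distrib)
    also have "\<dots> = (\<Sum>l=1..L. 1) / real L"
      using m cb_A Z.sum_U by (intro arg_cong2[where f = "(/)"] sum.cong) (auto simp: I_def)
    finally show "(\<Sum>z\<in>BZ. (\<Sum>l=1..L. pmf (V (cb (m, l))) z) / L) = 1"
      using assms by simp
  qed (auto simp: sum_nonneg)
  then have "G \<ge> 0" unfolding G by (rule divide_nonneg_nonneg[OF sum_nonneg]) auto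
  have "F \<ge> 0"
    by (auto simp: F_def err_def intro!: divide_nonneg_nonneg sum_nonneg add_nonneg_nonneg)
  define dec where "dec = threshold_decoder I cb Y.density T"
  have err_dec: "measure_pmf.prob (U (cb (m, l))) (BY - dec -` {m}) \<le> err cb (m, l)"
    if "(m, l) \<in> I" for m l
  proof -
    have "BY - dec -` {m} \<subseteq> {y. Y.density (cb (m, l)) y \<le> T} \<union>
        (\<Union>j\<in>I - {(m, l)}. {y\<in>BY. T < Y.density (cb j) y})"
    proof
      fix y assume y: "y \<in> BY - dec -` {m}"
      show "y \<in> {y. Y.density (cb (m, l)) y \<le> T} \<union> (\<Union>j\<in>I - {(m, l)}. {y\<in>BY. T < Y.density (cb j) y})"
      proof (rule ccontr)
        assume "\<not> ?thesis"
        then have "threshold_decoder I cb Y.density T y = fst (m, l)"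
          using y that by (intro threshold_decoder_correct) auto
        then show False using y by (simp add: dec_def)
      qed
    qed
    then have "measure_pmf.prob (U (cb (m, l))) (BY - dec -` {m}) \<le>
       measure_pmf.prob (U (cb (m, l))) ({y. Y.density (cb (m, l)) y \<le> T} \<union>
        (\<Union>j\<in>I - {(m, l)}. {y\<in>BY. T < Y.density (cb j) y}))"
      by (intro measure_pmf.finite_measure_mono) auto
    also have "\<dots> \<le> err cb (m, l)"
      unfolding err_def using \<open>finite I\<close>
      by (intro order.trans[OF measure_Un_le] add_mono measure_UNION_le) auto
    finally show ?thesis .
  qed
  show ?thesis
  proof (intro exI[of _ cb] exI[of _ dec] conjI ballI allI)
    show "cb i \<in> A" if "i \<in> {1..M} \<times> {1..L}" for i
      using cb_A that by (simp add: I_def)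
    show "dec y \<in> {1..M}" for y
      using threshold_decoder_cases[of I cb Y.density T y] \<open>M \<ge> 1\<close> by (auto simp: dec_def I_def)
    have "(\<Sum>m=1..M. (\<Sum>l=1..L. measure_pmf.prob (U (cb (m, l))) (BY - dec -` {m})) / L) / M \<le> F"
      unfolding F_def by (intro divide_right_mono sum_mono err_dec) (auto simp: I_def)
    then show "(\<Sum>m=1..M. (\<Sum>l=1..L. measure_pmf.prob (U (cb (m, l))) (BY - dec -` {m})) / L) / M
       \<le> \<tau> + real M * real L / T + \<sigma> / s"
      using FG \<open>G \<ge> 0\<close> by linarith
    show "(\<Sum>m=1..M. \<Sum>z\<in>BZ. (\<Sum>l=1..L. pmf (V (cb (m, l))) z) / L *
        ln (real (card BZ) * ((\<Sum>l=1..L. pmf (V (cb (m, l))) z) / L))) / M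
       \<le> \<tau> + real M * real L / T + \<sigma> / s"
      using FG \<open>F \<ge> 0\<close> unfolding G by linarith
  qed
qed

section \<open>One-shot converse\<close>

text \<open>
  Here \<open>P m\<close> is the eavesdropper's output distribution given the message, \<open>R\<close> its average, and \<open>Q\<close>
  an arbitrary reverse channel from \<open>z\<close> to \<open>y\<close>.
\<close>

lemma wiretap_one_shot_converse:
  fixes enc :: "nat \<Rightarrow> 'a pmf" and U :: "'a \<Rightarrow> 'c pmf" and V :: "'c \<Rightarrow> 'd pmf"
    and W :: "'a \<Rightarrow> 'd pmf" and Q :: "'c \<Rightarrow> 'd \<Rightarrow> real"
  assumes fin: "finite A" "finite BY" "finite BZ"
    and supp: "\<And>m. m \<in> {1..M} \<Longrightarrow> set_pmf (enc m) \<subseteq> A"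
       "\<And>a. a \<in> A \<Longrightarrow> set_pmf (U a) \<subseteq> BY" "\<And>y. y \<in> BY \<Longrightarrow> set_pmf (V y) \<subseteq> BZ"
       "\<And>a. a \<in> A \<Longrightarrow> set_pmf (W a) \<subseteq> BZ"
    and Q: "\<And>y z. y \<in> BY \<Longrightarrow> z \<in> BZ \<Longrightarrow> Q y z \<ge> 0" "\<And>z. z \<in> BZ \<Longrightarrow> (\<Sum>y\<in>BY. Q y z) \<le> 1"
    and "M \<ge> 1" "\<alpha> \<ge> 0" "\<beta> \<ge> 0"
    and P: "\<And>m z. P m z = (\<Sum>a\<in>A. pmf (enc m) a * pmf (W a) z)"
    and R: "\<And>z. R z = (\<Sum>m=1..M. P m z) / M"
    and leak: "(\<Sum>m=1..M. \<Sum>z | z \<in> BZ \<and> P m z > \<alpha> * R z. P m z) / M \<le> \<kappa>"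
    and bad: "\<And>a. a \<in> A \<Longrightarrow>
      (\<Sum>(y, z) | y \<in> BY \<and> z \<in> BZ \<and> pmf (U a) y * pmf (V y) z > \<beta> * (pmf (W a) z * Q y z).
         pmf (U a) y * pmf (V y) z) \<le> \<tau>"
    and W: "\<And>a z. a \<in> A \<Longrightarrow> z \<in> BZ \<Longrightarrow> (\<Sum>y\<in>BY. pmf (U a) y * pmf (V y) z) = pmf (W a) z"
  shows "(\<Sum>m=1..M. \<Sum>a\<in>A. pmf (enc m) a * measure_pmf.prob (U a) {y\<in>BY. dec y = m}) / M
    \<le> \<kappa> + \<tau> + \<alpha> * \<beta> / M"
proof -
  let ?u = "\<lambda>a y z. pmf (U a) y * pmf (V y) z"
  have R0: "R z \<ge> 0" for z unfolding R P by (intro divide_nonneg_nonneg sum_nonneg) auto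
  have sumP: "(\<Sum>z\<in>BZ. P m z) = 1" if "m \<in> {1..M}" for m
  proof -
    have "(\<Sum>z\<in>BZ. P m z) = (\<Sum>a\<in>A. pmf (enc m) a * (\<Sum>z\<in>BZ. pmf (W a) z))"
      unfolding P sum_distrib_left by (rule sum.swap)
    also have "\<dots> = (\<Sum>a\<in>A. pmf (enc m) a)"
      using fin supp by (intro sum.cong refl) (simp add: sum_pmf_eq_1)
    also have "\<dots> = 1" using fin supp that by (intro sum_pmf_eq_1) auto
    finally show ?thesis .
  qed
  have prob: "measure_pmf.prob (U a) {y\<in>BY. dec y = m} = (\<Sum>y | y \<in> BY \<and> dec y = m. \<Sum>z\<in>BZ. ?u a y z)" 
    for a m
    using fin supp by (subst measure_measure_pmf_finite)
      (auto simp: sum_pmf_eq_1 simp flip: sum_distrib_left intro!: sum.cong)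
  \<comment> \<open>A pair outside the leakage event and outside the bad set has probability at most
    \<open>\<beta> * (pmf (W a) z * Q y z)\<close>. Overlaps of the two exceptional sets are counted
    twice, which keeps the three sums separate.\<close>
  have split: "(\<Sum>y | y \<in> BY \<and> dec y = m. \<Sum>z\<in>BZ. ?u a y z) \<le>
      (\<Sum>z | z \<in> BZ \<and> P m z > \<alpha> * R z. pmf (W a) z) + \<tau> +
      (\<Sum>z | z \<in> BZ \<and> \<not> P m z > \<alpha> * R z. \<Sum>y | y \<in> BY \<and> dec y = m. \<beta> * (pmf (W a) z * Q y z))"
    if "a \<in> A" for a m
  proof -
    let ?L = "\<lambda>z. P m z > \<alpha> * R z" and ?Bad = "\<lambda>y z. ?u a y z > \<beta> * (pmf (W a) z * Q y z)"
    let ?w = "\<lambda>y z. \<beta> * (pmf (W a) z * Q y z)"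
    have "(\<Sum>y | y \<in> BY \<and> dec y = m. \<Sum>z\<in>BZ. ?u a y z) \<le> (\<Sum>y | y \<in> BY \<and> dec y = m. \<Sum>z\<in>BZ.
        (if ?L z then ?u a y z else 0) + (if ?Bad y z then ?u a y z else 0)
        + (if ?L z then 0 else ?w y z))"
      using Q \<open>\<beta> \<ge> 0\<close> by (intro sum_mono) auto
    also have "\<dots> = (\<Sum>y | y \<in> BY \<and> dec y = m. \<Sum>z\<in>BZ. if ?L z then ?u a y z else 0) +
        (\<Sum>y | y \<in> BY \<and> dec y = m. \<Sum>z\<in>BZ. if ?Bad y z then ?u a y z else 0) +
        (\<Sum>y | y \<in> BY \<and> dec y = m. \<Sum>z\<in>BZ. if ?L z then 0 else ?w y z)"
      by (simp add: sum.distrib)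
    also have "(\<Sum>y | y \<in> BY \<and> dec y = m. \<Sum>z\<in>BZ. if ?L z then ?u a y z else 0) \<le>
       (\<Sum>y\<in>BY. \<Sum>z\<in>BZ. if ?L z then ?u a y z else 0)"
      using fin by (intro sum_mono2 sum_nonneg) auto
    also have "\<dots> = (\<Sum>z\<in>BZ. if ?L z then (\<Sum>y\<in>BY. ?u a y z) else 0)"
      by (subst sum.swap) (auto intro!: sum.cong)
    also have "\<dots> = (\<Sum>z | z \<in> BZ \<and> ?L z. pmf (W a) z)"
      using fin W[OF \<open>a \<in> A\<close>] by (simp add: sum.inter_filter cong: if_cong sum.cong)
    also have "(\<Sum>y | y \<in> BY \<and> dec y = m. \<Sum>z\<in>BZ. if ?Bad y z then ?u a y z else 0) \<le>
       (\<Sum>y\<in>BY. \<Sum>z\<in>BZ. if ?Bad y z then ?u a y z else 0)"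
      using fin by (intro sum_mono2 sum_nonneg) auto
    also have "\<dots> = (\<Sum>(y, z)\<in>BY \<times> BZ. if ?Bad y z then ?u a y z else 0)"
      by (rule sum.cartesian_product)
    also have "\<dots> = (\<Sum>(y, z) | y \<in> BY \<and> z \<in> BZ \<and> ?Bad y z. ?u a y z)"
      using fin by (intro sum.mono_neutral_cong_right) (auto split: if_splits)
    also have "\<dots> \<le> \<tau>" by (rule bad[OF \<open>a \<in> A\<close>])
    also have "(\<Sum>y | y \<in> BY \<and> dec y = m. \<Sum>z\<in>BZ. if ?L z then 0 else ?w y z) =
        (\<Sum>z\<in>BZ. if \<not> ?L z then \<Sum>y | y \<in> BY \<and> dec y = m. ?w y z else 0)"
      by (subst sum.swap) (auto intro!: sum.cong)
    also have "\<dots> = (\<Sum>z | z \<in> BZ \<and> \<not> ?L z. \<Sum>y | y \<in> BY \<and> dec y = m. ?w y z)"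
      using fin by (simp only: sum.inter_filter)
    finally show ?thesis by simp
  qed
  have msg: "(\<Sum>a\<in>A. pmf (enc m) a * measure_pmf.prob (U a) {y\<in>BY. dec y = m}) \<le>
      (\<Sum>z | z \<in> BZ \<and> P m z > \<alpha> * R z. P m z) + \<tau> +
      \<alpha> * \<beta> * (\<Sum>z\<in>BZ. R z * (\<Sum>y | y \<in> BY \<and> dec y = m. Q y z))"
    if m: "m \<in> {1..M}" for m
  proof -
    let ?q = "\<lambda>z. \<Sum>y | y \<in> BY \<and> dec y = m. Q y z"
    have "(\<Sum>a\<in>A. pmf (enc m) a * measure_pmf.prob (U a) {y\<in>BY. dec y = m}) \<le>
      (\<Sum>a\<in>A. pmf (enc m) a * ((\<Sum>z | z \<in> BZ \<and> P m z > \<alpha> * R z. pmf (W a) z) + \<tau> +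
      (\<Sum>z | z \<in> BZ \<and> \<not> P m z > \<alpha> * R z. \<beta> * (pmf (W a) z * ?q z))))"
      unfolding prob using split
      by (intro sum_mono mult_left_mono) (simp_all add: sum_distrib_left)
    also have "\<dots> = (\<Sum>z | z \<in> BZ \<and> P m z > \<alpha> * R z. P m z) + (\<Sum>a\<in>A. pmf (enc m) a) * \<tau> +
      (\<Sum>z | z \<in> BZ \<and> \<not> P m z > \<alpha> * R z. \<beta> * (P m z * ?q z))"
      unfolding P
      by (simp add: distrib_left sum.distrib sum_distrib_left sum_distrib_right
          sum.swap[of _ _ A] mult_ac)
    also have "(\<Sum>a\<in>A. pmf (enc m) a) = 1" using fin supp m by (intro sum_pmf_eq_1) auto
    \<comment> \<open>Off the leakage event the output law given the message is exchanged for
      \<open>\<alpha>\<close> times its average, which no longer depends on the message.\<close>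
    also have "(\<Sum>z | z \<in> BZ \<and> \<not> P m z > \<alpha> * R z. \<beta> * (P m z * ?q z)) \<le>
        (\<Sum>z | z \<in> BZ \<and> \<not> P m z > \<alpha> * R z. \<beta> * ((\<alpha> * R z) * ?q z))"
      using \<open>\<beta> \<ge> 0\<close> Q by (intro sum_mono mult_left_mono mult_right_mono sum_nonneg) auto
    also have "\<dots> \<le> (\<Sum>z\<in>BZ. \<beta> * ((\<alpha> * R z) * ?q z))"
      using fin \<open>\<beta> \<ge> 0\<close> \<open>\<alpha> \<ge> 0\<close> Q R0 by (intro sum_mono2 mult_nonneg_nonneg sum_nonneg) auto
    finally show ?thesis by (simp add: sum_distrib_left mult_ac)
  qed
  have "(\<Sum>m=1..M. \<Sum>a\<in>A. pmf (enc m) a * measure_pmf.prob (U a) {y\<in>BY. dec y = m}) \<le>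
     (\<Sum>m=1..M. (\<Sum>z | z \<in> BZ \<and> P m z > \<alpha> * R z. P m z) + \<tau> +
      \<alpha> * \<beta> * (\<Sum>z\<in>BZ. R z * (\<Sum>y | y \<in> BY \<and> dec y = m. Q y z)))"
    by (intro sum_mono msg)
  also have "\<dots> = (\<Sum>m=1..M. \<Sum>z | z \<in> BZ \<and> P m z > \<alpha> * R z. P m z) + M * \<tau> +
     \<alpha> * \<beta> * (\<Sum>m=1..M. \<Sum>z\<in>BZ. R z * (\<Sum>y | y \<in> BY \<and> dec y = m. Q y z))"
    by (simp add: sum.distrib sum_distrib_left)
  \<comment> \<open>Once the message is decoupled only guessing is left: the decoding regions are
    disjoint, so their \<open>Q\<close>-masses add up to at most 1 over all messages.\<close>
  also have "(\<Sum>m=1..M. \<Sum>z\<in>BZ. R z * (\<Sum>y | y \<in> BY \<and> dec y = m. Q y z)) \<le> 1"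
  proof -
    have "(\<Sum>m=1..M. \<Sum>z\<in>BZ. R z * (\<Sum>y | y \<in> BY \<and> dec y = m. Q y z)) =
       (\<Sum>z\<in>BZ. R z * (\<Sum>m=1..M. \<Sum>y | y \<in> BY \<and> dec y = m. Q y z))"
      by (subst sum.swap) (simp add: sum_distrib_left)
    also have "\<dots> \<le> (\<Sum>z\<in>BZ. R z * 1)"
    proof (intro sum_mono mult_left_mono R0)
      fix z assume z: "z \<in> BZ"
      have "(\<Sum>m=1..M. \<Sum>y | y \<in> BY \<and> dec y = m. Q y z) = 
         (\<Sum>y\<in>(\<Union>m\<in>{1..M}. {y \<in> BY. dec y = m}). Q y z)"
        using fin by (subst sum.UNION_disjoint) auto
      also have "\<dots> \<le> (\<Sum>y\<in>BY. Q y z)"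
        using fin Q z by (intro sum_mono2) auto
      finally show "(\<Sum>m=1..M. \<Sum>y | y \<in> BY \<and> dec y = m. Q y z) \<le> 1"
        using Q(2)[OF z] by linarith
    qed
    also have "\<dots> = 1"
    proof -
      have "(\<Sum>z\<in>BZ. R z) = (\<Sum>m=1..M. \<Sum>z\<in>BZ. P m z) / M"
        unfolding R by (subst sum.swap) (simp add: sum_divide_distrib)
      then show ?thesis using sumP \<open>M \<ge> 1\<close> by simp
    qed
    finally show ?thesis .
  qed
  finally have "(\<Sum>m=1..M. \<Sum>a\<in>A. pmf (enc m) a * measure_pmf.prob (U a) {y\<in>BY. dec y = m}) \<le>
     (\<Sum>m=1..M. \<Sum>z | z \<in> BZ \<and> P m z > \<alpha> * R z. P m z) + M * \<tau> + \<alpha> * \<beta>"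
    using \<open>\<alpha> \<ge> 0\<close> \<open>\<beta> \<ge> 0\<close> by (simp add: mult_left_mono)
  then have "(\<Sum>m=1..M. \<Sum>a\<in>A. pmf (enc m) a * measure_pmf.prob (U a) {y\<in>BY. dec y = m}) / M \<le>
     ((\<Sum>m=1..M. \<Sum>z | z \<in> BZ \<and> P m z > \<alpha> * R z. P m z) + M * \<tau> + \<alpha> * \<beta>) / M"
    by (rule divide_right_mono) simp
  also have "\<dots> \<le> \<kappa> + \<tau> + \<alpha> * \<beta> / M"
    using leak \<open>M \<ge> 1\<close> by (simp add: add_divide_distrib)
  finally show ?thesis .
qed

section \<open>Relations between the secrecy metrics\<close>

lemma relative_entropy_eq_sum:
  fixes P Q :: "'a pmf"
  assumes "b > 1" "set_pmf P \<subseteq> set_pmf Q" "finite (set_pmf P)"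
  shows "relative_entropy b P Q = (\<Sum>w\<in>set_pmf P. pmf P w * log b (pmf P w / pmf Q w))"
  unfolding relative_entropy_def using assms by (rule KL_divergence_measure_pmf)

lemma sum_pmf_le_1: "finite S \<Longrightarrow> (\<Sum>w\<in>S. pmf p w) \<le> 1"
  using measure_pmf.prob_le_1[of p S] by (simp add: measure_measure_pmf_finite)

lemma relative_entropy_nonneg:
  fixes P Q :: "'a pmf"
  assumes "b > 1" "set_pmf P \<subseteq> set_pmf Q" "finite (set_pmf P)"
  shows "relative_entropy b P Q \<ge> 0"
proof -
  interpret information_space "measure_pmf Q" b
    using \<open>b > 1\<close> by unfold_locales
  have "(pmf P w - pmf Q w) / ln b \<le> pmf P w * log b (pmf P w / pmf Q w)" if "w \<in> set_pmf P" for w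
  proof -
    have pos: "pmf P w > 0" "pmf Q w > 0"
      using that assms by (auto simp: pmf_positive_iff)
    then have "ln (pmf Q w / pmf P w) \<le> pmf Q w / pmf P w - 1"
      by (intro ln_le_minus_one) simp
    then have "pmf P w * (1 - pmf Q w / pmf P w) \<le> pmf P w * ln (pmf P w / pmf Q w)"
      using pos by (intro mult_left_mono) (auto simp: ln_div)
    then have "(pmf P w - pmf Q w) / ln b \<le> pmf P w * ln (pmf P w / pmf Q w) / ln b"
      using pos \<open>b > 1\<close> by (intro divide_right_mono) (auto simp: right_diff_distrib)
    then show ?thesis by (simp add: log_def)
  qed
  then have "(\<Sum>w\<in>set_pmf P. (pmf P w - pmf Q w) / ln b) \<le> relative_entropy b P Q"
    unfolding relative_entropy_eq_sum[OF assms] by (intro sum_mono)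
  moreover have "(\<Sum>w\<in>set_pmf P. (pmf P w - pmf Q w) / ln b) \<ge> 0"
    using \<open>b > 1\<close> sum_pmf_le_1[OF assms(3), of Q] assms(3)
    by (simp add: sum_subtractf sum_pmf_eq_1 flip: sum_divide_distrib)
  ultimately show ?thesis by simp
qed

text \<open>
  The constant is worse than in Pinsker's inequality, but the relative entropy dominates the
  squared Hellinger distance termwise, which makes this an instance of Cauchy--Schwarz.
\<close>

lemma variational_distance_le_relative_entropy:
  fixes P Q :: "'a pmf"
  assumes "b > 1" "set_pmf P \<subseteq> set_pmf Q" "finite (set_pmf Q)"
  shows "variational_distance P Q \<le> 2 * sqrt (ln b * relative_entropy b P Q)"
proof -
  define S where "S = set_pmf Q"
  have "finite S" using assms by (simp add: S_def)
  have finP: "finite (set_pmf P)" using assms by (auto intro: finite_subset)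
  have sums: "(\<Sum>w\<in>S. pmf P w) = 1" "(\<Sum>w\<in>S. pmf Q w) = 1"
    using assms by (auto simp: S_def intro!: sum_pmf_eq_1)
  define H where "H = (\<Sum>w\<in>S. (sqrt (pmf P w) - sqrt (pmf Q w))\<^sup>2)"
  have H_le: "H \<le> ln b * relative_entropy b P Q"
  proof -
    have "(sqrt (pmf P w) - sqrt (pmf Q w))\<^sup>2 \<le>
        ln b * (pmf P w * log b (pmf P w / pmf Q w)) - pmf P w + pmf Q w" if "w \<in> S" for w
    proof (cases "pmf P w = 0")
      case False
      define p q where "p = sqrt (pmf P w)" and "q = sqrt (pmf Q w)"
      have pos: "p > 0" "q > 0"
        using that False by (auto simp: p_def q_def S_def set_pmf_iff less_le)
      have sq: "pmf P w = p\<^sup>2" "pmf Q w = q\<^sup>2" by (simp_all add: p_def q_def)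
      \<comment> \<open>The inequality is applied to the square roots. Doubled, it leaves the
        squared difference of the roots; applied to the masses it would give mere
        nonnegativity.\<close>
      have "ln (q / p) \<le> q / p - 1" using pos by (intro ln_le_minus_one) simp
      then have "p\<^sup>2 * (1 - q / p) \<le> p\<^sup>2 * ln (p / q)"
        using pos by (intro mult_left_mono) (auto simp: ln_div)
      moreover have "ln (p\<^sup>2 / q\<^sup>2) = 2 * ln (p / q)"
        using pos by (simp add: ln_realpow flip: power_divide)
      moreover have "p\<^sup>2 * (1 - q / p) = p\<^sup>2 - p * q"
        using pos by (simp add: field_simps power2_eq_square)
      ultimately have "2 * p\<^sup>2 - 2 * p * q \<le> ln b * (p\<^sup>2 * log b (p\<^sup>2 / q\<^sup>2))"
        using \<open>b > 1\<close> by (simp add: log_def)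
      then show ?thesis
        unfolding p_def[symmetric] q_def[symmetric] unfolding sq
        by (simp add: power2_diff)
    qed auto
    then have "H \<le> (\<Sum>w\<in>S. ln b * (pmf P w * log b (pmf P w / pmf Q w)) - pmf P w + pmf Q w)"
      unfolding H_def by (intro sum_mono)
    also have "\<dots> = ln b * (\<Sum>w\<in>S. pmf P w * log b (pmf P w / pmf Q w))"
      by (simp add: sum.distrib sum_subtractf sums sum_distrib_left)
    also have "(\<Sum>w\<in>S. pmf P w * log b (pmf P w / pmf Q w)) = relative_entropy b P Q"
      unfolding relative_entropy_eq_sum[OF assms(1,2) finP] S_def using assms
      by (intro sum.mono_neutral_right) (auto simp: set_pmf_iff)
    finally show ?thesis .
  qed
  \<comment> \<open>A difference of masses is the difference of the roots times their sum.
    Cauchy-Schwarz separates the two factors, and the squared sums add up to at most 4.\<close>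
  have l1: "(\<Sum>w\<in>S. \<bar>pmf P w - pmf Q w\<bar>) \<le> 2 * sqrt H"
  proof -
    let ?a = "\<lambda>w. \<bar>sqrt (pmf P w) - sqrt (pmf Q w)\<bar>" and ?b = "\<lambda>w. sqrt (pmf P w) + sqrt (pmf Q w)"
    have "\<bar>pmf P w - pmf Q w\<bar> = ?a w * ?b w" for w
    proof -
      have "\<bar>pmf P w - pmf Q w\<bar> = \<bar>(sqrt (pmf P w) - sqrt (pmf Q w)) * ?b w\<bar>"
        by (simp add: algebra_simps)
      then show ?thesis by (simp add: abs_mult)
    qed
    then have "(\<Sum>w\<in>S. \<bar>pmf P w - pmf Q w\<bar>)\<^sup>2 = (\<Sum>w\<in>S. ?a w * ?b w)\<^sup>2" by simp
    also have "\<dots> \<le> (\<Sum>w\<in>S. (?a w)\<^sup>2) * (\<Sum>w\<in>S. (?b w)\<^sup>2)"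
      by (rule Cauchy_Schwarz_ineq_sum)
    also have "(\<Sum>w\<in>S. (?b w)\<^sup>2) \<le> (\<Sum>w\<in>S. 2 * pmf P w + 2 * pmf Q w)"
    proof (rule sum_mono)
      fix w
      show "(?b w)\<^sup>2 \<le> 2 * pmf P w + 2 * pmf Q w"
        using sum_squares_bound[of "sqrt (pmf P w)" "sqrt (pmf Q w)"] by (simp add: power2_sum)
    qed
    also have "(\<Sum>w\<in>S. 2 * pmf P w + 2 * pmf Q w) = 4"
      by (simp add: sum.distrib sums flip: sum_distrib_left)
    finally have "(\<Sum>w\<in>S. \<bar>pmf P w - pmf Q w\<bar>)\<^sup>2 \<le> H * 4"
      by (simp add: H_def mult_left_mono sum_nonneg)
    then have "(\<Sum>w\<in>S. \<bar>pmf P w - pmf Q w\<bar>) \<le> sqrt (H * 4)"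
      by (rule real_le_rsqrt)
    then show ?thesis by (simp add: real_sqrt_mult)
  qed
  have "\<bar>measure_pmf.prob P A - measure_pmf.prob Q A\<bar> \<le> 2 * sqrt (ln b * relative_entropy b P Q)" for A
  proof -
    have "measure_pmf.prob P A = (\<Sum>w\<in>A \<inter> S. pmf P w)"
    proof -
      have "measure_pmf.prob P A = measure_pmf.prob P (A \<inter> S)"
        using assms by (intro measure_prob_cong_0) (auto simp: S_def set_pmf_iff)
      then show ?thesis using \<open>finite S\<close> by (simp add: measure_measure_pmf_finite)
    qed
    moreover have "measure_pmf.prob Q A = (\<Sum>w\<in>A \<inter> S. pmf Q w)"
      using \<open>finite S\<close> by (simp add: S_def measure_Int_set_pmf flip: measure_measure_pmf_finite)
    ultimately have "\<bar>measure_pmf.prob P A - measure_pmf.prob Q A\<bar> =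
        \<bar>\<Sum>w\<in>A \<inter> S. pmf P w - pmf Q w\<bar>"
      by (simp add: sum_subtractf)
    also have "\<dots> \<le> (\<Sum>w\<in>A \<inter> S. \<bar>pmf P w - pmf Q w\<bar>)" by (rule sum_abs)
    also have "\<dots> \<le> (\<Sum>w\<in>S. \<bar>pmf P w - pmf Q w\<bar>)"
      using \<open>finite S\<close> by (intro sum_mono2) auto
    also have "\<dots> \<le> 2 * sqrt (ln b * relative_entropy b P Q)"
      using l1 H_le by (meson mult_left_mono order.trans real_sqrt_le_mono zero_le_numeral)
    finally show ?thesis .
  qed
  then show ?thesis unfolding variational_distance_def by (intro cSUP_least) auto
qed

lemma abs_prob_diff_le_1: "\<bar>measure_pmf.prob P A - measure_pmf.prob Q A\<bar> \<le> 1"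
  using measure_pmf.prob_le_1[of P A] measure_pmf.prob_le_1[of Q A]
    measure_nonneg[of "measure_pmf P" A] measure_nonneg[of "measure_pmf Q" A]
  by linarith

lemma prob_diff_le_variational_distance:
  "measure_pmf.prob P A - measure_pmf.prob Q A \<le> variational_distance P Q"
proof -
  have "bdd_above (range (\<lambda>A. \<bar>measure_pmf.prob P A - measure_pmf.prob Q A\<bar>))"
    using abs_prob_diff_le_1 by (intro bdd_aboveI[where M = 1]) auto
  then have "\<bar>measure_pmf.prob P A - measure_pmf.prob Q A\<bar> \<le> variational_distance P Q"
    unfolding variational_distance_def by (rule cSUP_upper[rotated]) simp
  then show ?thesis by linarith
qed

lemma variational_distance_nonneg: "variational_distance P Q \<ge> 0"
  using prob_diff_le_variational_distance[of P "{}" Q] by simp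

lemma variational_distance_le_1: "variational_distance P Q \<le> 1"
  unfolding variational_distance_def using abs_prob_diff_le_1 by (intro cSUP_least) auto

text \<open>On the tail event \<open>Q\<close> is pointwise at most \<open>b powr (- \<eta>)\<close>
  times \<open>P\<close>, so the event itself witnesses a difference of at least
  \<open>1 - b powr (- \<eta>)\<close> times its \<open>P\<close>-probability.\<close>

lemma log_ratio_tail_le_variational_distance:
  fixes P Q :: "'a pmf"
  assumes "b > 1" "finite (set_pmf P)" "\<eta> > 0"
  shows "log_ratio_tail b 1 \<eta> P Q \<le> variational_distance P Q / (1 - b powr (- \<eta>))"
proof -
  let ?D = "{w. log b (pmf P w / pmf Q w) > \<eta>}"
  have D: "pmf P w > 0 \<and> pmf Q w \<le> b powr (- \<eta>) * pmf P w" if "w \<in> ?D" for w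
  proof -
    \<comment> \<open>If either mass is 0 the ratio is 0 and \<open>log b 0 = 0\<close>, which does
      not exceed a positive threshold; hence both masses are positive on the event.\<close>
    have "pmf P w / pmf Q w \<noteq> 0"
      using that \<open>\<eta> > 0\<close> by (auto simp: log_def)
    then have pos: "pmf P w > 0" "pmf Q w > 0" by (auto simp: less_le)
    then have "b powr \<eta> < pmf P w / pmf Q w"
      using that \<open>b > 1\<close> by (simp add: less_log_iff)
    then show ?thesis
      using pos \<open>b > 1\<close> by (simp add: powr_minus field_simps)
  qed
  have "finite ?D"
    using D assms(2) by (rule_tac finite_subset[of _ "set_pmf P"]) (auto simp: pmf_positive_iff)
  then have "measure_pmf.prob Q ?D \<le> b powr (- \<eta>) * measure_pmf.prob P ?D"
    using D by (auto simp: measure_measure_pmf_finite sum_distrib_left intro!: sum_mono)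
  then have "measure_pmf.prob P ?D * (1 - b powr (- \<eta>)) \<le> variational_distance P Q"
    using prob_diff_le_variational_distance[of P ?D Q] by (simp add: algebra_simps)
  moreover have "b powr (- \<eta>) < 1"
    using assms by (simp add: powr_less_one)
  ultimately show ?thesis
    by (simp add: log_ratio_tail_def le_divide_eq)
qed

lemma log_ratio_tail_scale:
  assumes "n \<ge> 1" "\<eta> > 0"
  shows "log_ratio_tail b (1 / real n) \<eta> P Q \<le> log_ratio_tail b 1 \<eta> P Q"
  unfolding log_ratio_tail_def
proof (rule measure_pmf.finite_measure_mono)
  have "\<eta> < l" if "\<eta> < l / real n" for l
  proof -
    have "\<eta> * 1 \<le> \<eta> * real n" using assms by (intro mult_left_mono) auto
    moreover have "\<eta> * real n < l" using that assms by (simp add: less_divide_eq)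
    ultimately show ?thesis by linarith
  qed
  then show "{w. \<eta> < 1 / real n * log b (pmf P w / pmf Q w)} \<subseteq> {w. \<eta> < 1 * log b (pmf P w / pmf Q w)}"
    by auto
qed simp

text \<open>Markov's inequality for the log ratio, whose negative part has to be paid for. From
  \<open>p * ln (p / q) \<ge> - q\<close> this costs at most \<open>1 / ln b\<close> in total,
  negligible after division by \<open>n\<close>.\<close>

lemma log_ratio_tail_le_relative_entropy:
  fixes P Q :: "'a pmf"
  assumes "b > 1" "set_pmf P \<subseteq> set_pmf Q" "finite (set_pmf P)" "n \<ge> 1" "\<eta> > 0"
  shows "log_ratio_tail b (1 / real n) \<eta> P Q \<le> (relative_entropy b P Q + 1 / ln b) / (real n * \<eta>)"
proof -
  let ?l = "\<lambda>w. log b (pmf P w / pmf Q w)"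
  let ?D = "{w. 1 / real n * ?l w > \<eta>}"
  have pt: "(if w \<in> ?D then real n * \<eta> * pmf P w else 0) \<le> pmf P w * ?l w + pmf Q w / ln b"
    if "w \<in> set_pmf P" for w
  proof -
    have pos: "pmf P w > 0" "pmf Q w > 0"
      using that assms by (auto simp: pmf_positive_iff)
    show ?thesis
    proof (cases "w \<in> ?D")
      case True
      then have "real n * \<eta> \<le> ?l w" using \<open>n \<ge> 1\<close> by (simp add: field_simps)
      then have "pmf P w * (real n * \<eta>) \<le> pmf P w * ?l w"
        using pos by (intro mult_left_mono) auto
      moreover have "pmf Q w / ln b \<ge> 0" using \<open>b > 1\<close> by simp
      ultimately show ?thesis using True by (simp add: mult_ac)
    next
      case False
      have "ln (pmf Q w / pmf P w) \<le> pmf Q w / pmf P w"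
        using pos ln_le_minus_one[of "pmf Q w / pmf P w"] by simp
      then have "pmf P w * ln (pmf Q w / pmf P w) \<le> pmf P w * (pmf Q w / pmf P w)"
        using pos by (intro mult_left_mono) auto
      then have "0 \<le> (pmf P w * ln (pmf P w / pmf Q w) + pmf Q w) / ln b"
        using pos \<open>b > 1\<close> by (intro divide_nonneg_pos) (auto simp: ln_div algebra_simps)
      then show ?thesis using False by (simp add: log_def add_divide_distrib)
    qed
  qed
  have "real n * \<eta> * log_ratio_tail b (1 / real n) \<eta> P Q = real n * \<eta> * (\<Sum>w\<in>?D \<inter> set_pmf P. pmf P w)"
    using assms unfolding log_ratio_tail_def
    by (simp add: measure_Int_set_pmf flip: measure_measure_pmf_finite)
  also have "\<dots> = (\<Sum>w\<in>set_pmf P. if w \<in> ?D then real n * \<eta> * pmf P w else 0)"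
    using assms by (auto simp: sum_distrib_left sum.inter_restrict Int_commute intro!: sum.cong)
  also have "\<dots> \<le> (\<Sum>w\<in>set_pmf P. pmf P w * ?l w + pmf Q w / ln b)"
    by (intro sum_mono pt)
  also have "\<dots> = relative_entropy b P Q + (\<Sum>w\<in>set_pmf P. pmf Q w) / ln b"
    using relative_entropy_eq_sum[OF assms(1-3)] by (simp add: sum.distrib sum_divide_distrib)
  also have "\<dots> \<le> relative_entropy b P Q + 1 / ln b"
    using sum_pmf_le_1[OF assms(3), of Q] \<open>b > 1\<close> by (intro add_left_mono divide_right_mono) auto
  finally show ?thesis using assms by (simp add: le_divide_eq mult_ac)
qed

text \<open>One majorant for all metrics, vanishing with \<open>\<delta>\<close> for each fixed
  threshold. Its summands serve the divergence, the variational distance and the tail; the versions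
  with \<open>1 / n\<close> are no larger.\<close>

lemma secrecy_le_relative_entropy:
  fixes P Q :: "'a pmf"
  assumes "b > 1" "set_pmf P \<subseteq> set_pmf Q" "finite (set_pmf Q)" "n \<ge> 1" "\<eta> > 0"
    and \<delta>: "relative_entropy b P Q \<le> \<delta>"
  shows "secrecy b i n \<eta> P Q \<le> \<delta> + 2 * sqrt (ln b * \<delta>) * (1 + 1 / (1 - b powr (- \<eta>)))"
proof -
  have finP: "finite (set_pmf P)" using assms by (auto intro: finite_subset)
  define d where "d = 2 * sqrt (ln b * \<delta>)"
  define c where "c = 1 / (1 - b powr (- \<eta>))"
  have "b powr (- \<eta>) < 1" using assms by (simp add: powr_less_one)
  then have "c \<ge> 0" by (simp add: c_def)
  have D0: "0 \<le> relative_entropy b P Q"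
    using assms finP by (intro relative_entropy_nonneg)
  then have "\<delta> \<ge> 0" using \<delta> by simp
  then have "d \<ge> 0" using \<open>b > 1\<close> by (simp add: d_def)
  have dc: "d * c \<ge> 0" using \<open>d \<ge> 0\<close> \<open>c \<ge> 0\<close> by simp
  have "2 * sqrt (ln b * relative_entropy b P Q) \<le> d"
    using \<delta> \<open>b > 1\<close> by (simp add: d_def mult_left_mono)
  then have V: "variational_distance P Q \<le> d"
    using variational_distance_le_relative_entropy[OF assms(1-3)] by linarith
  have T: "log_ratio_tail b 1 \<eta> P Q \<le> d * c"
  proof -
    have "log_ratio_tail b 1 \<eta> P Q \<le> variational_distance P Q * c"
      using log_ratio_tail_le_variational_distance[OF assms(1) finP assms(5)] by (simp add: c_def)
    also have "\<dots> \<le> d * c" using V \<open>c \<ge> 0\<close> by (rule mult_right_mono)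
    finally show ?thesis .
  qed
  have div_n: "1 / real n * x \<le> x" if "x \<ge> 0" for x
    using that assms(4) by (simp add: divide_le_eq mult_le_cancel_left1)
  have "secrecy b i n \<eta> P Q \<le> \<delta> + d + d * c"
  proof (cases i)
    case S1 then show ?thesis using \<delta> \<open>d \<ge> 0\<close> dc by simp
  next
    case S2 then show ?thesis using V \<open>\<delta> \<ge> 0\<close> \<open>d \<ge> 0\<close> dc by simp
  next
    case S3 then show ?thesis using T \<open>\<delta> \<ge> 0\<close> \<open>d \<ge> 0\<close> by simp
  next
    case S4
    then show ?thesis using div_n[OF D0] \<delta> \<open>d \<ge> 0\<close> dc by simp
  next
    case S5
    then show ?thesis
      using div_n[OF variational_distance_nonneg, of P Q] V \<open>\<delta> \<ge> 0\<close> dc by simp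
  next
    case S6
    then show ?thesis
      using log_ratio_tail_scale[OF assms(4,5), of b P Q] T \<open>\<delta> \<ge> 0\<close> \<open>d \<ge> 0\<close> by simp
  qed
  then show ?thesis by (simp add: d_def c_def distrib_left)
qed

text \<open>\<open>S6\<close> is the weakest of the metrics other than \<open>S5\<close>, up to
  factors in \<open>\<eta>\<close> and a term of order \<open>1 / n\<close> from the negative part
  of the log ratio. \<open>S5\<close> is at most \<open>1 / n\<close> for every code and carries no
  information about the tail.\<close>

lemma log_ratio_tail_le_secrecy:
  fixes P Q :: "'a pmf"
  assumes "b > 1" "set_pmf P \<subseteq> set_pmf Q" "finite (set_pmf P)" "n \<ge> 1" "\<eta> > 0" "i \<noteq> S5"
  shows "log_ratio_tail b (1 / real n) \<eta> P Q \<le>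
    secrecy b i n \<eta> P Q * (1 + 1 / \<eta> + 1 / (1 - b powr (- \<eta>))) + 1 / (ln b * \<eta>) * (1 / real n)"
proof -
  define s where "s = secrecy b i n \<eta> P Q"
  define c where "c = 1 / (1 - b powr (- \<eta>))"
  define r where "r = 1 / (ln b * \<eta>) * (1 / real n)"
  have "b powr (- \<eta>) < 1" using assms by (simp add: powr_less_one)
  then have "c \<ge> 0" by (simp add: c_def)
  have "r \<ge> 0" using assms by (simp add: r_def)
  have D0: "0 \<le> relative_entropy b P Q"
    using assms by (intro relative_entropy_nonneg)
  have "s \<ge> 0"
    using D0 assms(6) by (cases i) (auto simp: s_def variational_distance_nonneg log_ratio_tail_def)
  have D: "log_ratio_tail b (1 / real n) \<eta> P Q \<le> relative_entropy b P Q / real n * (1 / \<eta>) + r"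
    using log_ratio_tail_le_relative_entropy[OF assms(1-5)] by (simp add: r_def add_divide_distrib mult_ac)
  have c: "log_ratio_tail b (1 / real n) \<eta> P Q \<le> variational_distance P Q * c"
    using log_ratio_tail_scale[OF assms(4,5), of b P Q]
      log_ratio_tail_le_variational_distance[OF assms(1,3,5), of Q] by (simp add: c_def)
  have "log_ratio_tail b (1 / real n) \<eta> P Q \<le> s + s * (1 / \<eta>) + s * c + r"
  proof (cases i)
    case S1
    have "relative_entropy b P Q / real n \<le> relative_entropy b P Q"
      using D0 assms(4) by (simp add: divide_le_eq mult_le_cancel_left1)
    then have "relative_entropy b P Q / real n * (1 / \<eta>) \<le> s * (1 / \<eta>)"
      using S1 \<open>\<eta> > 0\<close> by (intro mult_right_mono) (auto simp: s_def)
    then show ?thesis using D \<open>s \<ge> 0\<close> \<open>c \<ge> 0\<close> by (smt (verit) mult_nonneg_nonneg)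
  next
    case S2
    have "s * (1 / \<eta>) \<ge> 0" using \<open>s \<ge> 0\<close> \<open>\<eta> > 0\<close> by simp
    then show ?thesis using c S2 \<open>s \<ge> 0\<close> \<open>r \<ge> 0\<close> by (simp add: s_def)
  next
    case S3
    have "s * (1 / \<eta>) \<ge> 0" "s * c \<ge> 0" using \<open>s \<ge> 0\<close> \<open>\<eta> > 0\<close> \<open>c \<ge> 0\<close> by auto
    then show ?thesis
      using log_ratio_tail_scale[OF assms(4,5), of b P Q] S3 \<open>r \<ge> 0\<close> by (simp add: s_def)
  next
    case S4
    have "s * c \<ge> 0" using \<open>s \<ge> 0\<close> \<open>c \<ge> 0\<close> by auto
    then show ?thesis using D S4 \<open>s \<ge> 0\<close> by (simp add: s_def)
  next
    case S5 then show ?thesis using assms(6) by simp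
  next
    case S6
    have "s * (1 / \<eta>) \<ge> 0" "s * c \<ge> 0" using \<open>s \<ge> 0\<close> \<open>\<eta> > 0\<close> \<open>c \<ge> 0\<close> by auto
    then show ?thesis using S6 \<open>r \<ge> 0\<close> by (simp add: s_def)
  qed
  then show ?thesis by (simp add: s_def c_def r_def distrib_left)
qed

section \<open>Codes for the degraded channel\<close>

context
  fixes M :: nat and K :: "nat \<Rightarrow> 'd pmf" and B :: "'d set"
  assumes M: "M \<ge> 1" and finite_B: "finite B"
    and support: "\<And>m. m \<in> {1..M} \<Longrightarrow> set_pmf (K m) \<subseteq> B"
begin

private abbreviation (input) "J \<equiv> joint_pmf (pmf_of_set {1..M}) K"
private abbreviation (input) "J' \<equiv> pair_pmf (map_pmf fst J) (map_pmf snd J)"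

lemma pmf_message: "pmf (pmf_of_set {1..M}) m = indicator {1..M} m / real M"
  using M by (subst pmf_of_set) auto

lemma pmf_message_output: "pmf J (m, z) = indicator {1..M} m * pmf (K m) z / M"
  by (simp only: pmf_joint_pmf pmf_message times_divide_eq_left)

lemma pmf_output: "pmf (map_pmf snd J) z = (\<Sum>m=1..M. pmf (K m) z) / M"
proof -
  have "pmf (map_pmf snd J) z = (\<Sum>m=1..M. pmf (K m) z * pmf (pmf_of_set {1..M}) m)"
    using M by (simp only: map_snd_joint_pmf pmf_bind, subst integral_measure_pmf_real[of "{1..M}"]) auto
  also have "\<dots> = (\<Sum>m=1..M. pmf (K m) z / M)"
    by (intro sum.cong refl) (simp only: pmf_message, simp)
  finally show ?thesis by (simp add: sum_divide_distrib)
qed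

lemma pmf_independent: "pmf J' (m, z) = indicator {1..M} m * pmf (map_pmf snd J) z / M"
  by (simp only: pmf_pair map_fst_joint_pmf pmf_message times_divide_eq_left)

lemma set_message_output: "set_pmf J \<subseteq> {1..M} \<times> B"
proof -
  have "z \<in> B" if "z \<in> set_pmf (K m)" "m \<in> {1..M}" for m z
    using support that by blast
  then show ?thesis using M by (auto simp: joint_pmf_def)
qed

lemma set_message_output_subset: "set_pmf J \<subseteq> set_pmf J'"
proof
  fix w assume "w \<in> set_pmf J"
  then have "fst w \<in> set_pmf (map_pmf fst J)" "snd w \<in> set_pmf (map_pmf snd J)"
    by (simp_all only: set_map_pmf imageI)
  then show "w \<in> set_pmf J'" by (simp only: set_pair_pmf mem_Times_iff)
qed

lemma finite_set_message_output: "finite (set_pmf J)"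
  using finite_subset[OF set_message_output] finite_B by simp

lemma finite_set_independent: "finite (set_pmf J')"
  using finite_set_message_output by (simp only: set_pair_pmf set_map_pmf finite_imageI finite_cartesian_product)

lemma sum_channel: "m \<in> {1..M} \<Longrightarrow> (\<Sum>z\<in>B. pmf (K m) z) = 1"
  using support finite_B by (intro sum_pmf_eq_1)

text \<open>Compensation identity: the information between message and output is the mean divergence
  of \<open>K m\<close> from uniform minus the divergence of the average output from uniform.
  Dropping the latter shows that output laws close to uniform leak little.\<close>

lemma relative_entropy_le_resolvability:
  assumes "b > 1" and card: "card B \<ge> 1"
  shows "ln b * relative_entropy b J J' \<le>
    (\<Sum>m=1..M. \<Sum>z\<in>B. pmf (K m) z * ln (real (card B) * pmf (K m) z)) / M"
proof -
  define R where "R = (\<lambda>z. pmf (map_pmf snd J) z)"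
  have R: "R z = (\<Sum>m=1..M. pmf (K m) z) / M" for z
    unfolding R_def by (rule pmf_output)
  have "ln b * relative_entropy b J J' = (\<Sum>w\<in>set_pmf J. pmf J w * ln (pmf J w / pmf J' w))"
    unfolding relative_entropy_eq_sum[OF \<open>b > 1\<close> set_message_output_subset finite_set_message_output]
    using \<open>b > 1\<close> by (simp add: sum_distrib_left log_def)
  also have "\<dots> = (\<Sum>w\<in>{1..M} \<times> B. pmf J w * ln (pmf J w / pmf J' w))"
    using set_message_output finite_B
    by (intro sum.mono_neutral_left) (auto simp: set_pmf_iff)
  also have "\<dots> = (\<Sum>m=1..M. \<Sum>z\<in>B. pmf J (m, z) * ln (pmf J (m, z) / pmf J' (m, z)))"
    by (simp add: sum.cartesian_product')
  also have "\<dots> = (\<Sum>m=1..M. \<Sum>z\<in>B. (pmf (K m) z * ln (real (card B) * pmf (K m) z)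
       - pmf (K m) z * ln (real (card B) * R z)) / M)"
  proof (intro sum.cong refl)
    fix m z assume m: "m \<in> {1..M}" and z: "z \<in> B"
    show "pmf J (m, z) * ln (pmf J (m, z) / pmf J' (m, z)) =
       (pmf (K m) z * ln (real (card B) * pmf (K m) z) - pmf (K m) z * ln (real (card B) * R z)) / M"
    proof (cases "pmf (K m) z = 0")
      case True
      then show ?thesis by (simp only: pmf_message_output) simp
    next
      case False
      then have pos: "pmf (K m) z > 0" by (simp add: less_le)
      also have "pmf (K m) z \<le> (\<Sum>m=1..M. pmf (K m) z)"
        using m by (intro member_le_sum) auto
      finally have "R z > 0" using M by (simp add: R)
      have "pmf J (m, z) = pmf (K m) z / M" "pmf J' (m, z) = R z / M"
        using m by (simp_all only: pmf_message_output pmf_independent R_def) simp_all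
      then have "pmf J (m, z) * ln (pmf J (m, z) / pmf J' (m, z)) = pmf (K m) z / M * ln (pmf (K m) z / R z)"
        using M by simp
      also have "ln (pmf (K m) z / R z) = ln (real (card B) * pmf (K m) z) - ln (real (card B) * R z)"
        using pos \<open>R z > 0\<close> card by (simp add: ln_div ln_mult)
      finally show ?thesis by (simp add: right_diff_distrib diff_divide_distrib)
    qed
  qed
  also have "\<dots> = (\<Sum>m=1..M. \<Sum>z\<in>B. pmf (K m) z * ln (real (card B) * pmf (K m) z)) / M
      - (\<Sum>z\<in>B. R z * ln (real (card B) * R z))"
  proof -
    have "(\<Sum>m=1..M. \<Sum>z\<in>B. pmf (K m) z * ln (real (card B) * R z)) / M =
        (\<Sum>z\<in>B. R z * ln (real (card B) * R z))"
      unfolding R by (subst sum.swap) (simp add: sum_divide_distrib sum_distrib_right)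
    then show ?thesis
      by (simp add: sum_subtractf diff_divide_distrib flip: sum_divide_distrib)
  qed
  finally have eq: "ln b * relative_entropy b J J' =
      (\<Sum>m=1..M. \<Sum>z\<in>B. pmf (K m) z * ln (real (card B) * pmf (K m) z)) / M
      - (\<Sum>z\<in>B. R z * ln (real (card B) * R z))" .
  have "(\<Sum>z\<in>B. R z * ln (real (card B) * R z)) \<ge> 0"
  proof (rule sum_ln_uniform_nonneg[OF finite_B])
    show "B \<noteq> {}" using card by auto
    have "(\<Sum>z\<in>B. R z) = (\<Sum>m=1..M. \<Sum>z\<in>B. pmf (K m) z) / M"
      unfolding R by (subst sum.swap) (simp add: sum_divide_distrib)
    then show "(\<Sum>z\<in>B. R z) = 1" using sum_channel M by simp
  qed (simp add: R_def)
  then show ?thesis unfolding eq by simp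
qed

text \<open>The weight \<open>1 / M\<close> cancels between the joint and the product law, leaving
  \<open>K m\<close> against the average output. The tail thus bounds the leakage event of the
  one-shot converse with \<open>\<alpha> = b powr (real n * \<eta>)\<close>.\<close>

lemma log_ratio_tail_ge_ratio_tail:
  assumes "b > 1" "n \<ge> 1"
  shows "(\<Sum>m=1..M. \<Sum>z | z \<in> B \<and> pmf (K m) z > b powr (real n * \<eta>) * ((\<Sum>m=1..M. pmf (K m) z) / M).
      pmf (K m) z) / M \<le> log_ratio_tail b (1 / real n) \<eta> J J'"
proof -
  let ?R = "\<lambda>z. (\<Sum>m=1..M. pmf (K m) z) / M"
  let ?S = "SIGMA m:{1..M}. {z. z \<in> B \<and> pmf (K m) z > b powr (real n * \<eta>) * ?R z}"
  have finS: "finite ?S" using finite_B by auto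
  have "(\<Sum>m=1..M. \<Sum>z | z \<in> B \<and> pmf (K m) z > b powr (real n * \<eta>) * ?R z. pmf (K m) z) / M =
      (\<Sum>m=1..M. \<Sum>z | z \<in> B \<and> pmf (K m) z > b powr (real n * \<eta>) * ?R z. pmf J (m, z))"
    by (simp only: pmf_message_output) (simp add: sum_divide_distrib)
  also have "\<dots> = (\<Sum>w\<in>?S. pmf J w)"
    using finite_B by (subst sum.Sigma) auto
  also have "\<dots> = measure_pmf.prob J ?S"
    using finS by (simp only: measure_measure_pmf_finite)
  also have "\<dots> \<le> measure_pmf.prob J {w. 1 / real n * log b (pmf J w / pmf J' w) > \<eta>}"
  proof (rule measure_pmf.finite_measure_mono)
    show "?S \<subseteq> {w. 1 / real n * log b (pmf J w / pmf J' w) > \<eta>}"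
    proof
      fix w assume "w \<in> ?S"
      then obtain m z where w: "w = (m, z)" and m: "m \<in> {1..M}"
        and gt: "pmf (K m) z > b powr (real n * \<eta>) * ?R z" by auto
      have "?R z \<ge> 0" by (intro divide_nonneg_nonneg sum_nonneg) auto
      then have pos: "pmf (K m) z > 0"
        using gt by (smt (verit) mult_nonneg_nonneg powr_ge_zero)
      also have "pmf (K m) z \<le> (\<Sum>m=1..M. pmf (K m) z)"
        using m by (intro member_le_sum) auto
      finally have "?R z > 0" using M by simp
      have "pmf J w = pmf (K m) z / M" "pmf J' w = ?R z / M"
        using m unfolding w pmf_message_output pmf_independent pmf_output by simp_all
      then have "pmf J w / pmf J' w = pmf (K m) z / ?R z" using M by simp
      moreover have "b powr (real n * \<eta>) < pmf (K m) z / ?R z"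
        using gt by (simp only: pos_less_divide_eq[OF \<open>?R z > 0\<close>])
      ultimately have "real n * \<eta> < log b (pmf J w / pmf J' w)"
        using \<open>b > 1\<close> pos \<open>?R z > 0\<close> by (simp only: less_log_iff divide_pos_pos)
      then show "w \<in> {w. 1 / real n * log b (pmf J w / pmf J' w) > \<eta>}"
        using \<open>n \<ge> 1\<close> by (simp add: field_simps)
    qed
  qed simp
  finally show ?thesis by (simp add: log_ratio_tail_def)
qed

end

section \<open>Block structure of the degraded channel\<close>

lemma joint_pmf_const: "joint_pmf p (\<lambda>_. K) = pair_pmf p K"
  by (simp add: joint_pmf_def pair_pmf_def map_pmf_def)

lemma product_channel_cascade:
  fixes V1 :: "nat \<Rightarrow> 'x \<Rightarrow> 'y::finite pmf" and V2 :: "nat \<Rightarrow> 'y \<Rightarrow> 'z pmf"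
  assumes "z \<in> words n"
  shows "pmf (product_channel (\<lambda>k. cascade (V1 k) (V2 k)) n x) z =
    (\<Sum>y\<in>words n. pmf (product_channel V1 n x) y * pmf (product_channel V2 n y) z)"
proof -
  have "(\<Sum>y\<in>words n. pmf (product_channel V1 n x) y * pmf (product_channel V2 n y) z) =
      (\<Sum>y\<in>words n. \<Prod>k=1..n. pmf (V1 k (x k)) (y k) * pmf (V2 k (y k)) (z k))"
    using assms by (intro sum.cong refl) (simp add: pmf_product_channel prod.distrib)
  also have "\<dots> = (\<Prod>k=1..n. \<Sum>a\<in>UNIV. pmf (V1 k (x k)) a * pmf (V2 k a) (z k))"
    by (rule sum_words_prod)
  finally show ?thesis using assms by (simp add: pmf_product_channel pmf_cascade)
qed

text \<open>A uniform input makes the outputs of both symmetric channels uniform, so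
  \<open>V2\<close> carries the uniform law to the uniform law. This is what normalises the reverse
  channel of the converse.\<close>

lemma cascade_column:
  fixes V1 :: "'x::finite \<Rightarrow> 'y::finite pmf" and V2 :: "'y \<Rightarrow> 'z::finite pmf"
  assumes "weakly_symmetric V1" "weakly_symmetric (cascade V1 V2)"
  shows "(\<Sum>y\<in>UNIV. pmf (V2 y) z) = real CARD('y) / real CARD('z)"
proof -
  have "real CARD('x) / real CARD('z) = (\<Sum>x\<in>UNIV. \<Sum>y\<in>UNIV. pmf (V1 x) y * pmf (V2 y) z)"
    using weakly_symmetric_column[OF assms(2), of z] by (simp add: pmf_cascade)
  also have "\<dots> = (\<Sum>y\<in>UNIV. (\<Sum>x\<in>UNIV. pmf (V1 x) y) * pmf (V2 y) z)"
    by (subst sum.swap) (simp add: sum_distrib_right)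
  also have "\<dots> = real CARD('x) / real CARD('y) * (\<Sum>y\<in>UNIV. pmf (V2 y) z)"
    by (simp add: weakly_symmetric_column[OF assms(1)] sum_distrib_left)
  finally show ?thesis by (simp add: field_simps)
qed

lemma symmetric_kernel_product_channel:
  fixes V :: "nat \<Rightarrow> 'x::finite \<Rightarrow> 'y::finite pmf"
  assumes "\<And>k. 1 \<le> k \<Longrightarrow> weakly_symmetric (V k)"
  shows "symmetric_kernel (words n) (words n) (product_channel V n)"
  using assms
  by unfold_locales (auto simp: set_pmf_product_channel product_channel_column weakly_symmetric_column)

lemma message_output_pmf_degraded:
  "message_output_pmf (degraded_wiretap_channel W1 W2) n M enc =
    joint_pmf (pmf_of_set {1..M})
      (\<lambda>m. bind_pmf (enc m) (product_channel (\<lambda>k. cascade (W1 k) (W2 k)) n))"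
  by (simp add: message_output_pmf_def eavesdropper_marginal_degraded)

lemma set_bind_product_channel: "set_pmf (bind_pmf p (product_channel V n)) \<subseteq> words n"
  using set_pmf_product_channel[of V n] by auto

lemma average_error_degraded:
  fixes W1 :: "nat \<Rightarrow> 'x::finite \<Rightarrow> 'y::finite pmf" and W2 :: "nat \<Rightarrow> 'y \<Rightarrow> 'z::finite pmf"
  shows "average_error (degraded_wiretap_channel W1 W2) n M enc dec =
    (\<Sum>m=1..M. \<Sum>x\<in>words n. pmf (enc m) x *
       measure_pmf.prob (product_channel W1 n x) (words n - dec -` {m})) / M"
  by (simp add: average_error_def main_marginal_degraded)

lemma average_error_eq_1_minus_success:
  fixes W1 :: "nat \<Rightarrow> 'x::finite \<Rightarrow> 'y::finite pmf" and W2 :: "nat \<Rightarrow> 'y \<Rightarrow> 'z::finite pmf"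
  assumes "M \<ge> 1" "\<And>m. m \<in> {1..M} \<Longrightarrow> set_pmf (enc m) \<subseteq> words n"
  shows "average_error (degraded_wiretap_channel W1 W2) n M enc dec =
    1 - (\<Sum>m=1..M. \<Sum>x\<in>words n. pmf (enc m) x *
       measure_pmf.prob (product_channel W1 n x) {y\<in>words n. dec y = m}) / M"
proof -
  have "measure_pmf.prob (product_channel W1 n x) (words n - dec -` {m}) =
     1 - measure_pmf.prob (product_channel W1 n x) {y\<in>words n. dec y = m}" for x m
  proof -
    have "words n - dec -` {m} = words n - {y\<in>words n. dec y = m}" by auto
    moreover have "measure_pmf.prob (product_channel W1 n x) (words n) = 1"
      using set_pmf_product_channel[of W1 n x]
      by (simp add: measure_pmf.prob_eq_1 AE_measure_pmf_iff subset_iff)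
    ultimately show ?thesis
      by (simp add: measure_pmf.finite_measure_Diff)
  qed
  moreover have "(\<Sum>m=1..M. \<Sum>x\<in>words n. pmf (enc m) x) = M"
    using assms by (simp add: sum_pmf_eq_1)
  ultimately show ?thesis
    using \<open>M \<ge> 1\<close>
    by (simp add: average_error_degraded right_diff_distrib sum_subtractf diff_divide_distrib)
qed

text \<open>The constant \<open>c\<close> is fixed before the block length, the code and
  \<open>\<eta>\<close>, so one exponent serves a whole sequence of codes. The factor 2 accounts for
  one deviation probability per receiver.\<close>

lemma degraded_wiretap_converse:
  fixes W1 :: "nat \<Rightarrow> 'x::finite \<Rightarrow> 'y::finite pmf" and W2 :: "nat \<Rightarrow> 'y \<Rightarrow> 'z::finite pmf"
  defines "WZ \<equiv> \<lambda>k. cascade (W1 k) (W2 k)"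
  assumes "b > 1" and ws: "\<And>k. 1 \<le> k \<Longrightarrow> weakly_symmetric (W1 k)"
      "\<And>k. 1 \<le> k \<Longrightarrow> weakly_symmetric (WZ k)" and "\<gamma> > 0"
  shows "\<exists>c>0. \<forall>n M enc dec \<eta>. n \<ge> 1 \<and> M \<ge> 1 \<and> (\<forall>m\<in>{1..M}. set_pmf (enc m) \<subseteq> words n) \<longrightarrow>
      1 - average_error (degraded_wiretap_channel W1 W2) n M enc dec \<le>
      leakage b S6 (degraded_wiretap_channel W1 W2) n M enc \<eta> + 2 * exp (- c * real n) +
      b powr (real n * \<eta>) * exp (sum_capacity b W1 n - sum_capacity b WZ n + 2 * real n * \<gamma>) / M"
proof -
  obtain c1 where c1: "c1 > 0" and upper: "\<And>n x. measure_pmf.prob (product_channel W1 n x)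
       {y. real (card (words n :: 'y word set)) * pmf (product_channel W1 n x) y
            \<ge> exp (sum_capacity b W1 n + real n * \<gamma>)} \<le> exp (- c1 * real n)"
    using information_density_tails[of b W1 \<gamma>, OF \<open>b > 1\<close> ws(1) \<open>\<gamma> > 0\<close>] by metis
  obtain c2 where c2: "c2 > 0" and lower: "\<And>n x. measure_pmf.prob (product_channel WZ n x)
       {z. real (card (words n :: 'z word set)) * pmf (product_channel WZ n x) z
            \<le> exp (sum_capacity b WZ n - real n * \<gamma>)} \<le> exp (- c2 * real n)"
    using information_density_tails[of b WZ \<gamma>, OF \<open>b > 1\<close> ws(2) \<open>\<gamma> > 0\<close>] by metis
  define c where "c = min c1 c2"
  have "1 - average_error (degraded_wiretap_channel W1 W2) n M enc dec \<le>
      leakage b S6 (degraded_wiretap_channel W1 W2) n M enc \<eta> + 2 * exp (- c * real n) +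
      b powr (real n * \<eta>) * exp (sum_capacity b W1 n - sum_capacity b WZ n + 2 * real n * \<gamma>) / M"
    if "n \<ge> 1" "M \<ge> 1" and enc: "\<And>m. m \<in> {1..M} \<Longrightarrow> set_pmf (enc m) \<subseteq> words n"
    for n M enc dec \<eta>
  proof -
    define NY NZ where "NY = real (card (words n :: 'y word set))"
      and "NZ = real (card (words n :: 'z word set))"
    have N: "NY > 0" "NZ > 0" by (simp_all add: NY_def NZ_def)
    let ?U = "product_channel W1 n" and ?V = "product_channel W2 n" and ?W = "product_channel WZ n"
    let ?K = "\<lambda>m. bind_pmf (enc m) ?W"
    \<comment> \<open>Bayes inversion of the block channel \<open>?V\<close> for a uniform input
      \<open>y\<close>, whose output is then uniform as well.\<close>
    define Q where "Q = (\<lambda>y z. NZ / NY * pmf (?V y) z)"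
    \<comment> \<open>Each of the two densities may deviate by \<open>real n * \<gamma>\<close> in
      the exponent, hence twice that amount.\<close>
    define \<beta> where "\<beta> = exp (sum_capacity b W1 n - sum_capacity b WZ n + 2 * real n * \<gamma>)"
    have W: "(\<Sum>y\<in>words n. pmf (?U x) y * pmf (?V y) z) = pmf (?W x) z" if "z \<in> words n" for x z
      unfolding WZ_def by (rule product_channel_cascade[OF that, symmetric])
    have K: "pmf (?K m) z = (\<Sum>x\<in>words n. pmf (enc m) x * pmf (?W x) z)" if "m \<in> {1..M}" for m z
      unfolding pmf_bind using enc[OF that]
      by (subst integral_measure_pmf_real[of "words n"]) (auto simp: mult.commute)
    define P where "P = (\<lambda>m z. \<Sum>x\<in>words n. pmf (enc m) x * pmf (?W x) z)"
    define R where "R = (\<lambda>z. (\<Sum>m=1..M. P m z) / M)"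
    have PK: "P m z = pmf (?K m) z" if "m \<in> {1..M}" for m z using K[OF that] by (simp add: P_def)
    have "(\<Sum>m=1..M. \<Sum>x\<in>words n. pmf (enc m) x * measure_pmf.prob (?U x) {y\<in>words n. dec y = m}) / M
      \<le> leakage b S6 (degraded_wiretap_channel W1 W2) n M enc \<eta> + 2 * exp (- c * real n) +
         b powr (real n * \<eta>) * \<beta> / M"
    proof (rule wiretap_one_shot_converse[where BZ = "words n" and V = ?V and W = ?W and Q = Q
            and P = P and R = R])
      show "P m z = (\<Sum>a\<in>words n. pmf (enc m) a * pmf (?W a) z)" for m z by (simp add: P_def)
      show "R z = (\<Sum>m=1..M. P m z) / M" for z by (simp add: R_def)
      show "(\<Sum>y\<in>words n. Q y z) \<le> 1" if "z \<in> words n" for z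
      proof -
        have "(\<Sum>y\<in>words n. pmf (?V y) z) = NY / NZ"
          unfolding NY_def NZ_def using ws that
          by (intro product_channel_column cascade_column) (auto simp: WZ_def)
        then show ?thesis using N unfolding Q_def sum_distrib_left[symmetric] by simp
      qed
      have "(\<Sum>m=1..M. \<Sum>z | z \<in> words n \<and> P m z > b powr (real n * \<eta>) * R z. P m z) / M =
        (\<Sum>m=1..M. \<Sum>z | z \<in> words n \<and> pmf (?K m) z > b powr (real n * \<eta>) *
           ((\<Sum>m=1..M. pmf (?K m) z) / M). pmf (?K m) z) / M"
        by (simp add: PK R_def)
      also have "\<dots> \<le> leakage b S6 (degraded_wiretap_channel W1 W2) n M enc \<eta>"
        unfolding leakage_def message_output_pmf_degraded Let_def secrecy.simps WZ_def
        by (intro log_ratio_tail_ge_ratio_tail[where B = "words n"] set_bind_product_channel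
            finite_words that(1,2) \<open>b > 1\<close>)
      finally show "(\<Sum>m=1..M. \<Sum>z | z \<in> words n \<and> P m z > b powr (real n * \<eta>) * R z. P m z) / M
        \<le> leakage b S6 (degraded_wiretap_channel W1 W2) n M enc \<eta>" .
      show "(\<Sum>(y, z) | y \<in> words n \<and> z \<in> words n \<and>
            pmf (?U x) y * pmf (?V y) z > \<beta> * (pmf (?W x) z * Q y z). pmf (?U x) y * pmf (?V y) z)
          \<le> 2 * exp (- c * real n)" for x
      proof -
        let ?D1 = "{y. NY * pmf (?U x) y \<ge> exp (sum_capacity b W1 n + real n * \<gamma>)}"
        let ?D2 = "{z. NZ * pmf (?W x) z \<le> exp (sum_capacity b WZ n - real n * \<gamma>)}"
        let ?u = "\<lambda>(y, z). pmf (?U x) y * pmf (?V y) z"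
        let ?Bad = "{(y, z). y \<in> words n \<and> z \<in> words n \<and>
            pmf (?U x) y * pmf (?V y) z > \<beta> * (pmf (?W x) z * Q y z)}"
        \<comment> \<open>The factor \<open>pmf (?V y) z\<close> occurs on both sides of the
          defining inequality. Without it the inequality compares the two densities alone, so one of
          them must have left its typical range.\<close>
        have "?Bad \<subseteq> (words n \<inter> ?D1) \<times> words n \<union> words n \<times> (words n \<inter> ?D2)"
        proof (rule subsetI, rule ccontr)
          fix w assume "w \<in> ?Bad"
            and notin: "w \<notin> (words n \<inter> ?D1) \<times> words n \<union> words n \<times> (words n \<inter> ?D2)"
          then obtain y z where w: "w = (y, z)" and yz: "y \<in> words n" "z \<in> words n"
            and bad: "pmf (?U x) y * pmf (?V y) z > \<beta> * (pmf (?W x) z * Q y z)"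
            by blast
          have "NY * pmf (?U x) y < exp (sum_capacity b W1 n + real n * \<gamma>)"
            and gt: "NZ * pmf (?W x) z > exp (sum_capacity b WZ n - real n * \<gamma>)"
            using notin yz unfolding w by auto
          moreover have "exp (sum_capacity b W1 n + real n * \<gamma>) =
              \<beta> * exp (sum_capacity b WZ n - real n * \<gamma>)"
            by (simp add: \<beta>_def flip: exp_add)
          moreover have "\<beta> * exp (sum_capacity b WZ n - real n * \<gamma>) \<le> \<beta> * (NZ * pmf (?W x) z)"
            using gt by (intro mult_left_mono) (auto simp: \<beta>_def)
          ultimately have le: "NY * pmf (?U x) y \<le> \<beta> * (NZ * pmf (?W x) z)" by linarith
          have "NY * (pmf (?U x) y * pmf (?V y) z) \<le> \<beta> * (NZ * pmf (?W x) z) * pmf (?V y) z"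
            using mult_right_mono[OF le, of "pmf (?V y) z"] by (simp add: mult.assoc)
          also have "\<dots> = NY * (\<beta> * (pmf (?W x) z * Q y z))"
            using N by (simp add: Q_def)
          finally show False using bad N by simp
        qed
        then have "(\<Sum>w\<in>?Bad. ?u w) \<le>
            (\<Sum>w\<in>(words n \<inter> ?D1) \<times> words n \<union> words n \<times> (words n \<inter> ?D2). ?u w)"
          by (intro sum_mono2) auto
        also have "\<dots> \<le> (\<Sum>w\<in>(words n \<inter> ?D1) \<times> words n. ?u w) + (\<Sum>w\<in>words n \<times> (words n \<inter> ?D2). ?u w)"
          by (subst sum.union_inter[symmetric]) (auto intro!: sum_nonneg)
        also have "(\<Sum>w\<in>(words n \<inter> ?D1) \<times> words n. ?u w) = (\<Sum>y\<in>words n \<inter> ?D1. pmf (?U x) y)"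
          by (simp add: sum.cartesian_product' sum_pmf_eq_1 set_pmf_product_channel flip: sum_distrib_left)
        also have "\<dots> \<le> exp (- c1 * real n)"
        proof -
          have "(\<Sum>y\<in>words n \<inter> ?D1. pmf (?U x) y) = measure_pmf.prob (?U x) (words n \<inter> ?D1)"
            by (simp add: measure_measure_pmf_finite)
          also have "\<dots> \<le> measure_pmf.prob (?U x) ?D1"
            by (intro measure_pmf.finite_measure_mono) auto
          finally show ?thesis using upper[of n x] by (simp add: NY_def)
        qed
        also have "(\<Sum>w\<in>words n \<times> (words n \<inter> ?D2). ?u w) = (\<Sum>z\<in>words n \<inter> ?D2. pmf (?W x) z)"
          by (simp add: sum.cartesian_product', subst sum.swap) (simp add: W)
        also have "\<dots> \<le> exp (- c2 * real n)"
        proof -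
          have "(\<Sum>z\<in>words n \<inter> ?D2. pmf (?W x) z) = measure_pmf.prob (?W x) (words n \<inter> ?D2)"
            by (simp add: measure_measure_pmf_finite)
          also have "\<dots> \<le> measure_pmf.prob (?W x) ?D2"
            by (intro measure_pmf.finite_measure_mono) auto
          finally show ?thesis using lower[of n x] by (simp add: NZ_def)
        qed
        also have "exp (- c1 * real n) + exp (- c2 * real n) \<le> 2 * exp (- c * real n)"
        proof -
          have "c * real n \<le> c1 * real n" "c * real n \<le> c2 * real n"
            by (simp_all add: c_def mult_right_mono)
          then have "exp (- c1 * real n) \<le> exp (- c * real n)" "exp (- c2 * real n) \<le> exp (- c * real n)"
            by simp_all
          then show ?thesis by linarith
        qed
        finally show ?thesis by simp
      qed
      show "Q y z \<ge> 0" for y z using N by (simp add: Q_def)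
    qed (use that W in \<open>simp_all add: \<beta>_def set_pmf_product_channel\<close>)
    then show ?thesis
      using average_error_eq_1_minus_success[of M enc n W1 W2 dec, OF \<open>M \<ge> 1\<close> enc]
      unfolding \<beta>_def by linarith
  qed
  note main = this
  have "c > 0" using c1 c2 by (simp add: c_def)
  then show ?thesis using main by (intro exI[of _ c]) blast
qed

text \<open>Guarantees that the intended number of codewords per message is at least 1, so that
  rounding it up at most doubles it.\<close>

lemma shannon_capacity_nonneg:
  fixes V :: "'x::finite \<Rightarrow> 'y::finite pmf"
  assumes "b > 1" "weakly_symmetric V"
  shows "shannon_capacity b V \<ge> 0"
proof -
  let ?p = "V undefined"
  have "0 \<le> (\<Sum>y\<in>UNIV. pmf ?p y * ln (real CARD('y) * pmf ?p y))"
    by (rule sum_ln_uniform_nonneg) (auto simp: sum_pmf_UNIV)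
  then show ?thesis
    using shannon_capacity_weakly_symmetric[OF assms, of undefined] \<open>b > 1\<close>
    by (simp add: log_def flip: sum_divide_distrib)
qed

lemma degraded_random_code:
  fixes W1 :: "nat \<Rightarrow> 'x::finite \<Rightarrow> 'y::finite pmf" and W2 :: "nat \<Rightarrow> 'y \<Rightarrow> 'z::finite pmf"
  defines "WZ \<equiv> \<lambda>k. cascade (W1 k) (W2 k)"
  assumes "b > 1" and ws: "\<And>k. 1 \<le> k \<Longrightarrow> weakly_symmetric (W1 k)"
      "\<And>k. 1 \<le> k \<Longrightarrow> weakly_symmetric (WZ k)"
    and M: "M \<ge> 1" and L: "L \<ge> 1" and "T > 0" "0 < s" "s \<le> 1"
    and low: "\<And>x. measure_pmf.prob (product_channel W1 n x)
        {y. real (card (words n :: 'y word set)) * pmf (product_channel W1 n x) y \<le> T} \<le> \<tau>"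
    and mom: "\<And>x. (\<Sum>z\<in>words n. pmf (product_channel WZ n x) z *
        (real (card (words n :: 'z word set)) * pmf (product_channel WZ n x) z / real L) powr s) \<le> \<sigma>"
    and e: "e = \<tau> + real M * real L / T + \<sigma> / s"
    and J: "\<And>enc. J enc = message_output_pmf (degraded_wiretap_channel W1 W2) n M enc"
  shows "\<exists>enc dec. (\<forall>m\<in>{1..M}. set_pmf (enc m) \<subseteq> words n) \<and> dec \<in> words n \<rightarrow> {1..M} \<and>
    average_error (degraded_wiretap_channel W1 W2) n M enc dec \<le> e \<and>
    ln b * relative_entropy b (J enc) (pair_pmf (map_pmf fst (J enc)) (map_pmf snd (J enc))) \<le> e"
proof -
  let ?U = "product_channel W1 n" and ?V = "product_channel WZ n"
  have kernels: "symmetric_kernel (words n) (words n) ?U" "symmetric_kernel (words n) (words n) ?V"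
    using ws by (auto intro: symmetric_kernel_product_channel)
  obtain cb and dec :: "'y word \<Rightarrow> nat" where
    code: "(\<forall>i\<in>{1..M} \<times> {1..L}. cb i \<in> words n) \<and> (\<forall>y. dec y \<in> {1..M}) \<and>
    (\<Sum>m=1..M. (\<Sum>l=1..L. measure_pmf.prob (?U (cb (m, l))) (words n - dec -` {m})) / L) / M
       \<le> \<tau> + real M * real L / T + \<sigma> / s \<and>
    (\<Sum>m=1..M. \<Sum>z\<in>words n. (\<Sum>l=1..L. pmf (?V (cb (m, l))) z) / L *
        ln (real (card (words n :: 'z word set)) * ((\<Sum>l=1..L. pmf (?V (cb (m, l))) z) / L))) / M
       \<le> \<tau> + real M * real L / T + \<sigma> / s"
    using wiretap_random_coding[OF kernels M L \<open>T > 0\<close> \<open>0 < s\<close> \<open>s \<le> 1\<close> low mom]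
    by (elim exE) (rule that)
  have cb: "\<And>i. i \<in> {1..M} \<times> {1..L} \<Longrightarrow> cb i \<in> words n" and dec: "\<And>y. dec y \<in> {1..M}"
    using code by blast+
  note err = code[THEN conjunct2, THEN conjunct2, THEN conjunct1]
    and leak = code[THEN conjunct2, THEN conjunct2, THEN conjunct2]
  \<comment> \<open>The local randomness of the encoder: a uniform index \<open>l\<close>, so that
    the eavesdropper sees the mixture of the \<open>L\<close> codewords of the message.\<close>
  define enc where "enc = (\<lambda>m. map_pmf (\<lambda>l. cb (m, l)) (pmf_of_set {1..L}))"
  have expect: "measure_pmf.expectation (enc m) g = (\<Sum>l=1..L. g (cb (m, l))) / L"
    for m and g :: "'x word \<Rightarrow> real"
    using L by (simp add: enc_def integral_pmf_of_set)
  have enc: "set_pmf (enc m) \<subseteq> words n" if "m \<in> {1..M}" for m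
    using cb that L by (auto simp: enc_def)
  have "(\<Sum>x\<in>words n. pmf (enc m) x * g x) = (\<Sum>l=1..L. g (cb (m, l))) / L"
    if "m \<in> {1..M}" for m g
    unfolding expect[symmetric] using enc[OF that]
    by (subst integral_measure_pmf_real[of "words n"]) (auto simp: mult.commute)
  then have "average_error (degraded_wiretap_channel W1 W2) n M enc dec =
      (\<Sum>m=1..M. (\<Sum>l=1..L. measure_pmf.prob (?U (cb (m, l))) (words n - dec -` {m})) / L) / M"
    unfolding average_error_degraded by simp
  with err have "average_error (degraded_wiretap_channel W1 W2) n M enc dec \<le> e"
    by (simp add: e)
  moreover have "ln b * relative_entropy b (J enc) (pair_pmf (map_pmf fst (J enc)) (map_pmf snd (J enc))) \<le> e"
  proof -
    let ?K = "\<lambda>m. bind_pmf (enc m) ?V"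
    have K: "pmf (?K m) z = (\<Sum>l=1..L. pmf (?V (cb (m, l))) z) / L" for m z
      unfolding pmf_bind by (rule expect)
    have "ln b * relative_entropy b (J enc) (pair_pmf (map_pmf fst (J enc)) (map_pmf snd (J enc))) \<le>
      (\<Sum>m=1..M. \<Sum>z\<in>words n. pmf (?K m) z *
         ln (real (card (words n :: 'z word set)) * pmf (?K m) z)) / M"
      unfolding J message_output_pmf_degraded WZ_def
      by (intro relative_entropy_le_resolvability M finite_words set_bind_product_channel \<open>b > 1\<close>)
         (use card_words_pos in \<open>simp add: Suc_le_eq\<close>)
    then show ?thesis using leak unfolding K e by linarith
  qed
  ultimately show ?thesis using enc dec by blast
qed

section \<open>Asymptotics\<close>

lemma eventually_linear_bounds:
  fixes S :: "nat \<Rightarrow> real"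
  assumes "(\<lambda>n. 1 / real n * S n) \<longlonglongrightarrow> C" "d > 0"
  shows "eventually (\<lambda>n. real n * (C - d) \<le> S n \<and> S n \<le> real n * (C + d)) sequentially"
proof -
  have "eventually (\<lambda>n. C - d < 1 / real n * S n) sequentially"
    "eventually (\<lambda>n. 1 / real n * S n < C + d) sequentially"
    using assms by (auto intro!: order_tendstoD)
  then show ?thesis
    using eventually_gt_at_top[of 0]
  proof eventually_elim
    case (elim n)
    then have "C - d < S n / real n" "S n / real n < C + d" "real n > 0" by simp_all
    then show ?case
      by (simp add: pos_less_divide_eq pos_divide_less_eq mult.commute less_imp_le)
  qed
qed

lemma exp_neg_mult_tendsto_0:
  assumes "(c::real) > 0"
  shows "(\<lambda>n. exp (- c * real n)) \<longlonglongrightarrow> 0"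
proof -
  have "(\<lambda>n. exp (- c) ^ n) \<longlonglongrightarrow> 0"
    using assms by (intro LIMSEQ_power_zero) simp
  then show ?thesis by (simp only: exp_of_nat2_mult)
qed

lemma powr_neg_mult_tendsto_0:
  assumes "b > 1" "d > 0"
  shows "(\<lambda>n. b powr (- d * real n)) \<longlonglongrightarrow> (0::real)"
  using exp_neg_mult_tendsto_0[of "d * ln b"] assms by (simp add: powr_def mult_ac)

context
  fixes b :: real and W1 :: "nat \<Rightarrow> 'x::finite \<Rightarrow> 'y::finite pmf"
    and W2 :: "nat \<Rightarrow> 'y \<Rightarrow> 'z::finite pmf" and WZ W CY CZ
  defines "WZ \<equiv> \<lambda>k. cascade (W1 k) (W2 k)" and "W \<equiv> degraded_wiretap_channel W1 W2"
  assumes b: "b > 1" and ws: "\<And>k. 1 \<le> k \<Longrightarrow> weakly_symmetric (W1 k)"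
      "\<And>k. 1 \<le> k \<Longrightarrow> weakly_symmetric (WZ k)"
    and CY: "(\<lambda>n. 1 / real n * (\<Sum>k=1..n. shannon_capacity b (W1 k))) \<longlonglongrightarrow> CY"
    and CZ: "(\<lambda>n. 1 / real n * (\<Sum>k=1..n. shannon_capacity b (WZ k))) \<longlonglongrightarrow> CZ"
begin

lemma exp_ln_mult: "exp (ln b * x) = b powr x"
  using b by (simp add: powr_def mult.commute)

text \<open>Leakage enters only through \<open>S6\<close>, and the code only through its supports
  and its error. The argument thus applies under every metric that controls \<open>S6\<close>, and
  also when the eavesdropper is replaced by another one.\<close>

lemma degraded_strong_converse:
  assumes R: "R > CY - CZ"
    and code: "\<And>n. n \<ge> 1 \<Longrightarrow> M n \<ge> 1"
      "\<And>n m. n \<ge> 1 \<Longrightarrow> m \<in> {1..M n} \<Longrightarrow> set_pmf (enc n m) \<subseteq> words n"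
    and leak: "\<And>\<eta>. \<eta> > 0 \<Longrightarrow> (\<lambda>n. leakage b S6 W n (M n) (enc n) \<eta>) \<longlonglongrightarrow> 0"
    and rate: "asymptotic_rate b M \<ge> ereal R"
    and err: "\<And>n. n \<ge> 1 \<Longrightarrow> average_error W n (M n) (enc n) (dec n) \<le> \<epsilon> n"
  shows "liminf (\<lambda>n. ereal (\<epsilon> n)) \<ge> 1"
proof -
  \<comment> \<open>Seven shares of the gap: one for the leakage threshold, two for the deviations
    of the densities, two for the limits of the averages, one for the limit inferior of the rate,
    and one left as decay.\<close>
  define d where "d = (R - (CY - CZ)) / 7"
  have "d > 0" using R by (simp add: d_def)
  have "7 * d = R - (CY - CZ)" by (simp add: d_def)
  then have R_eq: "R = CY - CZ + 7 * d" by simp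
  have "d * ln b > 0" using b \<open>d > 0\<close> by simp
  have "\<exists>c>0. \<forall>n M enc dec \<eta>. n \<ge> 1 \<and> M \<ge> 1 \<and>
      (\<forall>m\<in>{1..M}. set_pmf (enc m) \<subseteq> words n) \<longrightarrow>
      1 - average_error W n M enc dec \<le> leakage b S6 W n M enc \<eta> + 2 * exp (- c * real n) +
      b powr (real n * \<eta>) * exp (sum_capacity b W1 n - sum_capacity b WZ n + 2 * real n * (d * ln b)) / M"
    unfolding W_def WZ_def
    using ws unfolding WZ_def by (intro degraded_wiretap_converse b \<open>d * ln b > 0\<close>)
  then obtain c where "c > 0" and bound: "\<forall>n M enc dec \<eta>. n \<ge> 1 \<and> M \<ge> 1 \<and>
      (\<forall>m\<in>{1..M}. set_pmf (enc m) \<subseteq> words n) \<longrightarrow>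
      1 - average_error W n M enc dec \<le> leakage b S6 W n M enc \<eta> + 2 * exp (- c * real n) +
      b powr (real n * \<eta>) * exp (sum_capacity b W1 n - sum_capacity b WZ n + 2 * real n * (d * ln b)) / M"
    by (elim exE conjE) (rule that)
  define r where "r = (\<lambda>n. leakage b S6 W n (M n) (enc n) d + 2 * exp (- c * real n) + b powr (- d * real n))"
  have r: "r \<longlonglongrightarrow> 0 + 2 * 0 + 0"
    unfolding r_def using \<open>c > 0\<close> \<open>d > 0\<close> b
    by (intro tendsto_add tendsto_mult tendsto_const leak exp_neg_mult_tendsto_0 powr_neg_mult_tendsto_0)
  have "ereal (R - d) < liminf (\<lambda>n. ereal (1 / real n * log b (real (M n))))"
    using rate \<open>d > 0\<close> less_le_trans[of "ereal (R - d)" "ereal R"] unfolding asymptotic_rate_def by simp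
  then have "eventually (\<lambda>n. ereal (R - d) < ereal (1 / real n * log b (real (M n)))) sequentially"
    by (rule less_LiminfD)
  then have "eventually (\<lambda>n. ereal (1 - r n) \<le> ereal (\<epsilon> n)) sequentially"
    using eventually_linear_bounds[OF CY \<open>d > 0\<close>] eventually_linear_bounds[OF CZ \<open>d > 0\<close>]
      eventually_ge_at_top[of 1]
  proof eventually_elim
    case (elim n)
    have M: "real (M n) > 0" using code(1)[OF \<open>n \<ge> 1\<close>] by simp
    have "R - d \<le> log b (real (M n)) / real n" using elim(1) by simp
    then have "real n * (R - d) \<le> log b (real (M n))"
      using \<open>n \<ge> 1\<close> by (simp add: pos_le_divide_eq mult.commute)
    then have "b powr (real n * (R - d)) \<le> real (M n)"
      using M b by (simp add: le_log_iff)
    have "b powr (real n * d) * exp (sum_capacity b W1 n - sum_capacity b WZ n + 2 * real n * (d * ln b)) =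
        b powr (real n * d + (total_capacity b W1 n - total_capacity b WZ n + 2 * real n * d))"
    proof -
      have "sum_capacity b W1 n - sum_capacity b WZ n + 2 * real n * (d * ln b) =
          ln b * (total_capacity b W1 n - total_capacity b WZ n + 2 * real n * d)" by (simp add: algebra_simps)
      then show ?thesis by (simp only: exp_ln_mult powr_add)
    qed
    also have "\<dots> \<le> b powr (real n * (R - d) + - d * real n)"
      using elim(2,3) b by (intro powr_mono) (simp_all add: R_eq algebra_simps)
    also have "\<dots> \<le> real (M n) * b powr (- d * real n)"
      unfolding powr_add using \<open>b powr (real n * (R - d)) \<le> real (M n)\<close> by (rule mult_right_mono) simp
    finally have "b powr (real n * d) *
        exp (sum_capacity b W1 n - sum_capacity b WZ n + 2 * real n * (d * ln b)) / real (M n)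
        \<le> b powr (- d * real n)"
      using M by (simp add: divide_le_eq mult.commute)
    then have "1 - average_error W n (M n) (enc n) (dec n) \<le> r n"
      using bound[rule_format, of n "M n" "enc n" "dec n" d] code[OF \<open>n \<ge> 1\<close>] \<open>n \<ge> 1\<close>
      unfolding r_def by force
    then show ?case using err[OF \<open>n \<ge> 1\<close>] by simp
  qed
  then have "liminf (\<lambda>n. ereal (1 - r n)) \<le> liminf (\<lambda>n. ereal (\<epsilon> n))"
    by (rule Liminf_mono)
  moreover have "(\<lambda>n. ereal (1 - r n)) \<longlonglongrightarrow> ereal (1 - 0)"
    using r by (intro tendsto_intros) simp
  then have "liminf (\<lambda>n. ereal (1 - r n)) = 1"
    by (subst lim_imp_Liminf) (auto simp: one_ereal_def)
  ultimately show ?thesis by simp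
qed

lemma degraded_achievability:
  assumes R: "0 \<le> R" "R < CY - CZ"
  defines "J \<equiv> \<lambda>n M enc. message_output_pmf W n M enc"
  shows "\<exists>M \<epsilon> \<delta> enc dec. (\<forall>n\<ge>1. M n \<ge> 1 \<and> (\<forall>m\<in>{1..M n}. set_pmf (enc n m) \<subseteq> words n) \<and>
      dec n \<in> words n \<rightarrow> {1..M n} \<and> average_error W n (M n) (enc n) (dec n) \<le> \<epsilon> n \<and>
      relative_entropy b (J n (M n) (enc n))
        (pair_pmf (map_pmf fst (J n (M n) (enc n))) (map_pmf snd (J n (M n) (enc n)))) \<le> \<delta> n) \<and>
    \<epsilon> \<longlonglongrightarrow> 0 \<and> \<delta> \<longlonglongrightarrow> 0 \<and> asymptotic_rate b M \<ge> ereal R"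
proof -
  \<comment> \<open>Five shares of the gap: one each for the decoding threshold and the surplus of
    codewords per message, two for the limits of the averages, and one left as decay.\<close>
  define d where "d = (CY - CZ - R) / 5"
  have "d > 0" using R by (simp add: d_def)
  have "5 * d = CY - CZ - R" by (simp add: d_def)
  then have R_eq: "R = CY - CZ - 5 * d" by simp
  have "d * ln b > 0" using b \<open>d > 0\<close> by simp
  obtain c1 where "c1 > 0" and low: "\<And>n x. measure_pmf.prob (product_channel W1 n x)
       {y. real (card (words n :: 'y word set)) * pmf (product_channel W1 n x) y
            \<le> exp (sum_capacity b W1 n - real n * (d * ln b))} \<le> exp (- c1 * real n)"
    using information_density_tails[of b W1 "d * ln b", OF b ws(1) \<open>d * ln b > 0\<close>] by metis
  have "\<exists>s c2. 0 < s \<and> s \<le> 1 \<and> 0 < c2 \<and>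
    (\<forall>n x L. exp (sum_capacity b WZ n + real n * (d * ln b)) \<le> L \<longrightarrow>
       (\<Sum>z\<in>words n. pmf (product_channel WZ n x) z *
         (real (card (words n :: 'z word set)) * pmf (product_channel WZ n x) z / L) powr s)
       \<le> exp (- c2 * real n))"
    using ws by (intro resolvability_moment_decay b \<open>d * ln b > 0\<close>)
  then obtain s c2 where sc: "0 < s \<and> s \<le> 1 \<and> 0 < c2 \<and>
    (\<forall>n x L. exp (sum_capacity b WZ n + real n * (d * ln b)) \<le> L \<longrightarrow>
       (\<Sum>z\<in>words n. pmf (product_channel WZ n x) z *
         (real (card (words n :: 'z word set)) * pmf (product_channel WZ n x) z / L) powr s)
       \<le> exp (- c2 * real n))"
    by (elim exE) (rule that)
  then have s: "0 < s" "s \<le> 1" and "c2 > 0" by simp_all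
  have mom: "(\<Sum>z\<in>words n. pmf (product_channel WZ n x) z *
         (real (card (words n :: 'z word set)) * pmf (product_channel WZ n x) z / L) powr s)
       \<le> exp (- c2 * real n)"
    if "exp (sum_capacity b WZ n + real n * (d * ln b)) \<le> L" for n x L
    using sc that by simp
  define M where "M = (\<lambda>n. nat \<lceil>b powr (real n * R)\<rceil>)"
  define L where "L = (\<lambda>n. nat \<lceil>exp (sum_capacity b WZ n + real n * (d * ln b))\<rceil>)"
  define T where "T = (\<lambda>n. exp (sum_capacity b W1 n - real n * (d * ln b)))"
  define e where "e = (\<lambda>n. exp (- c1 * real n) + real (M n) * real (L n) / T n + exp (- c2 * real n) / s)"
  \<comment> \<open>Rounding a number that is at least 1 upwards at most doubles it; doing so for
    \<open>M\<close> and for \<open>L\<close> accounts for the factor 4 below.\<close>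
  have nat_ceiling: "nat \<lceil>x\<rceil> \<ge> 1 \<and> x \<le> real (nat \<lceil>x\<rceil>) \<and> real (nat \<lceil>x\<rceil>) \<le> 2 * x" if "x \<ge> 1" for x :: real
    using that by (simp add: Suc_le_eq) linarith
  have M: "M n \<ge> 1 \<and> b powr (real n * R) \<le> real (M n) \<and> real (M n) \<le> 2 * b powr (real n * R)" for n
    unfolding M_def using b R by (intro nat_ceiling ge_one_powr_ge_zero) auto
  have total_nonneg: "total_capacity b WZ n \<ge> 0" for n
    using shannon_capacity_nonneg[OF b ws(2)] by (intro sum_nonneg) auto
  have L: "L n \<ge> 1 \<and> exp (sum_capacity b WZ n + real n * (d * ln b)) \<le> real (L n) \<and>
      real (L n) \<le> 2 * exp (sum_capacity b WZ n + real n * (d * ln b))" for n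
    unfolding L_def using b total_nonneg[of n] \<open>d > 0\<close> by (intro nat_ceiling) simp
  have "e \<longlonglongrightarrow> 0 + 0 + 0 / s"
    unfolding e_def
  proof (intro tendsto_add tendsto_divide tendsto_const exp_neg_mult_tendsto_0 \<open>c1 > 0\<close> \<open>c2 > 0\<close>)
    show "(\<lambda>n. real (M n) * real (L n) / T n) \<longlonglongrightarrow> 0"
    proof (rule Lim_null_comparison)
      show "(\<lambda>n. 4 * b powr (- d * real n)) \<longlonglongrightarrow> 0"
        using tendsto_mult[OF tendsto_const powr_neg_mult_tendsto_0[OF b \<open>d > 0\<close>], of 4] by simp
      show "eventually (\<lambda>n. norm (real (M n) * real (L n) / T n) \<le> 4 * b powr (- d * real n)) sequentially"
        using eventually_linear_bounds[OF CY \<open>d > 0\<close>] eventually_linear_bounds[OF CZ \<open>d > 0\<close>]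
      proof eventually_elim
        case (elim n)
        have T: "T n = b powr (total_capacity b W1 n - real n * d)" and
          L': "exp (sum_capacity b WZ n + real n * (d * ln b)) = b powr (total_capacity b WZ n + real n * d)"
          unfolding T_def exp_ln_mult[symmetric] by (simp_all add: algebra_simps)
        have "real (M n) * real (L n) \<le> (2 * b powr (real n * R)) * (2 * b powr (total_capacity b WZ n + real n * d))"
          using M[of n] L[of n] unfolding L' by (intro mult_mono) auto
        also have "\<dots> = 4 * b powr (real n * R + (total_capacity b WZ n + real n * d))"
          by (simp add: powr_add)
        also have "\<dots> \<le> 4 * b powr (- d * real n + (total_capacity b W1 n - real n * d))"
          using elim b by (intro mult_left_mono powr_mono) (simp_all add: R_eq algebra_simps)
        also have "\<dots> = 4 * b powr (- d * real n) * T n"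
          unfolding T powr_add by simp
        finally have "real (M n) * real (L n) / T n \<le> 4 * b powr (- d * real n)"
          by (subst divide_le_eq) (simp add: T_def)
        then show ?case by (simp add: T_def)
      qed
    qed
  qed (use s in auto)
  then have e0: "e \<longlonglongrightarrow> 0" by simp
  have "\<exists>enc dec. (\<forall>m\<in>{1..M n}. set_pmf (enc m) \<subseteq> words n) \<and> dec \<in> words n \<rightarrow> {1..M n} \<and>
    average_error W n (M n) enc dec \<le> e n \<and>
    ln b * relative_entropy b (J n (M n) enc)
      (pair_pmf (map_pmf fst (J n (M n) enc)) (map_pmf snd (J n (M n) enc))) \<le> e n" for n
    unfolding W_def
  proof (rule degraded_random_code[where L = "L n" and T = "T n" and s = s
        and \<tau> = "exp (- c1 * real n)" and \<sigma> = "exp (- c2 * real n)"])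
    show "measure_pmf.prob (product_channel W1 n x)
       {y. real (card (words n :: 'y word set)) * pmf (product_channel W1 n x) y \<le> T n}
       \<le> exp (- c1 * real n)" for x
      unfolding T_def by (rule low)
    have "(\<Sum>z\<in>words n. pmf (product_channel WZ n x) z *
         (real (card (words n :: 'z word set)) * pmf (product_channel WZ n x) z / real (L n)) powr s)
       \<le> exp (- c2 * real n)" for x
      by (rule mom) (use L[of n] in simp)
    then show "(\<Sum>z\<in>words n. pmf (product_channel (\<lambda>k. cascade (W1 k) (W2 k)) n x) z *
         (real (card (words n :: 'z word set)) * pmf (product_channel (\<lambda>k. cascade (W1 k) (W2 k)) n x) z
           / real (L n)) powr s) \<le> exp (- c2 * real n)" for x
      unfolding WZ_def .
    show "weakly_symmetric (cascade (W1 k) (W2 k))" if "1 \<le> k" for k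
      using ws(2)[OF that] by (simp add: WZ_def)
  qed (use M[of n] L[of n] s b ws(1) in \<open>auto simp: T_def e_def J_def W_def\<close>)
  then obtain enc dec where code: "\<And>n. (\<forall>m\<in>{1..M n}. set_pmf (enc n m) \<subseteq> words n) \<and>
    dec n \<in> words n \<rightarrow> {1..M n} \<and> average_error W n (M n) (enc n) (dec n) \<le> e n \<and>
    ln b * relative_entropy b (J n (M n) (enc n))
      (pair_pmf (map_pmf fst (J n (M n) (enc n))) (map_pmf snd (J n (M n) (enc n)))) \<le> e n"
    by metis
  have "(\<lambda>n. e n / ln b) \<longlonglongrightarrow> 0 / ln b"
    using e0 b by (intro tendsto_divide tendsto_const) auto
  moreover have "asymptotic_rate b M \<ge> ereal R"
    unfolding asymptotic_rate_def
  proof (rule Liminf_bounded)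
    show "eventually (\<lambda>n. ereal R \<le> ereal (1 / real n * log b (real (M n)))) sequentially"
      using eventually_gt_at_top[of 0]
    proof eventually_elim
      case (elim n)
      have "real n * R \<le> log b (real (M n))"
        using M[of n] b by (subst le_log_iff) auto
      then have "R \<le> log b (real (M n)) / real n"
        using elim by (simp add: pos_le_divide_eq mult.commute)
      then show ?case by simp
    qed
  qed
  moreover have "relative_entropy b (J n (M n) (enc n))
      (pair_pmf (map_pmf fst (J n (M n) (enc n))) (map_pmf snd (J n (M n) (enc n)))) \<le> e n / ln b" for n
    using code[of n] b by (simp add: le_divide_eq mult.commute)
  ultimately show ?thesis
    using code M e0 by (intro exI[of _ M] exI[of _ e] exI[of _ "\<lambda>n. e n / ln b"] exI[of _ enc] exI[of _ dec])
      auto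
qed

end

section \<open>Capacities\<close>

definition achievable_rate ::
    "real \<Rightarrow> secrecy_metric \<Rightarrow> ('x::finite, 'y::finite, 'z::finite) wiretap_channel \<Rightarrow> real \<Rightarrow> bool" where
  "achievable_rate b i W R \<longleftrightarrow> (\<exists>M \<epsilon> \<delta> enc dec. wiretap_code_sequence b i W M \<epsilon> \<delta> enc dec \<and>
     \<epsilon> \<longlonglongrightarrow> 0 \<and> vanishing_leakage \<delta> \<and> asymptotic_rate b M \<ge> ereal R)"

definition strong_converse_rate ::
    "real \<Rightarrow> secrecy_metric \<Rightarrow> ('x::finite, 'y::finite, 'z::finite) wiretap_channel \<Rightarrow> real \<Rightarrow> bool" where
  "strong_converse_rate b i W R \<longleftrightarrow> (\<forall>M \<epsilon> \<delta> enc dec. wiretap_code_sequence b i W M \<epsilon> \<delta> enc dec \<and>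
     asymptotic_rate b M \<ge> ereal R \<and> vanishing_leakage \<delta> \<longrightarrow> liminf (\<lambda>n. ereal (\<epsilon> n)) \<ge> 1)"

lemma achievable_rate_le_strong_converse_rate:
  assumes "achievable_rate b i W R" "strong_converse_rate b i W R'"
  shows "R \<le> R'"
proof (rule ccontr)
  assume "\<not> R \<le> R'"
  obtain M \<epsilon> \<delta> enc dec where code: "wiretap_code_sequence b i W M \<epsilon> \<delta> enc dec"
    "\<epsilon> \<longlonglongrightarrow> 0" "vanishing_leakage \<delta>" "asymptotic_rate b M \<ge> ereal R"
    using assms(1) unfolding achievable_rate_def by blast
  then have "asymptotic_rate b M \<ge> ereal R'"
    using \<open>\<not> R \<le> R'\<close> order.trans[of "ereal R'" "ereal R"] by simp
  then have "liminf (\<lambda>n. ereal (\<epsilon> n)) \<ge> 1"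
    using assms(2) code unfolding strong_converse_rate_def by blast
  moreover have "liminf (\<lambda>n. ereal (\<epsilon> n)) = ereal 0"
    using code(2) by (intro lim_imp_Liminf) auto
  ultimately show False by simp
qed

text \<open>The capacity is at least \<open>C\<close>, the optimistic capacity at most
  \<open>C\<close>, and no achievable rate exceeds a strong converse rate since errors cannot both
  vanish and have limit inferior at least 1. The rate \<open>C\<close> itself stays undecided, hence
  the density arguments.\<close>

lemma partial_strong_converseI:
  assumes ach: "\<And>R. R < C \<Longrightarrow> achievable_rate b i W R"
    and conv: "\<And>R. R > C \<Longrightarrow> strong_converse_rate b i W R"
  shows "partial_strong_converse b i W"
proof -
  have S: "secrecy_capacity b i W = Sup {ereal R | R. achievable_rate b i W R}"
    by (simp add: secrecy_capacity_def achievable_rate_def)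
  have I: "optimistic_secrecy_capacity b i W = Inf {ereal R | R. strong_converse_rate b i W R}"
    by (simp add: optimistic_secrecy_capacity_def strong_converse_rate_def)
  have "ereal C \<le> secrecy_capacity b i W"
  proof (rule dense_le)
    fix y assume "y < ereal C"
    then obtain R where "y < ereal R" "R < C"
      using ereal_dense2[of y "ereal C"] by auto
    moreover have "ereal R \<le> secrecy_capacity b i W"
      unfolding S using ach[OF \<open>R < C\<close>] by (intro Sup_upper) auto
    ultimately show "y \<le> secrecy_capacity b i W" by simp
  qed
  moreover have "optimistic_secrecy_capacity b i W \<le> ereal C"
  proof (rule dense_ge)
    fix y assume "ereal C < y"
    then obtain R where "ereal R < y" "C < R"
      using ereal_dense2[of "ereal C" y] by auto
    moreover have "optimistic_secrecy_capacity b i W \<le> ereal R"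
      unfolding I using conv[OF \<open>C < R\<close>] by (intro Inf_lower) auto
    ultimately show "optimistic_secrecy_capacity b i W \<le> y" by simp
  qed
  moreover have "secrecy_capacity b i W \<le> optimistic_secrecy_capacity b i W"
    unfolding S I using achievable_rate_le_strong_converse_rate
    by (intro Sup_least Inf_greatest) auto
  ultimately show ?thesis by (simp add: partial_strong_converse_def)
qed

lemma message_output_support:
  fixes W1 :: "nat \<Rightarrow> 'x::finite \<Rightarrow> 'y::finite pmf" and W2 :: "nat \<Rightarrow> 'y \<Rightarrow> 'z::finite pmf"
    and n M :: nat and enc :: "'x encoder"
  assumes "M \<ge> 1"
  defines "P \<equiv> message_output_pmf (degraded_wiretap_channel W1 W2) n M enc"
  defines "Q \<equiv> pair_pmf (map_pmf fst P) (map_pmf snd P)"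
  shows "set_pmf P \<subseteq> set_pmf Q" "finite (set_pmf P)" "finite (set_pmf Q)"
  unfolding Q_def P_def message_output_pmf_degraded
  by (rule set_message_output_subset[OF assms(1) finite_words set_bind_product_channel]
      finite_set_message_output[OF assms(1) finite_words set_bind_product_channel]
      finite_set_independent[OF assms(1) finite_words set_bind_product_channel])+

lemma achievable_rate_degraded:
  fixes W1 :: "nat \<Rightarrow> 'x::finite \<Rightarrow> 'y::finite pmf" and W2 :: "nat \<Rightarrow> 'y \<Rightarrow> 'z::finite pmf"
  defines "W \<equiv> degraded_wiretap_channel W1 W2"
  defines "J \<equiv> \<lambda>n M enc. message_output_pmf W n M enc"
  assumes b: "b > 1"
    and code: "\<And>n. n \<ge> 1 \<Longrightarrow> M n \<ge> 1 \<and> (\<forall>m\<in>{1..M n}. set_pmf (enc n m) \<subseteq> words n) \<and>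
      dec n \<in> words n \<rightarrow> {1..M n} \<and> average_error W n (M n) (enc n) (dec n) \<le> \<epsilon> n \<and>
      relative_entropy b (J n (M n) (enc n))
        (pair_pmf (map_pmf fst (J n (M n) (enc n))) (map_pmf snd (J n (M n) (enc n)))) \<le> \<delta> n"
    and lim: "\<epsilon> \<longlonglongrightarrow> 0" "\<delta> \<longlonglongrightarrow> 0" "asymptotic_rate b M \<ge> ereal R"
  shows "achievable_rate b i W R"
proof -
  define \<delta>' where "\<delta>' = (\<lambda>n \<eta>. \<delta> n + 2 * sqrt (ln b * \<delta> n) * (1 + 1 / (1 - b powr (- \<eta>))))"
  have "wiretap_code b i W n (M n) (\<epsilon> n) (\<delta>' n) (enc n) (dec n)" if "n \<ge> 1" for n
  proof -
    have "leakage b i W n (M n) (enc n) \<eta> \<le> \<delta>' n \<eta>" if "\<eta> > 0" for \<eta>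
      unfolding leakage_def Let_def \<delta>'_def
      using code[OF \<open>n \<ge> 1\<close>] message_output_support[of "M n" W1 W2 n "enc n"] \<open>n \<ge> 1\<close> \<open>\<eta> > 0\<close> b
      by (intro secrecy_le_relative_entropy) (auto simp: J_def W_def)
    then show ?thesis using code[OF that] by (simp add: wiretap_code_def)
  qed
  moreover have "vanishing_leakage \<delta>'"
    unfolding vanishing_leakage_def
  proof (intro allI impI)
    fix \<eta> :: real
    have "(\<lambda>n. \<delta>' n \<eta>) \<longlonglongrightarrow> 0 + 2 * sqrt (ln b * 0) * (1 + 1 / (1 - b powr (- \<eta>)))"
      unfolding \<delta>'_def using lim(2) by (intro tendsto_intros)
    then show "(\<lambda>n. \<delta>' n \<eta>) \<longlonglongrightarrow> 0" by simp
  qed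
  ultimately show ?thesis
    using lim unfolding achievable_rate_def wiretap_code_sequence_def by blast
qed

lemma degraded_achievable_rate:
  fixes W1 :: "nat \<Rightarrow> 'x::finite \<Rightarrow> 'y::finite pmf" and W2 :: "nat \<Rightarrow> 'y \<Rightarrow> 'z::finite pmf"
  assumes "b > 1" and ws: "\<And>k. 1 \<le> k \<Longrightarrow> weakly_symmetric (W1 k)"
      "\<And>k. 1 \<le> k \<Longrightarrow> weakly_symmetric (cascade (W1 k) (W2 k))"
    and lim: "(\<lambda>n. 1 / real n * (\<Sum>k=1..n. shannon_capacity b (W1 k))) \<longlonglongrightarrow> CY"
      "(\<lambda>n. 1 / real n * (\<Sum>k=1..n. shannon_capacity b (cascade (W1 k) (W2 k)))) \<longlonglongrightarrow> CZ"
    and R: "0 \<le> R" "R < CY - CZ"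
  shows "achievable_rate b i (degraded_wiretap_channel W1 W2) R"
proof -
  let ?J = "\<lambda>n M enc. message_output_pmf (degraded_wiretap_channel W1 W2) n M enc"
  have "\<exists>M \<epsilon> \<delta> enc dec. (\<forall>n\<ge>1. M n \<ge> 1 \<and> (\<forall>m\<in>{1..M n}. set_pmf (enc n m) \<subseteq> words n) \<and>
      dec n \<in> words n \<rightarrow> {1..M n} \<and>
      average_error (degraded_wiretap_channel W1 W2) n (M n) (enc n) (dec n) \<le> \<epsilon> n \<and>
      relative_entropy b (?J n (M n) (enc n))
        (pair_pmf (map_pmf fst (?J n (M n) (enc n))) (map_pmf snd (?J n (M n) (enc n)))) \<le> \<delta> n) \<and>
    \<epsilon> \<longlonglongrightarrow> 0 \<and> \<delta> \<longlonglongrightarrow> 0 \<and> asymptotic_rate b M \<ge> ereal R"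
    using ws lim R by (intro degraded_achievability \<open>b > 1\<close>)
  then show ?thesis
  proof (elim exE conjE)
    fix M \<epsilon> \<delta> enc dec
    assume code: "\<forall>n\<ge>1. M n \<ge> 1 \<and> (\<forall>m\<in>{1..M n}. set_pmf (enc n m) \<subseteq> words n) \<and>
      dec n \<in> words n \<rightarrow> {1..M n} \<and>
      average_error (degraded_wiretap_channel W1 W2) n (M n) (enc n) (dec n) \<le> \<epsilon> n \<and>
      relative_entropy b (?J n (M n) (enc n))
        (pair_pmf (map_pmf fst (?J n (M n) (enc n))) (map_pmf snd (?J n (M n) (enc n)))) \<le> \<delta> n"
      and lim: "\<epsilon> \<longlonglongrightarrow> 0" "\<delta> \<longlonglongrightarrow> 0" "asymptotic_rate b M \<ge> ereal R"
    show ?thesis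
      by (rule achievable_rate_degraded[OF \<open>b > 1\<close> code[THEN spec, THEN mp] lim])
  qed
qed

text \<open>A single message causes neither error nor leakage. This covers the rates below the range
  \<open>0 \<le> R\<close> of the random code.\<close>

lemma achievable_nonpositive_rate:
  fixes W1 :: "nat \<Rightarrow> 'x::finite \<Rightarrow> 'y::finite pmf" and W2 :: "nat \<Rightarrow> 'y \<Rightarrow> 'z::finite pmf"
  assumes "b > 1" "R \<le> 0"
  shows "achievable_rate b i (degraded_wiretap_channel W1 W2) R"
proof (rule achievable_rate_degraded[where M = "\<lambda>_. 1" and \<epsilon> = "\<lambda>_. 0" and \<delta> = "\<lambda>_. 0"
      and enc = "\<lambda>n _. return_pmf (SOME x. x \<in> words n)" and dec = "\<lambda>_ _. 1"])
  fix n :: nat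
  let ?x = "SOME x :: 'x word. x \<in> words n"
  let ?P = "message_output_pmf (degraded_wiretap_channel W1 W2) n 1 (\<lambda>_. return_pmf ?x)"
  have "?x \<in> words n" using words_nonempty by (rule some_in_eq[THEN iffD2])
  moreover have "relative_entropy b ?P (pair_pmf (map_pmf fst ?P) (map_pmf snd ?P)) \<le> 0"
  proof -
    have "?P = pair_pmf (return_pmf 1) (product_channel (\<lambda>k. cascade (W1 k) (W2 k)) n ?x)"
      by (simp add: message_output_pmf_degraded bind_return_pmf joint_pmf_const pmf_of_set_singleton)
    then have "pair_pmf (map_pmf fst ?P) (map_pmf snd ?P) = ?P"
      by (simp add: map_fst_pair_pmf map_snd_pair_pmf)
    then show ?thesis
      by (simp add: relative_entropy_def sigma_finite_measure.KL_same_eq_0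
          measure_pmf.sigma_finite_measure_axioms)
  qed
  moreover have "average_error (degraded_wiretap_channel W1 W2) n 1 (\<lambda>_. return_pmf ?x) (\<lambda>_. 1) \<le> 0"
    by (simp add: average_error_degraded vimage_def)
  ultimately show "(1::nat) \<ge> 1 \<and> (\<forall>m\<in>{1..1}. set_pmf (return_pmf ?x) \<subseteq> words n) \<and>
      (\<lambda>_ :: 'y word. 1 :: nat) \<in> words n \<rightarrow> {1..1} \<and>
      average_error (degraded_wiretap_channel W1 W2) n 1 (\<lambda>_. return_pmf ?x) (\<lambda>_. 1) \<le> 0 \<and>
      relative_entropy b ?P (pair_pmf (map_pmf fst ?P) (map_pmf snd ?P)) \<le> 0"
    by auto
next
  show "asymptotic_rate b (\<lambda>_. 1) \<ge> ereal R"
    using assms by (simp add: asymptotic_rate_def zero_ereal_def Liminf_const)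
qed (use assms in auto)

lemma leakage_S6_tendsto_0:
  fixes W1 :: "nat \<Rightarrow> 'x::finite \<Rightarrow> 'y::finite pmf" and W2 :: "nat \<Rightarrow> 'y \<Rightarrow> 'z::finite pmf"
  defines "W \<equiv> degraded_wiretap_channel W1 W2"
  assumes "b > 1" "i \<noteq> S5" "wiretap_code_sequence b i W M \<epsilon> \<delta> enc dec" "vanishing_leakage \<delta>" "\<eta> > 0"
  shows "(\<lambda>n. leakage b S6 W n (M n) (enc n) \<eta>) \<longlonglongrightarrow> 0"
proof (rule tendsto_sandwich)
  define c where "c = 1 + 1 / \<eta> + 1 / (1 - b powr (- \<eta>))"
  define g where "g = (\<lambda>n. \<delta> n \<eta> * c + 1 / (ln b * \<eta>) * (1 / real n))"
  have "b powr (- \<eta>) < 1" using assms by (simp add: powr_less_one)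
  then have "c \<ge> 0" using \<open>\<eta> > 0\<close> by (simp add: c_def)
  show "eventually (\<lambda>n. 0 \<le> leakage b S6 W n (M n) (enc n) \<eta>) sequentially"
    by (simp add: leakage_def Let_def log_ratio_tail_def)
  show "eventually (\<lambda>n. leakage b S6 W n (M n) (enc n) \<eta> \<le> g n) sequentially"
    using eventually_ge_at_top[of 1]
  proof eventually_elim
    case (elim n)
    let ?J = "message_output_pmf W n (M n) (enc n)"
    let ?Q = "pair_pmf (map_pmf fst ?J) (map_pmf snd ?J)"
    have code: "wiretap_code b i W n (M n) (\<epsilon> n) (\<delta> n) (enc n) (dec n)"
      using assms(4) elim by (simp add: wiretap_code_sequence_def)
    then have "M n \<ge> 1" by (simp add: wiretap_code_def)
    have "leakage b S6 W n (M n) (enc n) \<eta> = log_ratio_tail b (1 / real n) \<eta> ?J ?Q"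
      by (simp add: leakage_def Let_def)
    also have "\<dots> \<le> secrecy b i n \<eta> ?J ?Q * (1 + 1 / \<eta> + 1 / (1 - b powr (- \<eta>)))
        + 1 / (ln b * \<eta>) * (1 / real n)"
      unfolding W_def
      using message_output_support[of "M n" W1 W2 n "enc n", OF \<open>M n \<ge> 1\<close>] assms elim
      by (intro log_ratio_tail_le_secrecy) auto
    also have "secrecy b i n \<eta> ?J ?Q = leakage b i W n (M n) (enc n) \<eta>"
      by (simp add: leakage_def Let_def)
    also have "leakage b i W n (M n) (enc n) \<eta> * (1 + 1 / \<eta> + 1 / (1 - b powr (- \<eta>))) \<le> \<delta> n \<eta> * c"
      unfolding c_def[symmetric]
      using code \<open>\<eta> > 0\<close> \<open>c \<ge> 0\<close> by (intro mult_right_mono) (auto simp: wiretap_code_def)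
    finally show ?case by (simp add: g_def)
  qed
  have "g \<longlonglongrightarrow> 0 * c + 1 / (ln b * \<eta>) * 0"
    unfolding g_def using assms(5,6) unfolding vanishing_leakage_def
    by (intro tendsto_intros lim_1_over_n) auto
  then show "g \<longlonglongrightarrow> 0" by simp
qed simp

lemma wiretap_code_sequenceD:
  assumes "wiretap_code_sequence b i W M \<epsilon> \<delta> enc dec" "n \<ge> 1"
  shows "M n \<ge> 1" "m \<in> {1..M n} \<Longrightarrow> set_pmf (enc n m) \<subseteq> words n"
    "dec n \<in> words n \<rightarrow> {1..M n}" "average_error W n (M n) (enc n) (dec n) \<le> \<epsilon> n"
  using assms by (auto simp: wiretap_code_sequence_def wiretap_code_def)

section \<open>The metric \<open>S5\<close> and an eavesdropper with constant output\<close>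

definition blind_eavesdropper :: "nat \<Rightarrow> 'y \<Rightarrow> unit pmf" where
  "blind_eavesdropper k = (\<lambda>_. return_pmf ())"

lemma cascade_blind_eavesdropper: "cascade V (blind_eavesdropper k) = (\<lambda>_. return_pmf ())"
  by (simp add: fun_eq_iff cascade_def blind_eavesdropper_def)

lemma weakly_symmetric_blind: "weakly_symmetric (\<lambda>_ :: 'x::finite. return_pmf ())"
  by (auto simp: weakly_symmetric_def intro!: exI[of _ id])

lemma shannon_capacity_blind:
  assumes "b > 1"
  shows "shannon_capacity b (\<lambda>_ :: 'x::finite. return_pmf ()) = 0"
  using shannon_capacity_weakly_symmetric[OF assms weakly_symmetric_blind]
  by (simp add: UNIV_unit)

text \<open>With a constant output the joint law is already a product. The ratio is 1, or
  \<open>0 / 0 = 0\<close> off the support, and its logarithm is 0 in both cases.\<close>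

lemma leakage_S6_blind:
  fixes W1 :: "nat \<Rightarrow> 'x::finite \<Rightarrow> 'y::finite pmf"
  assumes "\<eta> > 0"
  shows "leakage b S6 (degraded_wiretap_channel W1 blind_eavesdropper) n M enc \<eta> = 0"
proof -
  have "product_channel (\<lambda>k. cascade (W1 k) (blind_eavesdropper k)) n =
      (\<lambda>_. return_pmf (\<lambda>k. if k \<in> {1..n} then () else undefined))"
    by (simp add: fun_eq_iff product_channel_def cascade_blind_eavesdropper)
  then have "message_output_pmf (degraded_wiretap_channel W1 blind_eavesdropper) n M enc =
      pair_pmf (pmf_of_set {1..M}) (return_pmf (\<lambda>k. if k \<in> {1..n} then () else undefined))"
    by (simp only: message_output_pmf_degraded bind_pmf_const joint_pmf_const)
  then have "leakage b S6 (degraded_wiretap_channel W1 blind_eavesdropper) n M enc \<eta> =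
      log_ratio_tail b (1 / real n) \<eta> (message_output_pmf (degraded_wiretap_channel W1 blind_eavesdropper) n M enc)
       (message_output_pmf (degraded_wiretap_channel W1 blind_eavesdropper) n M enc)"
    by (simp add: leakage_def Let_def map_fst_pair_pmf map_snd_pair_pmf)
  also have "\<dots> = 0"
  proof -
    have "\<not> 1 / real n * log b (p / p) > \<eta>" for p :: real
      using assms by (cases "p = 0") (auto simp: log_def)
    then show ?thesis by (simp add: log_ratio_tail_def)
  qed
  finally show ?thesis .
qed

lemma average_error_blind:
  "average_error (degraded_wiretap_channel W1 blind_eavesdropper) n M enc dec =
   average_error (degraded_wiretap_channel W1 (W2 :: nat \<Rightarrow> 'y::finite \<Rightarrow> 'z::finite pmf)) n M enc dec"
  by (simp add: average_error_def main_marginal_degraded)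

text \<open>
  The normalized variational distance is at most \<open>1 / n\<close>, so \<open>S5\<close> imposes no secrecy constraint
  and the problem reduces to an eavesdropper who observes nothing.
\<close>

lemma achievable_rate_S5:
  fixes W1 :: "nat \<Rightarrow> 'x::finite \<Rightarrow> 'y::finite pmf" and W2 :: "nat \<Rightarrow> 'y \<Rightarrow> 'z::finite pmf"
  assumes "achievable_rate b S1 (degraded_wiretap_channel W1 blind_eavesdropper) R"
  shows "achievable_rate b S5 (degraded_wiretap_channel W1 W2) R"
proof -
  let ?W = "degraded_wiretap_channel W1 blind_eavesdropper"
  obtain M \<epsilon> \<delta> enc dec where code: "wiretap_code_sequence b S1 ?W M \<epsilon> \<delta> enc dec"
    and lim: "\<epsilon> \<longlonglongrightarrow> 0" "asymptotic_rate b M \<ge> ereal R"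
    using assms unfolding achievable_rate_def by blast
  have leak: "leakage b S5 (degraded_wiretap_channel W1 W2) n M enc \<eta> \<le> 1 / real n" for n M enc \<eta>
    by (simp add: leakage_def Let_def divide_right_mono variational_distance_le_1)
  have "wiretap_code_sequence b S5 (degraded_wiretap_channel W1 W2) M \<epsilon> (\<lambda>n _. 1 / real n) enc dec"
    using code leak unfolding wiretap_code_sequence_def wiretap_code_def
    by (simp add: average_error_blind[of W1 _ _ _ _ W2])
  moreover have "vanishing_leakage (\<lambda>n _. 1 / real n)"
    by (simp add: vanishing_leakage_def lim_1_over_n)
  ultimately show ?thesis using lim unfolding achievable_rate_def by blast
qed

theorem theorem4:
  fixes b :: real
    and W1 :: "nat \<Rightarrow> 'x::finite \<Rightarrow> 'y::finite pmf"
    and W2 :: "nat \<Rightarrow> 'y \<Rightarrow> 'z::finite pmf"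
  assumes "b > 1"
    and "\<forall>k\<ge>1. weakly_symmetric (W1 k)"
    and "\<forall>k\<ge>1. weakly_symmetric (cascade (W1 k) (W2 k))"
    and "convergent (\<lambda>n. 1 / real n * (\<Sum>k=1..n. shannon_capacity b (W1 k)))"
    and "convergent (\<lambda>n. 1 / real n * (\<Sum>k=1..n. shannon_capacity b (cascade (W1 k) (W2 k))))"
  shows "\<forall>i. partial_strong_converse b i (degraded_wiretap_channel W1 W2)"
proof
  fix i
  have ws: "\<And>k. 1 \<le> k \<Longrightarrow> weakly_symmetric (W1 k)"
    "\<And>k. 1 \<le> k \<Longrightarrow> weakly_symmetric (cascade (W1 k) (W2 k))"
    using assms by auto
  obtain CY where CY: "(\<lambda>n. 1 / real n * (\<Sum>k=1..n. shannon_capacity b (W1 k))) \<longlonglongrightarrow> CY"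
    using assms(4) unfolding convergent_def by blast
  obtain CZ where CZ:
      "(\<lambda>n. 1 / real n * (\<Sum>k=1..n. shannon_capacity b (cascade (W1 k) (W2 k)))) \<longlonglongrightarrow> CZ"
    using assms(5) unfolding convergent_def by blast
  show "partial_strong_converse b i (degraded_wiretap_channel W1 W2)"
  proof (cases "i = S5")
    case False
    show ?thesis
    proof (rule partial_strong_converseI)
      show "achievable_rate b i (degraded_wiretap_channel W1 W2) R" if "R < CY - CZ" for R
      proof (cases "R \<le> 0")
        case False
        then show ?thesis
          by (intro degraded_achievable_rate[OF \<open>b > 1\<close> _ _ CY CZ _ that] ws) auto
      qed (rule achievable_nonpositive_rate[OF \<open>b > 1\<close>])
      show "strong_converse_rate b i (degraded_wiretap_channel W1 W2) R" if "R > CY - CZ" for R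
        unfolding strong_converse_rate_def
      proof (intro allI impI, elim conjE)
        fix M \<epsilon> \<delta> enc dec
        assume code: "wiretap_code_sequence b i (degraded_wiretap_channel W1 W2) M \<epsilon> \<delta> enc dec"
          and rate: "asymptotic_rate b M \<ge> ereal R" and leak: "vanishing_leakage \<delta>"
        show "liminf (\<lambda>n. ereal (\<epsilon> n)) \<ge> 1"
          by (rule degraded_strong_converse[OF \<open>b > 1\<close> _ _ CY CZ that _ _
                leakage_S6_tendsto_0[OF \<open>b > 1\<close> False code leak] rate])
             (use ws wiretap_code_sequenceD[OF code] in auto)
      qed
    qed
  next
    case True
    \<comment> \<open>The error depends on the main channel only, so codes pass between the two
      eavesdroppers in both directions. The blind cascade is weakly symmetric with capacity 0, which
      makes \<open>CY\<close> the common value.\<close>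
    let ?W = "degraded_wiretap_channel W1 blind_eavesdropper"
    have ws0: "weakly_symmetric (cascade (W1 k) (blind_eavesdropper k))" for k
      by (simp add: cascade_blind_eavesdropper weakly_symmetric_blind)
    have C0: "(\<lambda>n. 1 / real n * (\<Sum>k=1..n. shannon_capacity b (cascade (W1 k) (blind_eavesdropper k))))
        \<longlonglongrightarrow> 0"
      by (simp add: cascade_blind_eavesdropper shannon_capacity_blind[OF \<open>b > 1\<close>])
    show ?thesis
      unfolding True
    proof (rule partial_strong_converseI)
      \<comment> \<open>The form \<open>CY - 0\<close> is the instance \<open>CZ = 0\<close> of the
        general bounds.\<close>
      show "achievable_rate b S5 (degraded_wiretap_channel W1 W2) R" if "R < CY - 0" for R
      proof (rule achievable_rate_S5)
        show "achievable_rate b S1 ?W R"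
        proof (cases "R \<le> 0")
          case False
          then show ?thesis
            by (intro degraded_achievable_rate[OF \<open>b > 1\<close> _ _ CY C0 _ that] ws(1) ws0) auto
        qed (rule achievable_nonpositive_rate[OF \<open>b > 1\<close>])
      qed
      show "strong_converse_rate b S5 (degraded_wiretap_channel W1 W2) R" if "R > CY - 0" for R
        unfolding strong_converse_rate_def
      proof (intro allI impI, elim conjE)
        fix M \<epsilon> \<delta> enc dec
        assume code: "wiretap_code_sequence b S5 (degraded_wiretap_channel W1 W2) M \<epsilon> \<delta> enc dec"
          and rate: "asymptotic_rate b M \<ge> ereal R"
        have leak: "(\<lambda>n. leakage b S6 ?W n (M n) (enc n) \<eta>) \<longlonglongrightarrow> 0" if "\<eta> > 0" for \<eta>
          using that by (simp add: leakage_S6_blind)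
        have err: "average_error ?W n (M n) (enc n) (dec n) \<le> \<epsilon> n" if "n \<ge> 1" for n
          using wiretap_code_sequenceD(4)[OF code that] by (simp add: average_error_blind[of W1 _ _ _ _ W2])
        show "liminf (\<lambda>n. ereal (\<epsilon> n)) \<ge> 1"
          by (rule degraded_strong_converse[OF \<open>b > 1\<close> _ _ CY C0 that _ _ leak rate err])
             (use ws(1) ws0 wiretap_code_sequenceD[OF code] in auto)
      qed
    qed
  qed
qed

end
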